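(* Let $m,N,n_1,\ldots,n_m\ge1$ be integers. For $i=1,\ldots,m$ let $c_i>0$ and let $B_i:\mathbb{R}^N\to\mathbb{R}^{n_i}$ be linear maps such that $B_iB_i^*=I_{n_i}$ for every $i$ and $$\sum_{i=1}^m c_i B_i^*B_i=I_N.$$ If Borel functions $h:\mathbb{R}^N\to\mathbb{R}^+$ and $f_i:\mathbb{R}^{n_i}\to\mathbb{R}^+$ ($i=1,\ldots,m$) satisfy $$\forall x\in\mathbb{R}^N,\quad h(x)\le\prod_{i=1}^m f_i(B_ix)^{c_i},$$ then for all $t\ge0$ $$\forall x\in\mathbb{R}^N,\quad P_th(x)\le\prod_{i=1}^m \big(P_tf_i(B_ix)\big)^{c_i}.$$
   Context: $\mathbb{R}^+=[0,\infty)$; $B_i^*$ is the adjoint (transpose) of $B_i$ for the Euclidean structures, and $I_d$ is the identity of $\mathbb{R}^d$. For a nonnegative Borel function $f$ on $\mathbb{R}^d$ and $t\ge0$, the heat semigroup is $P_tf(x)=\int_{\mathbb{R}^d} f(x+\sqrt t\,y)\,\gamma_d(dy)\in[0,\infty]$, where $\gamma_d(dy)=(2\pi)^{-d/2}e^{-|y|^2/2}\,dy$ is the standard Gaussian measure on $\mathbb{R}^d$. The usual convention $0\cdot\infty=0$ is used in products. *)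

theory Defs
  imports "HOL-Analysis.Analysis"
begin

text \<open>
  The dimensions of the target spaces vary with an index, so Euclidean \<open>d\<close>-space is the set of
  real functions on \<open>{..<d}\<close> that are \<open>undefined\<close> elsewhere. This is the underlying set of the finite
  product measure \<open>Pi\<^sub>M {..<d} (\<lambda>_. lborel)\<close>, which is Lebesgue measure on the Borel sets
  (the product of finitely many copies of the Borel sigma-algebra of the line).
\<close>

definition euc :: "nat \<Rightarrow> (nat \<Rightarrow> real) set" where
  "euc d = {..<d} \<rightarrow>\<^sub>E UNIV"

definition euc_borel :: "nat \<Rightarrow> (nat \<Rightarrow> real) measure" where
  "euc_borel d = Pi\<^sub>M {..<d} (\<lambda>_. borel)"

definition euc_lborel :: "nat \<Rightarrow> (nat \<Rightarrow> real) measure" where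
  "euc_lborel d = Pi\<^sub>M {..<d} (\<lambda>_. lborel)"

definition euc_add :: "nat \<Rightarrow> (nat \<Rightarrow> real) \<Rightarrow> (nat \<Rightarrow> real) \<Rightarrow> (nat \<Rightarrow> real)" where
  "euc_add d x y = (\<lambda>k\<in>{..<d}. x k + y k)"

definition euc_scale :: "nat \<Rightarrow> real \<Rightarrow> (nat \<Rightarrow> real) \<Rightarrow> (nat \<Rightarrow> real)" where
  "euc_scale d a x = (\<lambda>k\<in>{..<d}. a * x k)"

definition euc_inner :: "nat \<Rightarrow> (nat \<Rightarrow> real) \<Rightarrow> (nat \<Rightarrow> real) \<Rightarrow> real" where
  "euc_inner d x y = (\<Sum>k<d. x k * y k)"

definition euc_unit :: "nat \<Rightarrow> nat \<Rightarrow> (nat \<Rightarrow> real)" where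
  "euc_unit d j = (\<lambda>k\<in>{..<d}. if k = j then 1 else 0)"

definition euc_linear :: "nat \<Rightarrow> nat \<Rightarrow> ((nat \<Rightarrow> real) \<Rightarrow> (nat \<Rightarrow> real)) \<Rightarrow> bool" where
  "euc_linear d e T \<longleftrightarrow>
     (\<forall>x\<in>euc d. T x \<in> euc e) \<and>
     (\<forall>x\<in>euc d. \<forall>y\<in>euc d. T (euc_add d x y) = euc_add e (T x) (T y)) \<and>
     (\<forall>a. \<forall>x\<in>euc d. T (euc_scale d a x) = euc_scale e a (T x))"

text \<open>The transpose; \<open>euc_adjoint_inner\<close> and \<open>euc_adjoint_unique\<close> below show that it is the adjoint.\<close>

definition euc_adjoint ::
  "nat \<Rightarrow> nat \<Rightarrow> ((nat \<Rightarrow> real) \<Rightarrow> (nat \<Rightarrow> real)) \<Rightarrow> ((nat \<Rightarrow> real) \<Rightarrow> (nat \<Rightarrow> real))" where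
  "euc_adjoint d e T = (\<lambda>y. \<lambda>j\<in>{..<d}. euc_inner e (T (euc_unit d j)) y)"

lemma euc_unit_mem: "euc_unit d j \<in> euc d"
  by (simp add: euc_unit_def euc_def)

lemma euc_inner_unit: "j < d \<Longrightarrow> euc_inner d (euc_unit d j) x = x j"
  by (simp add: euc_inner_def euc_unit_def if_distrib[of "\<lambda>a. a * _"] cong: if_cong)

lemma euc_adjoint_mem: "euc_adjoint d e T y \<in> euc d"
  by (simp add: euc_adjoint_def euc_def)

lemma euc_adjoint_inner:
  assumes T: "euc_linear d e T" and x: "x \<in> euc d"
  shows "euc_inner e (T x) y = euc_inner d x (euc_adjoint d e T y)"
proof -
  define p where "p n = (\<lambda>k\<in>{..<d}. if k < n then x k else 0)" for n
  have p_mem: "p n \<in> euc d" for n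
    by (simp add: p_def euc_def)
  have sc_mem: "euc_scale d a z \<in> euc d" for a z
    by (simp add: euc_scale_def euc_def)
  have inner_add: "euc_inner e (euc_add e u v) y = euc_inner e u y + euc_inner e v y" for u v
    by (simp add: euc_inner_def euc_add_def sum.distrib algebra_simps)
  have inner_scale: "euc_inner e (euc_scale e a u) y = a * euc_inner e u y" for a u
    by (simp add: euc_inner_def euc_scale_def sum_distrib_left algebra_simps)
  have scale: "T (euc_scale d a z) = euc_scale e a (T z)" if "z \<in> euc d" for a z
    using T that by (simp add: euc_linear_def)
  have add: "T (euc_add d u v) = euc_add e (T u) (T v)" if "u \<in> euc d" "v \<in> euc d" for u v
    using T that by (simp add: euc_linear_def)
  have "n \<le> d \<Longrightarrow> euc_inner e (T (p n)) y = (\<Sum>j<n. x j * euc_inner e (T (euc_unit d j)) y)" for n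
  proof (induction n)
    case 0
    have "p 0 = euc_scale d 0 (p 0)"
      by (auto simp: p_def euc_scale_def)
    then have "T (p 0) = euc_scale e 0 (T (p 0))"
      using scale[OF p_mem[of 0], of 0] by metis
    then have "euc_inner e (T (p 0)) y = 0 * euc_inner e (T (p 0)) y"
      using inner_scale by metis
    then show ?case by simp
  next
    case (Suc n)
    have "p (Suc n) = euc_add d (p n) (euc_scale d (x n) (euc_unit d n))"
      by (auto simp: p_def euc_add_def euc_scale_def euc_unit_def fun_eq_iff less_Suc_eq)
    then show ?case
      using Suc by (simp add: add p_mem sc_mem scale euc_unit_mem inner_add inner_scale)
  qed
  moreover have "p d = x"
    using x by (auto simp: p_def euc_def fun_eq_iff PiE_def extensional_def)
  ultimately show ?thesis
    by (auto simp: euc_inner_def[of d] euc_adjoint_def)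
qed

lemma euc_adjoint_unique:
  assumes T: "euc_linear d e T" and z: "z \<in> euc d"
    and eq: "\<And>x. x \<in> euc d \<Longrightarrow> euc_inner e (T x) y = euc_inner d x z"
  shows "z = euc_adjoint d e T y"
proof -
  have "z j = euc_adjoint d e T y j" if "j < d" for j
    using eq[OF euc_unit_mem[of d j]] that by (simp add: euc_inner_unit euc_adjoint_def)
  then show ?thesis
    using z euc_adjoint_mem[of d e T y] by (intro PiE_ext[of _ "{..<d}" "\<lambda>_. UNIV"]) (auto simp: euc_def)
qed

definition std_gaussian :: "nat \<Rightarrow> (nat \<Rightarrow> real) measure" where
  "std_gaussian d =
     density (euc_lborel d)
       (\<lambda>y. ennreal ((2 * pi) powr (- real d / 2) * exp (- euc_inner d y y / 2)))"

definition heat_semigroup ::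
  "nat \<Rightarrow> real \<Rightarrow> ((nat \<Rightarrow> real) \<Rightarrow> real) \<Rightarrow> (nat \<Rightarrow> real) \<Rightarrow> ennreal" where
  "heat_semigroup d t f x =
     (\<integral>\<^sup>+ y. ennreal (f (euc_add d x (euc_scale d (sqrt t) y))) \<partial>std_gaussian d)"

text \<open>Real powers on \<open>[0,\<infinity>]\<close>, for positive exponents only: \<open>\<infinity>\<close> is sent to \<open>\<infinity>\<close> and \<open>0\<close> to \<open>0\<close>.\<close>

definition ennreal_powr :: "ennreal \<Rightarrow> real \<Rightarrow> ennreal" where
  "ennreal_powr a c = (if a = \<infinity> then \<infinity> else ennreal (enn2real a powr c))"

end

theory Submission
  imports Defs "HOL-Probability.Distributions"
begin

text \<open>
  The inequality is a monotonicity statement for the heat flow: the product of the factors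
  \<open>P\<^sub>s f\<^sub>i (B\<^sub>i x)\<close>, raised to the powers \<open>c\<^sub>i\<close>, is a supersolution of the heat equation on
  \<open>\<real>\<^sup>N\<close>. The proof uses a version of this fact in discrete time, which never differentiates in time.
  Let \<open>F\<^sub>i = P\<^sub>s f\<^sub>i\<close> with \<open>f\<^sub>i\<close> bounded and bounded below by a positive number. For a step of
  length \<open>\<epsilon> = r\<^sup>2\<close> and a standard Gaussian vector \<open>y\<close> in \<open>\<real>\<^sup>N\<close>, divide
  \<open>F\<^sub>i (B\<^sub>i x + r B\<^sub>i y)\<close> by \<open>P\<^sub>\<epsilon> F\<^sub>i (B\<^sub>i x)\<close> and write the quotient as \<open>1 + w\<^sub>i\<close>. Up to an error
  of order \<open>r\<^sup>3\<close>,
  \<open>\<Prod> (1 + w\<^sub>i) powr c\<^sub>i = 1 + \<Sum> c\<^sub>i w\<^sub>i + ((\<Sum> c\<^sub>i w\<^sub>i)\<^sup>2 - \<Sum> c\<^sub>i w\<^sub>i\<^sup>2) / 2\<close>.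

  The mean of the linear term is of order \<open>r\<^sup>3\<close>, because \<open>B\<^sub>i y\<close> and a standard Gaussian vector of
  dimension \<open>n\<^sub>i\<close> have the same first two moments: this is where \<open>B\<^sub>i B\<^sub>i\<^sup>* = I\<close> enters, and it is
  Lindeberg's argument (lemma \<open>mean_taylor\<close>). To leading order \<open>w\<^sub>i\<close> is a linear form
  \<open>r \<langle>\<alpha>\<^sub>i, B\<^sub>i y\<rangle>\<close>, so the quadratic term has mean
  \<open>r\<^sup>2 (|\<Sum> c\<^sub>i B\<^sub>i\<^sup>* \<alpha>\<^sub>i|\<^sup>2 - \<Sum> c\<^sub>i |\<alpha>\<^sub>i|\<^sup>2) / 2\<close>, which is at most \<open>0\<close>; that is the dual form of
  \<open>|v|\<^sup>2 = \<Sum> c\<^sub>i |B\<^sub>i v|\<^sup>2\<close> (lemma \<open>gradient_inequality\<close>). Hence one step of length \<open>\<epsilon>\<close> satisfies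
  the inequality with a factor \<open>1 + K \<epsilon> powr (3/2)\<close> (lemma \<open>local_step\<close>). As \<open>K\<close> is uniform along
  the flow, \<open>m\<close> steps of length \<open>t / m\<close> lose a factor that tends to \<open>1\<close> (lemma \<open>heat_flow\<close>).

  The expansions need smooth \<open>F\<^sub>i\<close> with uniform bounds; these come from the smoothing time \<open>s \<ge> \<delta> > 0\<close>
  through the Cameron-Martin formula (lemma \<open>heat_taylor\<close>). Three limits then remove the assumptions
  on \<open>f\<^sub>i\<close>: \<open>\<delta> \<rightarrow> 0\<close> for continuous functions, approximation of bounded measurable functions from
  above by limits of continuous ones (lemma \<open>continuous_majorant\<close>), and truncation.
\<close>

section \<open>Gaussian product measures\<close>

definition gauss1 :: "real measure" where
  "gauss1 = density lborel std_normal_density"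

definition gauss :: "nat \<Rightarrow> (nat \<Rightarrow> real) measure" where
  "gauss d = Pi\<^sub>M {..<d} (\<lambda>_. gauss1)"

lemma sets_gauss1 [simp, measurable_cong]: "sets gauss1 = sets borel"
  by (simp add: gauss1_def)

lemma space_gauss1 [simp]: "space gauss1 = UNIV"
  by (simp add: gauss1_def)

lemma sets_gauss [simp, measurable_cong]: "sets (gauss d) = sets (euc_borel d)"
  by (auto simp: gauss_def euc_borel_def intro!: sets_PiM_cong)

lemma space_euc_borel [simp]: "space (euc_borel d) = euc d"
  by (simp add: euc_borel_def euc_def space_PiM)

lemma space_gauss [simp]: "space (gauss d) = euc d"
  using sets_eq_imp_space_eq[OF sets_gauss[of d]] by simp

lemma measurable_euc_coordinate: "k < d \<Longrightarrow> (\<lambda>x. x k) \<in> borel_measurable (euc_borel d)"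
  unfolding euc_borel_def by (rule measurable_component_singleton) simp

lemma measurable_gauss_coordinate: "k < d \<Longrightarrow> (\<lambda>x. x k) \<in> borel_measurable (gauss d)"
  using measurable_euc_coordinate[of k d] by simp

lemma measurable_euc_restrict:
  assumes "\<And>k. k < d \<Longrightarrow> (\<lambda>x. f x k) \<in> borel_measurable M"
  shows "(\<lambda>x. \<lambda>k\<in>{..<d}. f x k) \<in> measurable M (euc_borel d)"
  using assms unfolding euc_borel_def by (intro measurable_restrict) auto

lemmas measurable_euc_intros = measurable_euc_restrict borel_measurable_add borel_measurable_times
  borel_measurable_const measurable_euc_coordinate measurable_gauss_coordinate

lemma measurable_mult_gauss1 [simp]: "(*) (b :: real) \<in> borel_measurable gauss1"
  by (rule borel_measurable_times) measurable

interpretation gauss1: prob_space gauss1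
  unfolding gauss1_def by (rule prob_space_normal_density) simp

interpretation gauss_factors: product_prob_space "\<lambda>_::nat. gauss1" I for I
  by unfold_locales

interpretation gauss: prob_space "gauss d" for d
  unfolding gauss_def by (rule prob_space_PiM) (rule gauss1.prob_space_axioms)

text \<open>
  Identifies the standard Gaussian measure as a product measure, and reduces the density of a
  translated Gaussian vector to dimension one.
\<close>

lemma density_PiM:
  fixes M :: "'i \<Rightarrow> 'a measure" and f :: "'i \<Rightarrow> 'a \<Rightarrow> ennreal"
  assumes I: "finite I" and M: "\<And>i. sigma_finite_measure (M i)"
    and f [measurable]: "\<And>i. f i \<in> borel_measurable (M i)"
    and p: "\<And>i. sigma_finite_measure (density (M i) (f i))"
  shows "density (Pi\<^sub>M I M) (\<lambda>x. \<Prod>i\<in>I. f i (x i)) = Pi\<^sub>M I (\<lambda>i. density (M i) (f i))"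
proof -
  let ?D = "density (Pi\<^sub>M I M) (\<lambda>x. \<Prod>i\<in>I. f i (x i))"
  interpret M: product_sigma_finite M
    by (simp add: product_sigma_finite_def M)
  interpret N: product_sigma_finite "\<lambda>i. density (M i) (f i)"
    by (simp add: product_sigma_finite_def p)
  show ?thesis
  proof (rule N.PiM_eqI)
    show "sets ?D = sets (Pi\<^sub>M I (\<lambda>i. density (M i) (f i)))"
      by (auto intro!: sets_PiM_cong)
    fix A assume A: "\<And>i. i \<in> I \<Longrightarrow> A i \<in> sets (density (M i) (f i))"
    then have [measurable]: "Pi\<^sub>E I A \<in> sets (Pi\<^sub>M I M)"
      using I by (intro sets_PiM_I_finite) auto
    have "emeasure ?D (Pi\<^sub>E I A)
      = (\<integral>\<^sup>+ x. (\<Prod>i\<in>I. f i (x i)) * indicator (Pi\<^sub>E I A) x \<partial>Pi\<^sub>M I M)"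
      by (subst emeasure_density) auto
    also have "\<dots> = (\<integral>\<^sup>+ x. (\<Prod>i\<in>I. f i (x i) * indicator (A i) (x i)) \<partial>Pi\<^sub>M I M)"
    proof (intro nn_integral_cong)
      fix x assume x: "x \<in> space (Pi\<^sub>M I M)"
      have "indicator (Pi\<^sub>E I A) x = (\<Prod>i\<in>I. indicator (A i) (x i) :: ennreal)"
        using x I by (auto simp: indicator_def space_PiM PiE_iff prod_zero_iff split: if_splits)
      then show "(\<Prod>i\<in>I. f i (x i)) * indicator (Pi\<^sub>E I A) x = (\<Prod>i\<in>I. f i (x i) * indicator (A i) (x i))"
        by (simp add: prod.distrib)
    qed
    also have "\<dots> = (\<Prod>i\<in>I. \<integral>\<^sup>+ x. f i x * indicator (A i) x \<partial>M i)"
      using A by (intro M.product_nn_integral_prod I) auto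
    also have "\<dots> = (\<Prod>i\<in>I. emeasure (density (M i) (f i)) (A i))"
      using A by (intro prod.cong refl) (simp add: emeasure_density)
    finally show "emeasure ?D (Pi\<^sub>E I A)
      = (\<Prod>i\<in>I. emeasure (density (M i) (f i)) (A i))" .
  qed (fact I)
qed

text \<open>
  Translations and dilations act coordinate by coordinate, so this reduces their effect on a
  product measure to dimension one.
\<close>

lemma distr_PiM_componentwise:
  fixes M :: "'i \<Rightarrow> 'a measure" and f :: "'i \<Rightarrow> 'a \<Rightarrow> 'b"
  assumes I: "finite I" and M: "\<And>i. prob_space (M i)"
    and f [measurable]: "\<And>i. f i \<in> measurable (M i) (N i)"
  shows "distr (Pi\<^sub>M I M) (Pi\<^sub>M I N) (\<lambda>x. \<lambda>i\<in>I. f i (x i)) = Pi\<^sub>M I (\<lambda>i. distr (M i) (N i) (f i))"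
proof -
  let ?F = "\<lambda>x. \<lambda>i\<in>I. f i (x i)"
  have N: "prob_space (distr (M i) (N i) (f i))" for i
    by (intro prob_space.prob_space_distr M f)
  interpret M: product_sigma_finite M
    using M by (simp add: product_sigma_finite_def prob_space_imp_sigma_finite)
  interpret D: product_sigma_finite "\<lambda>i. distr (M i) (N i) (f i)"
    using N by (simp add: product_sigma_finite_def prob_space_imp_sigma_finite)
  show ?thesis
  proof (rule D.PiM_eqI)
    show "sets (distr (Pi\<^sub>M I M) (Pi\<^sub>M I N) ?F)
        = sets (Pi\<^sub>M I (\<lambda>i. distr (M i) (N i) (f i)))"
      by (auto intro!: sets_PiM_cong)
    fix A assume A: "\<And>i. i \<in> I \<Longrightarrow> A i \<in> sets (distr (M i) (N i) (f i))"
    then have "Pi\<^sub>E I A \<in> sets (Pi\<^sub>M I N)"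
      using I by (intro sets_PiM_I_finite) auto
    then have "emeasure (distr (Pi\<^sub>M I M) (Pi\<^sub>M I N) ?F) (Pi\<^sub>E I A)
      = emeasure (Pi\<^sub>M I M) (?F -` Pi\<^sub>E I A \<inter> space (Pi\<^sub>M I M))"
      by (intro emeasure_distr measurable_restrict) auto
    also have "?F -` Pi\<^sub>E I A \<inter> space (Pi\<^sub>M I M)
      = Pi\<^sub>E I (\<lambda>i. f i -` A i \<inter> space (M i))"
      by (auto simp: space_PiM PiE_iff)
    also have "emeasure (Pi\<^sub>M I M) \<dots> = (\<Prod>i\<in>I. emeasure (M i) (f i -` A i \<inter> space (M i)))"
      using A by (intro M.emeasure_PiM I) auto
    also have "\<dots> = (\<Prod>i\<in>I. emeasure (distr (M i) (N i) (f i)) (A i))"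
      using A by (intro prod.cong refl) (simp add: emeasure_distr)
    finally show "emeasure (distr (Pi\<^sub>M I M) (Pi\<^sub>M I N) ?F) (Pi\<^sub>E I A)
      = (\<Prod>i\<in>I. emeasure (distr (M i) (N i) (f i)) (A i))" .
  qed (fact I)
qed

lemma std_gaussian_eq: "std_gaussian d = gauss d"
proof -
  have "gauss d = density (Pi\<^sub>M {..<d} (\<lambda>_. lborel)) (\<lambda>x. \<Prod>i<d. ennreal (std_normal_density (x i)))"
    unfolding gauss_def gauss1_def
    by (intro density_PiM[symmetric] finite_lessThan sigma_finite_lborel)
       (use gauss1.sigma_finite_measure_axioms in \<open>auto simp: gauss1_def\<close>)
  also have "(\<lambda>x. \<Prod>i<d. ennreal (std_normal_density (x i)))
    = (\<lambda>y. ennreal ((2 * pi) powr (- real d / 2) * exp (- euc_inner d y y / 2)))"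
  proof
    fix y :: "nat \<Rightarrow> real"
    have "(\<Prod>i<d. std_normal_density (y i)) = (1 / sqrt (2 * pi)) ^ d * exp (\<Sum>i<d. - (y i)\<^sup>2 / 2)"
      by (subst exp_sum) (simp_all add: std_normal_density_def prod.distrib prod_dividef power_divide)
    also have "(1 / sqrt (2 * pi)) ^ d = (2 * pi) powr (- real d / 2)"
    proof -
      have "1 / sqrt (2 * pi) = (2 * pi) powr (- 1 / 2)"
        by (simp add: powr_minus_divide powr_half_sqrt)
      also have "\<dots> ^ d = (2 * pi) powr (- real d / 2)"
        by (subst powr_realpow[symmetric]) (simp_all add: powr_powr)
      finally show ?thesis .
    qed
    also have "(\<Sum>i<d. - (y i)\<^sup>2 / 2) = - euc_inner d y y / 2"
      by (simp add: euc_inner_def power2_eq_square sum_negf sum_divide_distrib)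
    finally have "(\<Prod>i<d. std_normal_density (y i))
      = (2 * pi) powr (- real d / 2) * exp (- euc_inner d y y / 2)" .
    then show "(\<Prod>i<d. ennreal (std_normal_density (y i)))
      = ennreal ((2 * pi) powr (- real d / 2) * exp (- euc_inner d y y / 2))"
      by (subst prod_ennreal) auto
  qed
  finally show ?thesis
    by (simp add: std_gaussian_def euc_lborel_def)
qed

text \<open>
  Completing the square: \<open>(v - \<eta>)\<^sup>2 / 2 = v\<^sup>2 / 2 - (\<eta> v - \<eta>\<^sup>2 / 2)\<close>.
\<close>

lemma distr_gauss1_shift:
  "distr gauss1 borel (\<lambda>v. v + \<eta>) = density gauss1 (\<lambda>v. ennreal (exp (\<eta> * v - \<eta>\<^sup>2 / 2)))"
proof (rule measure_eqI)
  fix A :: "real set" assume "A \<in> sets (distr gauss1 borel (\<lambda>v. v + \<eta>))"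
  then have [measurable]: "A \<in> sets borel" by simp
  have "emeasure (distr gauss1 borel (\<lambda>v. v + \<eta>)) A = (\<integral>\<^sup>+ v. indicator A (v + \<eta>) \<partial>gauss1)"
  proof -
    have "(\<integral>\<^sup>+ v. indicator A v \<partial>distr gauss1 borel (\<lambda>v. v + \<eta>)) = (\<integral>\<^sup>+ v. indicator A (v + \<eta>) \<partial>gauss1)"
      by (intro nn_integral_distr) measurable
    then show ?thesis by simp
  qed
  also have "\<dots> = (\<integral>\<^sup>+ v. ennreal (std_normal_density v) * indicator A (v + \<eta>) \<partial>lborel)"
    unfolding gauss1_def by (subst nn_integral_density) auto
  also have "\<dots> = (\<integral>\<^sup>+ v. ennreal (std_normal_density (v - \<eta>)) * indicator A v \<partial>lborel)"
    by (subst nn_integral_real_affine[where c=1 and t="-\<eta>"]) auto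
  also have "\<dots> = (\<integral>\<^sup>+ v. ennreal (std_normal_density v) * (ennreal (exp (\<eta> * v - \<eta>\<^sup>2 / 2)) * indicator A v) \<partial>lborel)"
  proof (intro nn_integral_cong)
    fix v :: real
    have "std_normal_density (v - \<eta>) = std_normal_density v * exp (\<eta> * v - \<eta>\<^sup>2 / 2)"
      by (simp add: std_normal_density_def exp_add[symmetric] power2_eq_square field_simps)
    then show "ennreal (std_normal_density (v - \<eta>)) * indicator A v
      = ennreal (std_normal_density v) * (ennreal (exp (\<eta> * v - \<eta>\<^sup>2 / 2)) * indicator A v)"
      by (simp add: ennreal_mult' mult.assoc)
  qed
  also have "\<dots> = (\<integral>\<^sup>+ v. ennreal (exp (\<eta> * v - \<eta>\<^sup>2 / 2)) * indicator A v \<partial>gauss1)"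
    unfolding gauss1_def by (subst nn_integral_density) auto
  also have "\<dots> = emeasure (density gauss1 (\<lambda>v. ennreal (exp (\<eta> * v - \<eta>\<^sup>2 / 2)))) A"
    by (subst emeasure_density) auto
  finally show "emeasure (distr gauss1 borel (\<lambda>v. v + \<eta>)) A
    = emeasure (density gauss1 (\<lambda>v. ennreal (exp (\<eta> * v - \<eta>\<^sup>2 / 2)))) A" .
qed simp

text \<open>
  A translation of the argument becomes a weight that is analytic in \<open>\<eta>\<close>. This is what allows
  averages of functions that are merely measurable to be expanded in powers of \<open>\<eta>\<close>.
\<close>

lemma cameron_martin:
  fixes \<Psi> :: "(nat \<Rightarrow> real) \<Rightarrow> real" and \<eta> :: "nat \<Rightarrow> real"
  assumes [measurable]: "\<Psi> \<in> borel_measurable (euc_borel d)"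
  shows "(\<integral>y. \<Psi> (\<lambda>k\<in>{..<d}. y k + \<eta> k) \<partial>gauss d)
       = (\<integral>y. exp ((\<Sum>k<d. \<eta> k * y k) - (\<Sum>k<d. (\<eta> k)\<^sup>2) / 2) * \<Psi> y \<partial>gauss d)"
proof -
  define \<rho> where "\<rho> i v = ennreal (exp (\<eta> i * v - (\<eta> i)\<^sup>2 / 2))" for i and v :: real
  have [measurable]: "\<rho> i \<in> borel_measurable gauss1" for i
    unfolding \<rho>_def by measurable
  have [measurable]: "(\<lambda>y. \<lambda>k\<in>{..<d}. y k + \<eta> k) \<in> measurable (gauss d) (euc_borel d)"
    unfolding gauss_def euc_borel_def by (intro measurable_restrict) auto
  have \<rho>: "(\<Prod>i<d. \<rho> i (y i)) = ennreal (exp ((\<Sum>k<d. \<eta> k * y k) - (\<Sum>k<d. (\<eta> k)\<^sup>2) / 2))" for y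
    unfolding \<rho>_def by (subst prod_ennreal) (auto simp: exp_sum[symmetric] sum_subtractf sum_divide_distrib)
  have sh: "distr gauss1 borel (\<lambda>v. v + \<eta> i) = density gauss1 (\<rho> i)" for i
    unfolding \<rho>_def by (rule distr_gauss1_shift)
  have "distr (gauss d) (euc_borel d) (\<lambda>y. \<lambda>k\<in>{..<d}. y k + \<eta> k)
    = Pi\<^sub>M {..<d} (\<lambda>i. distr gauss1 borel (\<lambda>v. v + \<eta> i))"
    unfolding gauss_def euc_borel_def
    by (intro distr_PiM_componentwise) (auto intro: gauss1.prob_space_axioms)
  also have "\<dots> = Pi\<^sub>M {..<d} (\<lambda>i. density gauss1 (\<rho> i))"
    unfolding sh ..
  also have "\<dots> = density (gauss d) (\<lambda>y. \<Prod>i<d. \<rho> i (y i))"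
    unfolding gauss_def
    by (intro density_PiM[symmetric])
       (auto intro!: gauss1.sigma_finite_measure_axioms prob_space_imp_sigma_finite
          gauss1.prob_space_distr simp: sh[symmetric])
  finally have eq: "distr (gauss d) (euc_borel d) (\<lambda>y. \<lambda>k\<in>{..<d}. y k + \<eta> k)
    = density (gauss d) (\<lambda>y. ennreal (exp ((\<Sum>k<d. \<eta> k * y k) - (\<Sum>k<d. (\<eta> k)\<^sup>2) / 2)))"
    unfolding \<rho> .
  have [measurable]: "(\<lambda>y. exp ((\<Sum>k<d. \<eta> k * y k) - (\<Sum>k<d. (\<eta> k)\<^sup>2) / 2)) \<in> borel_measurable (gauss d)"
    unfolding measurable_cong_sets[OF sets_gauss refl]
    by (rule measurable_compose[OF _ borel_measurable_exp])
       (intro borel_measurable_diff borel_measurable_sum borel_measurable_times borel_measurable_const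
          measurable_euc_coordinate, auto)
  have "(\<integral>y. \<Psi> (\<lambda>k\<in>{..<d}. y k + \<eta> k) \<partial>gauss d)
    = (\<integral>y. \<Psi> y \<partial>distr (gauss d) (euc_borel d) (\<lambda>y. \<lambda>k\<in>{..<d}. y k + \<eta> k))"
    by (subst integral_distr) auto
  also have "\<dots> = (\<integral>y. exp ((\<Sum>k<d. \<eta> k * y k) - (\<Sum>k<d. (\<eta> k)\<^sup>2) / 2) * \<Psi> y \<partial>gauss d)"
    unfolding eq by (subst integral_density) auto
  finally show ?thesis .
qed

lemma distr_to_lborel:
  "distr M lborel f = distr M gauss1 f" "distr M lborel f = distr M borel f"
  by (rule distr_cong; simp)+

text \<open>
  Stability of the normal law. A normal law of variance \<open>0\<close> has no density, so vanishing
  coefficients are separated off; they occur when one of the two times in the semigroup law is \<open>0\<close>.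
\<close>

lemma distr_gauss1_add:
  assumes "0 \<le> a" "0 \<le> b"
  shows "distr (gauss1 \<Otimes>\<^sub>M gauss1) borel (\<lambda>(u, v). a * u + b * v)
       = distr gauss1 borel (\<lambda>v. sqrt (a\<^sup>2 + b\<^sup>2) * v)"
proof -
  let ?GG = "gauss1 \<Otimes>\<^sub>M gauss1"
  interpret P: pair_prob_space gauss1 gauss1 ..

  have fst: "distr ?GG gauss1 fst = gauss1"
    by (rule gauss1.distr_pair_fst)
  have snd: "distr ?GG gauss1 snd = gauss1"
  proof -
    have "distr ?GG gauss1 snd
      = distr (distr ?GG ?GG (\<lambda>(x, y). (y, x))) gauss1 fst"
      by (subst distr_distr) (auto simp: comp_def split_beta)
    then show ?thesis
      unfolding P.distr_pair_swap[symmetric] fst .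
  qed
  consider "a = 0" | "b = 0" | "a > 0" "b > 0"
    using assms by fastforce
  then show ?thesis
  proof cases
    case 1
    have "distr ?GG borel (\<lambda>(u, v). a * u + b * v)
      = distr (distr ?GG gauss1 snd) borel (\<lambda>v. b * v)"
      by (subst distr_distr) (auto simp: comp_def 1 case_prod_unfold)
    then show ?thesis using assms 1 by (simp add: snd)
  next
    case 2
    have "distr ?GG borel (\<lambda>(u, v). a * u + b * v)
      = distr (distr ?GG gauss1 fst) borel (\<lambda>v. a * v)"
      by (subst distr_distr) (auto simp: comp_def 2 case_prod_unfold)
    then show ?thesis using assms 2 by (simp add: fst)
  next
    case 3
    have std: "distributed gauss1 lborel (\<lambda>v. v) std_normal_density"
      unfolding distributed_def by (auto simp: gauss1_def distr_id2)
    have f1: "distributed ?GG lborel fst std_normal_density"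
      unfolding distributed_def using fst distr_to_lborel(1)[of "?GG" fst]
      by (auto simp: gauss1_def[symmetric])
    have s1: "distributed ?GG lborel snd std_normal_density"
      unfolding distributed_def using snd distr_to_lborel(1)[of "?GG" snd]
      by (auto simp: gauss1_def[symmetric])
    have c: "0 < sqrt (a\<^sup>2 + b\<^sup>2)" using 3 by (simp add: sum_power2_gt_zero_iff)
    have ind: "P.indep_var borel (\<lambda>x. a * fst x) borel (\<lambda>x. b * snd x)"
    proof -
      have "P.indep_var gauss1 fst gauss1 snd"
        by (subst P.indep_var_distribution_eq) (auto simp: fst snd distr_id2)
      from P.indep_var_compose[OF this, of "\<lambda>u. a * u" borel "\<lambda>u. b * u" borel]
      show ?thesis by (simp add: comp_def)
    qed
    have "distributed ?GG lborel (\<lambda>x. a * fst x) (normal_density 0 a)"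
      using P.normal_density_affine[OF f1, of a 0] 3 by simp
    moreover have "distributed ?GG lborel (\<lambda>x. b * snd x) (normal_density 0 b)"
      using P.normal_density_affine[OF s1, of b 0] 3 by simp
    ultimately have "distributed ?GG lborel (\<lambda>x. a * fst x + b * snd x)
        (normal_density 0 (sqrt (a\<^sup>2 + b\<^sup>2)))"
      using P.add_indep_normal[OF ind 3, of 0 0] by simp
    moreover have "distributed gauss1 lborel (\<lambda>v. sqrt (a\<^sup>2 + b\<^sup>2) * v) (normal_density 0 (sqrt (a\<^sup>2 + b\<^sup>2)))"
      using gauss1.normal_density_affine[OF std _ less_imp_neq[OF c, symmetric], of 0] c by simp
    ultimately have "distr ?GG lborel (\<lambda>x. a * fst x + b * snd x)
       = distr gauss1 lborel (\<lambda>v. sqrt (a\<^sup>2 + b\<^sup>2) * v)"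
      by (simp add: distributed_def)
    then show ?thesis
      unfolding distr_to_lborel(2) by (simp add: case_prod_unfold)
  qed
qed

text \<open>
  On a box, Fubini's theorem splits the statement into a product of one-dimensional ones, and the
  boxes determine the measure.
\<close>

lemma distr_gauss_add:
  assumes "0 \<le> a" "0 \<le> b"
  shows "distr (gauss d \<Otimes>\<^sub>M gauss d) (euc_borel d) (\<lambda>(y, z). \<lambda>k\<in>{..<d}. a * y k + b * z k)
       = distr (gauss d) (euc_borel d) (\<lambda>y. \<lambda>k\<in>{..<d}. sqrt (a\<^sup>2 + b\<^sup>2) * y k)"
proof -
  let ?GG = "gauss d \<Otimes>\<^sub>M gauss d"
  let ?S = "\<lambda>(y, z). \<lambda>k\<in>{..<d}. a * y k + b * z k"
  define N where "N = distr gauss1 borel (\<lambda>v. sqrt (a\<^sup>2 + b\<^sup>2) * v)"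
  interpret N: prob_space N unfolding N_def by (rule gauss1.prob_space_distr) simp
  interpret NN: product_sigma_finite "\<lambda>_::nat. N" by unfold_locales
  interpret P: pair_prob_space "gauss d" "gauss d" ..
  interpret P1: pair_prob_space gauss1 gauss1 ..
  have m [measurable]: "?S \<in> measurable ?GG (euc_borel d)"
    unfolding split_beta
    by (intro measurable_euc_intros
          measurable_compose[OF measurable_fst measurable_gauss_coordinate]
          measurable_compose[OF measurable_snd measurable_gauss_coordinate]) auto
  have "distr ?GG (euc_borel d) ?S
    = Pi\<^sub>M {..<d} (\<lambda>_. N)"
  proof (rule NN.PiM_eqI)
    show "sets (distr ?GG (euc_borel d) ?S) =
      sets (Pi\<^sub>M {..<d} (\<lambda>_. N))"
      by (auto simp: N_def euc_borel_def intro!: sets_PiM_cong)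
    fix A :: "nat \<Rightarrow> real set" assume "\<And>i. i \<in> {..<d} \<Longrightarrow> A i \<in> sets N"
    then have A: "A i \<in> sets borel" if "i < d" for i using that by (simp add: N_def)
    have pair: "{x. a * fst x + b * snd x \<in> A k} \<in> sets (gauss1 \<Otimes>\<^sub>M gauss1)" if "k < d" for k
    proof -
      have "(\<lambda>x. a * fst x + b * snd x) -` A k \<inter> space (gauss1 \<Otimes>\<^sub>M gauss1) \<in> sets (gauss1 \<Otimes>\<^sub>M gauss1)"
        by (rule measurable_sets[OF _ A[OF that]]) measurable
      then show ?thesis by (simp add: space_pair_measure vimage_def)
    qed
    have sec: "(\<lambda>u. emeasure gauss1 {v. a * u + b * v \<in> A k}) \<in> borel_measurable gauss1" if "k < d" for k
      using gauss1.measurable_emeasure_Pair[OF pair[OF that]] by (simp add: vimage_def)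
    define S where "S = {(y, z). y \<in> euc d \<and> z \<in> euc d \<and> (\<forall>k<d. a * y k + b * z k \<in> A k)}"
    have PE: "Pi\<^sub>E {..<d} A \<in> sets (euc_borel d)"
      unfolding euc_borel_def using A by (intro sets_PiM_I_finite) auto
    have pre: "?S -` Pi\<^sub>E {..<d} A \<inter> space ?GG = S"
    proof (rule set_eqI)
      fix x :: "(nat \<Rightarrow> real) \<times> (nat \<Rightarrow> real)"
      obtain y z where x: "x = (y, z)" by (cases x)
      show "x \<in> ?S -` Pi\<^sub>E {..<d} A \<inter> space ?GG
        \<longleftrightarrow> x \<in> S"
        unfolding S_def x space_pair_measure by (simp add: PiE_iff) blast
    qed
    have S [measurable]: "S \<in> sets ?GG"
      using measurable_sets[OF m PE] unfolding pre .
    have "emeasure (distr ?GG (euc_borel d) ?S) (Pi\<^sub>E {..<d} A)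
      = emeasure ?GG S"
      by (subst emeasure_distr[OF m PE]) (simp only: pre)
    also have "\<dots> = (\<integral>\<^sup>+ y. emeasure (gauss d) (Pair y -` S) \<partial>gauss d)"
      by (rule gauss.emeasure_pair_measure_alt[OF S])
    also have "\<dots> = (\<integral>\<^sup>+ y. (\<Prod>k<d. emeasure gauss1 {v. a * y k + b * v \<in> A k}) \<partial>gauss d)"
    proof (intro nn_integral_cong)
      fix y assume y: "y \<in> space (gauss d)"
      then have "Pair y -` S = Pi\<^sub>E {..<d} (\<lambda>k. {v. a * y k + b * v \<in> A k})"
      proof (intro set_eqI)
        fix z show "z \<in> Pair y -` S \<longleftrightarrow> z \<in> Pi\<^sub>E {..<d} (\<lambda>k. {v. a * y k + b * v \<in> A k})"
          using y unfolding S_def by (simp add: euc_def PiE_iff) blast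
      qed
      then show "emeasure (gauss d) (Pair y -` S) = (\<Prod>k<d. emeasure gauss1 {v. a * y k + b * v \<in> A k})"
      proof -
        have "{v. a * y k + b * v \<in> A k} \<in> sets gauss1" if "k < d" for k
        proof -
          have "(\<lambda>v. a * y k + b * v) -` A k \<inter> space gauss1 \<in> sets gauss1"
            by (rule measurable_sets[OF _ A[OF that]]) measurable
          then show ?thesis by (simp add: vimage_def)
        qed
        then show ?thesis
          using \<open>Pair y -` S = _\<close> gauss_factors.emeasure_PiM[of "{..<d}" "\<lambda>k. {v. a * y k + b * v \<in> A k}"]
          by (simp add: gauss_def)
      qed
    qed
    also have "\<dots> = (\<Prod>k<d. \<integral>\<^sup>+ u. emeasure gauss1 {v. a * u + b * v \<in> A k} \<partial>gauss1)"
      unfolding gauss_def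
      by (intro gauss_factors.product_nn_integral_prod finite_lessThan sec) simp
    also have "\<dots> = (\<Prod>k<d. emeasure N (A k))"
    proof (intro prod.cong refl)
      fix k assume "k \<in> {..<d}"
      then have k: "k < d" by simp
      have "(\<integral>\<^sup>+ u. emeasure gauss1 {v. a * u + b * v \<in> A k} \<partial>gauss1)
        = emeasure (gauss1 \<Otimes>\<^sub>M gauss1) {x. a * fst x + b * snd x \<in> A k}"
        by (subst gauss1.emeasure_pair_measure_alt[OF pair[OF k]]) (simp add: vimage_def)
      also have "\<dots> = emeasure (distr (gauss1 \<Otimes>\<^sub>M gauss1) borel (\<lambda>(u, v). a * u + b * v)) (A k)"
        unfolding case_prod_unfold
        by (subst emeasure_distr[OF _ A[OF k]]) (measurable, simp add: space_pair_measure vimage_def)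
      also have "\<dots> = emeasure N (A k)"
        unfolding distr_gauss1_add[OF assms] N_def ..
      finally show "(\<integral>\<^sup>+ u. emeasure gauss1 {v. a * u + b * v \<in> A k} \<partial>gauss1) = emeasure N (A k)" .
    qed
    finally show "emeasure (distr ?GG (euc_borel d) ?S) (Pi\<^sub>E {..<d} A)
      = (\<Prod>k<d. emeasure N (A k))" .
  qed simp
  also have "\<dots> = distr (gauss d) (euc_borel d) (\<lambda>y. \<lambda>k\<in>{..<d}. sqrt (a\<^sup>2 + b\<^sup>2) * y k)"
    unfolding gauss_def euc_borel_def N_def
    by (intro distr_PiM_componentwise[symmetric]) (auto intro: gauss1.prob_space_axioms)
  finally show ?thesis .
qed

section \<open>Moments and the heat operator\<close>

text \<open>
  The \<open>\<ell>\<^sup>1\<close> norm of the first \<open>d\<close> coordinates. Its exponential is a product over the coordinates,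
  which makes exponential moments of Gaussian vectors one-dimensional.
\<close>

definition l1 :: "nat \<Rightarrow> (nat \<Rightarrow> real) \<Rightarrow> real" where
  "l1 d y = (\<Sum>k<d. \<bar>y k\<bar>)"

lemma l1_nonneg [simp]: "0 \<le> l1 d y"
  by (simp add: l1_def sum_nonneg)

lemma abs_le_l1: "k < d \<Longrightarrow> \<bar>y k\<bar> \<le> l1 d y"
  unfolding l1_def by (rule member_le_sum[of k "{..<d}" "\<lambda>k. \<bar>y k\<bar>"]) auto

text \<open>
  \<open>exp (\<eta> v - \<eta>\<^sup>2 / 2)\<close> is the density of a translated normal law, and
  \<open>exp (p \<bar>v\<bar>) \<le> exp (p v) + exp (- p v)\<close>.
\<close>

lemma integrable_gauss1_exp: "integrable gauss1 (\<lambda>v. exp (p * \<bar>v\<bar>))"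
proof -
  have e: "integrable gauss1 (\<lambda>v. exp (\<eta> * v))" for \<eta>
  proof -
    interpret D: prob_space "density gauss1 (\<lambda>v. ennreal (exp (\<eta> * v - \<eta>\<^sup>2 / 2)))"
      unfolding distr_gauss1_shift[symmetric] by (rule gauss1.prob_space_distr) measurable
    have "(\<integral>\<^sup>+ v. ennreal (exp (\<eta> * v - \<eta>\<^sup>2 / 2)) \<partial>gauss1) = 1"
      using D.emeasure_space_1 by (subst (asm) emeasure_density) (auto cong: nn_integral_cong)
    then have "integrable gauss1 (\<lambda>v. exp (\<eta> * v - \<eta>\<^sup>2 / 2))"
      by (intro integrableI_nonneg) auto
    then have "integrable gauss1 (\<lambda>v. exp (\<eta>\<^sup>2 / 2) * exp (\<eta> * v - \<eta>\<^sup>2 / 2))"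
      by (rule integrable_mult_right)
    then show ?thesis by (simp add: exp_add[symmetric])
  qed
  show ?thesis
  proof (rule Bochner_Integration.integrable_bound[OF Bochner_Integration.integrable_add[OF e[of p] e[of "-p"]]])
    show "AE v in gauss1. norm (exp (p * \<bar>v\<bar>)) \<le> norm (exp (p * v) + exp (- p * v))"
    proof (rule AE_I2)
      fix v
      have pos: "0 < exp (p * v)" "0 < exp (- p * v)" by simp_all
      have "exp (p * \<bar>v\<bar>) \<le> exp (p * v) + exp (- p * v)"
        by (cases "v < 0") (simp_all add: abs_if)
      then show "norm (exp (p * \<bar>v\<bar>)) \<le> norm (exp (p * v) + exp (- p * v))"
        using pos by (simp only: real_norm_def abs_of_pos exp_gt_zero add_pos_pos)
    qed
  qed measurable
qed

lemma integral_gauss1_moments: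
  "integrable gauss1 (\<lambda>v. v)" "(\<integral>v. v \<partial>gauss1) = 0"
  "integrable gauss1 (\<lambda>v. v\<^sup>2)" "(\<integral>v. v\<^sup>2 \<partial>gauss1) = 1"
  using std_normal_moment_odd[of 0] std_normal_moment_even[of 1] unfolding gauss1_def
  by (auto simp: has_bochner_integral_iff integrable_density integral_density)

lemma gauss_integral_prod:
  fixes g :: "nat \<Rightarrow> real \<Rightarrow> real"
  assumes "\<And>k. k < d \<Longrightarrow> integrable gauss1 (g k)"
  shows "integrable (gauss d) (\<lambda>y. \<Prod>k<d. g k (y k))"
    and "(\<integral>y. (\<Prod>k<d. g k (y k)) \<partial>gauss d) = (\<Prod>k<d. \<integral>v. g k v \<partial>gauss1)"
  unfolding gauss_def
  by (rule gauss_factors.product_integrable_prod gauss_factors.product_integral_prod; use assms in simp)+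

text \<open>
  The monomial \<open>y k * y l\<close> is a product over all coordinates of functions of one variable, most of
  them constant.
\<close>

lemma gauss_second_moment:
  assumes "k < d" "l < d"
  shows "integrable (gauss d) (\<lambda>y. y k * y l)"
    and "(\<integral>y. y k * y l \<partial>gauss d) = (if k = l then 1 else 0)"
proof -
  define g where "g j v = (if j = k then v else 1) * (if j = l then v else 1)" for j :: nat and v :: real
  have g: "integrable gauss1 (g j)" for j
    unfolding g_def using integral_gauss1_moments(1) integral_gauss1_moments(3)[unfolded power2_eq_square]
    by (cases "j = k"; cases "j = l") simp_all
  have eq: "(\<Prod>j<d. g j (y j)) = y k * y l" for y
    unfolding g_def using assms by (simp add: prod.distrib prod.delta)
  note * = gauss_integral_prod[of d g, OF g]
  show "integrable (gauss d) (\<lambda>y. y k * y l)"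
    using *(1) by (simp add: eq)
  have "(\<Prod>j<d. \<integral>v. g j v \<partial>gauss1) = (if k = l then 1 else 0)"
  proof (cases "k = l")
    case True
    then have "(\<integral>v. g j v \<partial>gauss1) = 1" for j
      using integral_gauss1_moments(4)[unfolded power2_eq_square] gauss1.prob_space
      by (cases "j = l") (simp_all add: g_def)
    then show ?thesis using True by simp
  next
    case False
    then have "(\<integral>v. g k v \<partial>gauss1) = 0"
      using integral_gauss1_moments(2) by (simp add: g_def)
    then show ?thesis using False assms by (auto intro!: prod_zero)
  qed
  then show "(\<integral>y. y k * y l \<partial>gauss d) = (if k = l then 1 else 0)"
    using *(2) by (simp add: eq)
qed

lemma gauss_first_moment:
  assumes "k < d"
  shows "integrable (gauss d) (\<lambda>y. y k)" and "(\<integral>y. y k \<partial>gauss d) = 0"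
proof -
  define g where "g j v = (if j = k then v else 1)" for j :: nat and v :: real
  have g: "integrable gauss1 (g j)" for j
    unfolding g_def using integral_gauss1_moments(1) by (cases "j = k") simp_all
  have eq: "(\<Prod>j<d. g j (y j)) = y k" for y
    unfolding g_def using assms by (simp add: prod.delta)
  note * = gauss_integral_prod[of d g, OF g]
  show "integrable (gauss d) (\<lambda>y. y k)"
    using *(1) by (simp add: eq)
  have "(\<integral>v. g k v \<partial>gauss1) = 0"
    using integral_gauss1_moments(2) by (simp add: g_def)
  then have "(\<Prod>j<d. \<integral>v. g j v \<partial>gauss1) = 0"
    using assms by (auto intro!: prod_zero)
  then show "(\<integral>y. y k \<partial>gauss d) = 0"
    using *(2) by (simp add: eq)
qed

text \<open>
  The mean of the function that dominates the error terms: powers and exponentials of \<open>l1 d y\<close> are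
  bounded by a multiple of such an exponential, and the mean then enters the constants.
\<close>

definition gauss_exp :: "nat \<Rightarrow> real \<Rightarrow> real" where
  "gauss_exp d p = (\<integral>y. exp (p * (1 + l1 d y)) \<partial>gauss d)"

lemma gauss_exp_nonneg: "0 \<le> gauss_exp d p"
  unfolding gauss_exp_def by (rule integral_nonneg_AE) simp

lemma integrable_gauss_exp: "integrable (gauss d) (\<lambda>y. exp (p * (1 + l1 d y)))"
proof -
  have "integrable (gauss d) (\<lambda>y. exp p * (\<Prod>k<d. exp (p * \<bar>y k\<bar>)))"
    by (intro integrable_mult_right gauss_integral_prod integrable_gauss1_exp)
  then show ?thesis
    by (simp add: l1_def exp_sum[symmetric] exp_add[symmetric] distrib_left sum_distrib_left)
qed

lemma integrable_gauss_bound: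
  fixes f :: "(nat \<Rightarrow> real) \<Rightarrow> real"
  assumes "f \<in> borel_measurable (gauss d)"
    and "\<And>y. y \<in> euc d \<Longrightarrow> \<bar>f y\<bar> \<le> C * exp (p * (1 + l1 d y))"
  shows "integrable (gauss d) f"
proof (rule Bochner_Integration.integrable_bound)
  show "integrable (gauss d) (\<lambda>y. C * exp (p * (1 + l1 d y)))"
    by (intro integrable_mult_right integrable_gauss_exp)
  show "AE y in gauss d. norm (f y) \<le> norm (C * exp (p * (1 + l1 d y)))"
  proof (rule AE_I2)
    fix y assume "y \<in> space (gauss d)"
    then have "\<bar>f y\<bar> \<le> C * exp (p * (1 + l1 d y))" using assms(2) by simp
    also have "\<dots> \<le> \<bar>C * exp (p * (1 + l1 d y))\<bar>" by (rule abs_ge_self)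
    finally show "norm (f y) \<le> norm (C * exp (p * (1 + l1 d y)))" by simp
  qed
qed fact

lemma integral_gauss_bound:
  fixes f :: "(nat \<Rightarrow> real) \<Rightarrow> real"
  assumes f: "f \<in> borel_measurable (gauss d)"
    and b: "\<And>y. y \<in> euc d \<Longrightarrow> \<bar>f y\<bar> \<le> C * exp (p * (1 + l1 d y))"
  shows "\<bar>\<integral>y. f y \<partial>gauss d\<bar> \<le> C * gauss_exp d p"
proof -
  have i: "integrable (gauss d) f" by (rule integrable_gauss_bound[OF f b])
  have "\<bar>\<integral>y. f y \<partial>gauss d\<bar> \<le> (\<integral>y. \<bar>f y\<bar> \<partial>gauss d)"
    by (rule integral_abs_bound)
  also have "\<dots> \<le> (\<integral>y. C * exp (p * (1 + l1 d y)) \<partial>gauss d)"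
    using b by (intro integral_mono integrable_mult_right integrable_gauss_exp integrable_abs i) auto
  finally show ?thesis by (simp add: gauss_exp_def)
qed

text \<open>
  The heat semigroup on bounded functions, with real values. The point \<open>x\<close> may be any function: the
  restriction inside keeps the first \<open>d\<close> coordinates, so points need not be restricted beforehand.
\<close>

definition heat :: "nat \<Rightarrow> real \<Rightarrow> ((nat \<Rightarrow> real) \<Rightarrow> real) \<Rightarrow> (nat \<Rightarrow> real) \<Rightarrow> real" where
  "heat d t F x = (\<integral>y. F (\<lambda>k\<in>{..<d}. x k + sqrt t * y k) \<partial>gauss d)"

lemma restrict_in_euc [simp]: "restrict f {..<d} \<in> euc d"
  by (simp add: euc_def)

lemma measurable_move [measurable]:
  "(\<lambda>y. \<lambda>k\<in>{..<d}. x k + r * y k) \<in> measurable (gauss d) (euc_borel d)"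
  by (intro measurable_euc_intros)

lemma measurable_move2 [measurable]:
  "(\<lambda>z. \<lambda>k\<in>{..<d}. fst z k + r * snd z k) \<in> measurable (euc_borel d \<Otimes>\<^sub>M gauss d) (euc_borel d)"
  by (intro measurable_euc_intros measurable_compose[OF measurable_fst measurable_euc_coordinate]
        measurable_compose[OF measurable_snd measurable_gauss_coordinate])

lemma heat_cong: "(\<And>k. k < d \<Longrightarrow> x k = x' k) \<Longrightarrow> heat d t F x = heat d t F x'"
  unfolding heat_def by (intro Bochner_Integration.integral_cong arg_cong[of _ _ F]) auto

lemma measurable_heat [measurable]:
  assumes [measurable]: "F \<in> borel_measurable (euc_borel d)"
  shows "heat d t F \<in> borel_measurable (euc_borel d)"
proof -
  have "(\<lambda>z. F (\<lambda>k\<in>{..<d}. fst z k + sqrt t * snd z k)) \<in> borel_measurable (euc_borel d \<Otimes>\<^sub>M gauss d)"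
    by (rule measurable_compose[OF measurable_move2]) fact
  then show ?thesis
    unfolding heat_def by (intro gauss.borel_measurable_lebesgue_integral) (simp add: case_prod_unfold)
qed

lemma integrable_gauss_bounded:
  fixes F :: "(nat \<Rightarrow> real) \<Rightarrow> real"
  assumes "F \<in> borel_measurable (gauss d)" "\<And>y. y \<in> euc d \<Longrightarrow> \<bar>F y\<bar> \<le> M"
  shows "integrable (gauss d) F"
  using assms by (intro gauss.integrable_const_bound[where B=M]) (auto intro!: AE_I2)

lemma integrable_heat:
  fixes F :: "(nat \<Rightarrow> real) \<Rightarrow> real"
  assumes [measurable]: "F \<in> borel_measurable (euc_borel d)" and "\<And>y. y \<in> euc d \<Longrightarrow> \<bar>F y\<bar> \<le> M"
  shows "integrable (gauss d) (\<lambda>y. F (\<lambda>k\<in>{..<d}. x k + r * y k))"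
  using assms by (intro integrable_gauss_bounded[of _ _ M]) auto

lemma heat_bounds:
  assumes F: "F \<in> borel_measurable (euc_borel d)" and lo: "\<And>y. y \<in> euc d \<Longrightarrow> lo \<le> F y"
    and hi: "\<And>y. y \<in> euc d \<Longrightarrow> F y \<le> hi"
  shows "lo \<le> heat d t F x" "heat d t F x \<le> hi"
proof -
  have i: "integrable (gauss d) (\<lambda>y. F (\<lambda>k\<in>{..<d}. x k + sqrt t * y k))"
  proof (rule integrable_heat[OF F])
    fix y assume "y \<in> euc d" then show "\<bar>F y\<bar> \<le> max \<bar>lo\<bar> \<bar>hi\<bar>" using lo[of y] hi[of y] by linarith
  qed
  show "lo \<le> heat d t F x"
    unfolding heat_def by (intro gauss.integral_ge_const[OF i] AE_I2 lo) simp
  show "heat d t F x \<le> hi"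
    unfolding heat_def by (intro gauss.integral_le_const[OF i] AE_I2 hi) simp
qed

lemma heat_mono:
  assumes F: "F \<in> borel_measurable (euc_borel d)" and bF: "\<And>y. y \<in> euc d \<Longrightarrow> \<bar>F y\<bar> \<le> M"
    and G: "G \<in> borel_measurable (euc_borel d)" and bG: "\<And>y. y \<in> euc d \<Longrightarrow> \<bar>G y\<bar> \<le> M'"
    and le: "\<And>y. y \<in> euc d \<Longrightarrow> F y \<le> G y"
  shows "heat d t F x \<le> heat d t G x"
  unfolding heat_def using le
  by (intro integral_mono integrable_heat[OF F bF] integrable_heat[OF G bG]) auto

lemma heat_mult: "heat d t (\<lambda>y. c * F y) x = c * heat d t F x"
  unfolding heat_def by simp

text \<open>
  The semigroup law: a sum of two independent Gaussian increments is one Gaussian increment whose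
  variance is the sum of the variances.
\<close>

lemma heat_add_time:
  assumes [measurable]: "F \<in> borel_measurable (euc_borel d)" and bF: "\<And>y. y \<in> euc d \<Longrightarrow> \<bar>F y\<bar> \<le> M"
    and st: "0 \<le> s" "0 \<le> t"
  shows "heat d s (heat d t F) x = heat d (s + t) F x"
proof -
  let ?S = "\<lambda>(y, z). \<lambda>k\<in>{..<d}. sqrt s * y k + sqrt t * z k"
  interpret P: pair_prob_space "gauss d" "gauss d" ..
  define H where "H z = F (\<lambda>k\<in>{..<d}. x k + z k)" for z
  have [measurable]: "(\<lambda>z. \<lambda>k\<in>{..<d}. x k + z k) \<in> measurable (euc_borel d) (euc_borel d)"
    by (intro measurable_euc_intros)
  have Hm [measurable]: "H \<in> borel_measurable (euc_borel d)"
    unfolding H_def by measurable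
  have m [measurable]: "?S
      \<in> measurable (gauss d \<Otimes>\<^sub>M gauss d) (euc_borel d)"
    unfolding split_beta
    by (intro measurable_euc_intros
          measurable_compose[OF measurable_fst measurable_gauss_coordinate]
          measurable_compose[OF measurable_snd measurable_gauss_coordinate]) auto
  have m1: "(\<lambda>y. \<lambda>k\<in>{..<d}. c * y k) \<in> measurable (gauss d) (euc_borel d)" for c
    by (intro measurable_euc_intros)
  have bH: "\<bar>H z\<bar> \<le> M" for z
    unfolding H_def by (intro bF) simp
  have "heat d s (heat d t F) x
    = (\<integral>y. (\<integral>z. H (\<lambda>k\<in>{..<d}. sqrt s * y k + sqrt t * z k) \<partial>gauss d) \<partial>gauss d)"
    unfolding heat_def H_def
    by (intro Bochner_Integration.integral_cong arg_cong[of _ _ F] refl) (auto simp: algebra_simps)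
  also have "\<dots> = (\<integral>w. H (?S w) \<partial>(gauss d \<Otimes>\<^sub>M gauss d))"
  proof (subst P.integral_fst'[symmetric])
    show "integrable (gauss d \<Otimes>\<^sub>M gauss d) (\<lambda>w. H (?S w))"
      by (intro P.integrable_const_bound[where B=M] AE_I2) (simp_all add: bH measurable_compose[OF m Hm])
  qed simp
  also have "\<dots> = (\<integral>z. H z \<partial>distr (gauss d \<Otimes>\<^sub>M gauss d) (euc_borel d)
      ?S)"
    by (rule integral_distr[OF m Hm, symmetric])
  also have "\<dots> = (\<integral>z. H z \<partial>distr (gauss d) (euc_borel d) (\<lambda>y. \<lambda>k\<in>{..<d}. sqrt (s + t) * y k))"
    using st by (subst distr_gauss_add) auto
  also have "\<dots> = (\<integral>y. H (\<lambda>k\<in>{..<d}. sqrt (s + t) * y k) \<partial>gauss d)"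
    by (rule integral_distr[OF m1 Hm])
  also have "\<dots> = heat d (s + t) F x"
    unfolding heat_def H_def
    by (intro Bochner_Integration.integral_cong arg_cong[of _ _ F] refl) auto
  finally show ?thesis .
qed

section \<open>Elementary expansions\<close>

lemma exp_taylor3: "\<bar>exp r - (1 + r + r\<^sup>2 / 2)\<bar> \<le> \<bar>r\<bar> ^ 3 * exp \<bar>r\<bar> / (6::real)"
proof -
  obtain t where t: "\<bar>t\<bar> \<le> \<bar>r\<bar>" "exp r = (\<Sum>m<3. r ^ m / fact m) + exp t / fact 3 * r ^ 3"
    using Maclaurin_exp_le[of r 3] by blast
  have "exp r - (1 + r + r\<^sup>2 / 2) = exp t * r ^ 3 / 6"
    using t(2) by (simp add: numeral_3_eq_3 power2_eq_square field_simps)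
  then have "\<bar>exp r - (1 + r + r\<^sup>2 / 2)\<bar> = \<bar>exp t * r ^ 3 / 6\<bar>"
    by (rule arg_cong)
  also have "\<dots> = \<bar>r\<bar> ^ 3 * exp t / 6"
    by (simp only: abs_mult abs_divide power_abs[symmetric]) simp
  also have "\<bar>r\<bar> ^ 3 * exp t / 6 \<le> \<bar>r\<bar> ^ 3 * exp \<bar>r\<bar> / 6"
    using t(1) by (intro divide_right_mono mult_left_mono) auto
  finally show ?thesis .
qed

lemma cube_le_exp: "0 \<le> x \<Longrightarrow> x ^ 3 \<le> 6 * exp (x::real)"
proof -
  assume x: "0 \<le> x"
  obtain t where t: "exp x = (\<Sum>m<4. x ^ m / fact m) + exp t / fact 4 * x ^ 4"
    using Maclaurin_exp_le[of x 4] by blast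
  have "0 \<le> exp t / fact 4 * x ^ 4" using x by simp
  moreover have "(\<Sum>m<4. x ^ m / fact m) = 1 + x + x ^ 2 / 2 + x ^ 3 / 6"
    by (simp add: eval_nat_numeral)
  moreover have "0 \<le> x ^ 2" by simp
  ultimately show ?thesis using t x by linarith
qed

text \<open>
  The function \<open>w - w\<^sup>2 / 2 + w\<^sup>3 / 3 - ln (1 + w)\<close> has derivative \<open>w\<^sup>3 / (1 + w)\<close>, so its minimum
  is its value \<open>0\<close> at \<open>w = 0\<close>.
\<close>

lemma ln_le_cubic:
  assumes "-1 < (w::real)"
  shows "ln (1 + w) \<le> w - w\<^sup>2 / 2 + \<bar>w\<bar> ^ 3"
proof -
  define \<phi> where "\<phi> v = v - v\<^sup>2 / 2 + v ^ 3 / 3 - ln (1 + v)" for v :: real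
  have D: "(\<phi> has_real_derivative v ^ 3 / (1 + v)) (at v)" if "-1 < v" for v
    unfolding \<phi>_def using that
    by (auto intro!: derivative_eq_intros simp: power2_eq_square power3_eq_cube field_simps)
  have "\<phi> 0 \<le> \<phi> w"
  proof (cases "0 \<le> w")
    case True
    show ?thesis
    proof (rule DERIV_nonneg_imp_nondecreasing[OF True])
      fix x assume "0 \<le> x" "x \<le> w"
      then show "\<exists>y. (\<phi> has_real_derivative y) (at x) \<and> 0 \<le> y"
        using D[of x] by (intro exI[of _ "x ^ 3 / (1 + x)"]) auto
    qed
  next
    case False
    show ?thesis
    proof (rule DERIV_nonpos_imp_nonincreasing[of w 0])
      show "w \<le> 0" using False by simp
      fix x assume x: "w \<le> x" "x \<le> 0"
      then have "x ^ 3 / (1 + x) \<le> 0"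
        using assms by (intro divide_nonpos_pos) (auto simp: power_le_zero_eq)
      then show "\<exists>y. (\<phi> has_real_derivative y) (at x) \<and> y \<le> 0"
        using D[of x] x assms by (intro exI[of _ "x ^ 3 / (1 + x)"]) auto
    qed
  qed
  then have "ln (1 + w) \<le> w - w\<^sup>2 / 2 + w ^ 3 / 3" by (simp add: \<phi>_def)
  also have "w ^ 3 / 3 \<le> \<bar>w\<bar> ^ 3"
  proof -
    have "w ^ 3 \<le> \<bar>w\<bar> ^ 3" by (metis abs_ge_self power_abs)
    moreover have "0 \<le> \<bar>w\<bar> ^ 3" by simp
    ultimately show ?thesis by linarith
  qed
  finally show ?thesis by simp
qed

text \<open>
  The product is \<open>exp T\<close> with \<open>T = \<Sum> c\<^sub>i ln (1 + w\<^sub>i)\<close>. Expanding the logarithms contributes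
  \<open>- \<Sum> c\<^sub>i w\<^sub>i\<^sup>2 / 2\<close>, expanding the exponential contributes \<open>(\<Sum> c\<^sub>i w\<^sub>i)\<^sup>2 / 2\<close>, and the competition of
  these two terms decides the theorem. The bounds \<open>\<kappa>\<close> and \<open>M\<close> keep the cubic errors uniform.
\<close>

lemma prod_powr_second_order:
  fixes c :: "'i \<Rightarrow> real"
  assumes fin: "finite I" and c: "\<And>i. i \<in> I \<Longrightarrow> 0 \<le> c i" and \<kappa>: "0 < \<kappa>" "\<kappa> \<le> 1" and M: "0 \<le> M"
  shows "\<exists>C\<ge>0. \<forall>w \<tau>. 0 \<le> \<tau> \<longrightarrow> (\<forall>i\<in>I. \<kappa> \<le> 1 + w i \<and> \<bar>w i\<bar> \<le> M \<and> \<bar>w i\<bar> \<le> \<tau>) \<longrightarrow>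
    (\<Prod>i\<in>I. (1 + w i) powr c i) \<le>
      1 + (\<Sum>i\<in>I. c i * w i) + ((\<Sum>i\<in>I. c i * w i)\<^sup>2 - (\<Sum>i\<in>I. c i * (w i)\<^sup>2)) / 2 + C * \<tau> ^ 3"
proof -
  define S where "S = (\<Sum>i\<in>I. c i)"
  have S: "0 \<le> S" unfolding S_def using c by (simp add: sum_nonneg)
  define C where "C = S + (S / \<kappa>) * (S / \<kappa> + S) / 2 + (S / \<kappa>) ^ 3 * exp (S * M / \<kappa>)"
  have "0 \<le> C" unfolding C_def using S \<kappa> by simp
  moreover have "(\<Prod>i\<in>I. (1 + w i) powr c i) \<le>
      1 + (\<Sum>i\<in>I. c i * w i) + ((\<Sum>i\<in>I. c i * w i)\<^sup>2 - (\<Sum>i\<in>I. c i * (w i)\<^sup>2)) / 2 + C * \<tau> ^ 3"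
    if \<tau>: "0 \<le> \<tau>" and w: "\<forall>i\<in>I. \<kappa> \<le> 1 + w i \<and> \<bar>w i\<bar> \<le> M \<and> \<bar>w i\<bar> \<le> \<tau>" for w \<tau>
  proof -
    define l where "l i = ln (1 + w i)" for i
    define T where "T = (\<Sum>i\<in>I. c i * l i)"
    define W where "W = (\<Sum>i\<in>I. c i * w i)"
    have pos: "0 < 1 + w i" if "i \<in> I" for i using w that \<kappa> by force
    have le_w: "l i \<le> w i" if "i \<in> I" for i
      unfolding l_def using ln_add_one_self_le_self2[of "w i"] pos[OF that] by simp
    have ge_w: "w i - (w i)\<^sup>2 / \<kappa> \<le> l i" if i: "i \<in> I" for i
    proof -
      have "1 - 1 / (1 + w i) \<le> l i"
        unfolding l_def using ln_le_minus_one[of "1 / (1 + w i)"] pos[OF i] by (simp add: ln_div)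
      moreover have "w i - (w i)\<^sup>2 / (1 + w i) = 1 - 1 / (1 + w i)"
        using pos[OF i] by (simp add: power2_eq_square field_simps)
      moreover have "(w i)\<^sup>2 / (1 + w i) \<le> (w i)\<^sup>2 / \<kappa>"
        using w i \<kappa> by (intro divide_left_mono) (auto intro!: mult_pos_pos pos)
      ultimately show ?thesis by linarith
    qed
    have abs_l: "\<bar>l i\<bar> \<le> \<bar>w i\<bar> / \<kappa>" if i: "i \<in> I" for i
    proof -
      have "1 - 1 / (1 + w i) \<le> l i"
        unfolding l_def using ln_le_minus_one[of "1 / (1 + w i)"] pos[OF i] by (simp add: ln_div)
      then have "w i / (1 + w i) \<le> l i" using pos[OF i] by (simp add: field_simps)
      moreover have "\<bar>w i / (1 + w i)\<bar> \<le> \<bar>w i\<bar> / \<kappa>"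
        using w i \<kappa> pos[OF i] unfolding abs_divide by (intro divide_left_mono) auto
      moreover have "\<bar>w i\<bar> \<le> \<bar>w i\<bar> / \<kappa>" using \<kappa> by (simp add: le_divide_eq mult_left_le)
      ultimately show ?thesis using le_w[OF i] by linarith
    qed
    have T_abs: "\<bar>T\<bar> \<le> S * b / \<kappa>" if b: "\<And>i. i \<in> I \<Longrightarrow> \<bar>w i\<bar> \<le> b" for b
    proof -
      have "\<bar>T\<bar> \<le> (\<Sum>i\<in>I. c i * (b / \<kappa>))"
        unfolding T_def
      proof (rule sum_abs[THEN order_trans], rule sum_mono)
        fix i assume i: "i \<in> I"
        have "\<bar>l i\<bar> \<le> b / \<kappa>" using abs_l[OF i] divide_right_mono[OF b[OF i], of \<kappa>] \<kappa> by linarith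
        then show "\<bar>c i * l i\<bar> \<le> c i * (b / \<kappa>)"
          using mult_left_mono[of "\<bar>l i\<bar>" "b / \<kappa>" "c i"] c[OF i] by (simp add: abs_mult)
      qed
      also have "\<dots> = S * b / \<kappa>" unfolding S_def by (simp add: sum_distrib_right sum_divide_distrib)
      finally show ?thesis .
    qed
    have T1: "\<bar>T\<bar> \<le> S / \<kappa> * \<tau>" using T_abs[of \<tau>] w by simp
    have T2: "\<bar>T\<bar> \<le> S * M / \<kappa>" using T_abs[of M] w by simp
    have W1: "\<bar>W\<bar> \<le> S * \<tau>"
    proof -
      have "\<bar>W\<bar> \<le> (\<Sum>i\<in>I. c i * \<tau>)"
        unfolding W_def using w c
        by (intro sum_abs[THEN order_trans] sum_mono) (auto simp: abs_mult intro: mult_left_mono)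
      then show ?thesis by (simp add: S_def sum_distrib_right)
    qed
    have TW: "\<bar>T - W\<bar> \<le> S / \<kappa> * \<tau>\<^sup>2"
    proof -
      have "\<bar>T - W\<bar> = \<bar>\<Sum>i\<in>I. c i * (l i - w i)\<bar>"
        unfolding T_def W_def by (simp add: sum_subtractf algebra_simps)
      also have "\<dots> \<le> (\<Sum>i\<in>I. c i * (\<tau>\<^sup>2 / \<kappa>))"
      proof (rule sum_abs[THEN order_trans], rule sum_mono)
        fix i assume i: "i \<in> I"
        have "(w i)\<^sup>2 \<le> \<tau>\<^sup>2" using w i \<tau> by (intro power2_le_iff_abs_le[THEN iffD2]) auto
        then have "(w i)\<^sup>2 / \<kappa> \<le> \<tau>\<^sup>2 / \<kappa>" using \<kappa> by (intro divide_right_mono) auto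
        then have "\<bar>l i - w i\<bar> \<le> \<tau>\<^sup>2 / \<kappa>" using le_w[OF i] ge_w[OF i] by linarith
        then show "\<bar>c i * (l i - w i)\<bar> \<le> c i * (\<tau>\<^sup>2 / \<kappa>)"
          using mult_left_mono[of "\<bar>l i - w i\<bar>" "\<tau>\<^sup>2 / \<kappa>" "c i"] c[OF i] by (simp add: abs_mult)
      qed
      also have "\<dots> = S / \<kappa> * \<tau>\<^sup>2" unfolding S_def by (simp add: sum_distrib_right sum_divide_distrib)
      finally show ?thesis .
    qed
    have T_le: "T \<le> W - (\<Sum>i\<in>I. c i * (w i)\<^sup>2) / 2 + S * \<tau> ^ 3"
    proof -
      have "T \<le> (\<Sum>i\<in>I. c i * (w i - (w i)\<^sup>2 / 2 + \<tau> ^ 3))"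
        unfolding T_def
      proof (intro sum_mono mult_left_mono c)
        fix i assume i: "i \<in> I"
        have "\<bar>w i\<bar> ^ 3 \<le> \<tau> ^ 3" using w i by (intro power_mono) auto
        then show "l i \<le> w i - (w i)\<^sup>2 / 2 + \<tau> ^ 3"
          unfolding l_def using ln_le_cubic[of "w i"] pos[OF i] by linarith
      qed
      also have "\<dots> = W - (\<Sum>i\<in>I. c i * (w i)\<^sup>2) / 2 + S * \<tau> ^ 3"
        unfolding W_def S_def
        by (simp add: algebra_simps sum.distrib sum_subtractf sum_divide_distrib sum_distrib_right)
      finally show ?thesis .
    qed
    have sq: "T\<^sup>2 \<le> W\<^sup>2 + (S / \<kappa>) * (S / \<kappa> + S) * \<tau> ^ 3"
    proof -
      have "T\<^sup>2 - W\<^sup>2 = (T - W) * (T + W)" by (simp add: power2_eq_square algebra_simps)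
      also have "\<dots> \<le> \<bar>T - W\<bar> * \<bar>T + W\<bar>" by (metis abs_ge_self abs_mult)
      also have "\<dots> \<le> (S / \<kappa> * \<tau>\<^sup>2) * ((S / \<kappa> + S) * \<tau>)"
        using T1 W1 S \<kappa> by (intro mult_mono TW) (auto simp: algebra_simps)
      also have "\<dots> = (S / \<kappa>) * (S / \<kappa> + S) * \<tau> ^ 3" by (simp add: power2_eq_square power3_eq_cube)
      finally show ?thesis by simp
    qed
    have "(\<Prod>i\<in>I. (1 + w i) powr c i) = exp T"
      unfolding T_def l_def exp_sum[OF fin]
    proof (intro prod.cong refl)
      fix i assume "i \<in> I"
      from pos[OF this] show "(1 + w i) powr c i = exp (c i * ln (1 + w i))" by (simp add: powr_def)
    qed
    also have "\<dots> \<le> 1 + T + T\<^sup>2 / 2 + \<bar>T\<bar> ^ 3 * exp \<bar>T\<bar>"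
    proof -
      have "0 \<le> \<bar>T\<bar> ^ 3 * exp \<bar>T\<bar>" by simp
      then show ?thesis using exp_taylor3[of T] by linarith
    qed
    also have "\<bar>T\<bar> ^ 3 * exp \<bar>T\<bar> \<le> (S / \<kappa> * \<tau>) ^ 3 * exp (S * M / \<kappa>)"
      using T1 T2 by (intro mult_mono power_mono) auto
    also have "1 + T + T\<^sup>2 / 2 + (S / \<kappa> * \<tau>) ^ 3 * exp (S * M / \<kappa>)
       \<le> 1 + (W - (\<Sum>i\<in>I. c i * (w i)\<^sup>2) / 2 + S * \<tau> ^ 3) + (W\<^sup>2 + (S / \<kappa>) * (S / \<kappa> + S) * \<tau> ^ 3) / 2
          + (S / \<kappa> * \<tau>) ^ 3 * exp (S * M / \<kappa>)"
      using T_le sq by (intro add_mono divide_right_mono) auto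
    also have "\<dots> = 1 + W + (W\<^sup>2 - (\<Sum>i\<in>I. c i * (w i)\<^sup>2)) / 2 + C * \<tau> ^ 3"
      unfolding C_def power_mult_distrib by (simp add: algebra_simps add_divide_distrib diff_divide_distrib)
    finally show ?thesis unfolding W_def by simp
  qed
  ultimately show ?thesis by blast
qed

text \<open>
  For \<open>s = \<langle>\<eta>, y\<rangle>\<close>, \<open>p = |\<eta>|\<^sup>2 / 2\<close>, \<open>\<rho> = l1 d \<eta>\<close> and \<open>u = l1 d y\<close>, \<open>exp (s - p)\<close> is the
  Cameron-Martin weight. Here \<open>p\<close> is of second order in \<open>\<rho>\<close>, so \<open>s\<^sup>2 / 2 - p\<close> is the whole quadratic
  term, and the exponential of \<open>u\<close> absorbs the powers of \<open>u\<close> in the remainder.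
\<close>

lemma gaussian_kernel_taylor:
  fixes \<rho> u s p :: real
  assumes \<rho>: "0 \<le> \<rho>" "\<rho> \<le> 1" and u: "0 \<le> u" and s: "\<bar>s\<bar> \<le> \<rho> * u" and p: "0 \<le> p" "p \<le> \<rho>\<^sup>2 / 2"
  shows "\<bar>exp (s - p) - (1 + s + (s\<^sup>2 / 2 - p))\<bar> \<le> 2 * \<rho> ^ 3 * exp (2 * (1 + u))"
proof -
  define E where "E = exp (2 * (1 + u))"
  have le: "\<rho>\<^sup>2 \<le> \<rho>" using \<rho> by (simp add: power2_eq_square mult_left_le)
  have pr: "p \<le> \<rho>" using p le \<rho> by linarith
  have r: "\<bar>s - p\<bar> \<le> \<rho> * (1 + u)" using s p pr by (simp add: algebra_simps)
  have r1: "\<bar>s - p\<bar> \<le> 1 + u"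
  proof -
    have "\<rho> * (1 + u) \<le> 1 * (1 + u)" using \<rho> u by (intro mult_right_mono) auto
    then have "\<rho> * (1 + u) \<le> 1 + u" by simp
    with r show ?thesis by (rule order_trans)
  qed
  have "\<bar>s - p\<bar> ^ 3 * exp \<bar>s - p\<bar> / 6 \<le> (\<rho> * (1 + u)) ^ 3 * exp (1 + u) / 6"
    using r r1 by (intro divide_right_mono mult_mono power_mono) auto
  also have "\<dots> = \<rho> ^ 3 * ((1 + u) ^ 3 / 6) * exp (1 + u)" by (simp add: power_mult_distrib)
  also have "\<dots> \<le> \<rho> ^ 3 * exp (1 + u) * exp (1 + u)"
    using cube_le_exp[of "1 + u"] u \<rho> by (intro mult_right_mono mult_left_mono) auto
  also have "\<dots> = \<rho> ^ 3 * E" unfolding E_def by (simp add: exp_add[symmetric] mult.assoc)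
  finally have 1: "\<bar>s - p\<bar> ^ 3 * exp \<bar>s - p\<bar> / 6 \<le> \<rho> ^ 3 * E" .
  have "\<bar>(s - p)\<^sup>2 / 2 - s\<^sup>2 / 2\<bar> = \<bar>p / 2 * (p - 2 * s)\<bar>" by (simp add: power2_eq_square algebra_simps add_divide_distrib diff_divide_distrib)
  also have "\<dots> = p / 2 * \<bar>p - 2 * s\<bar>" using p by (simp add: abs_mult)
  also have "\<dots> \<le> \<rho>\<^sup>2 / 2 * (\<rho> + 2 * (\<rho> * u))"
    using p pr s by (intro mult_mono) auto
  also have "\<dots> \<le> \<rho>\<^sup>2 * (\<rho> * (1 + u))"
    using \<rho> u by (simp add: algebra_simps)
  also have "\<dots> = \<rho> ^ 3 * (1 + u)" by (simp add: power2_eq_square power3_eq_cube)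
  also have "\<dots> \<le> \<rho> ^ 3 * E"
    unfolding E_def using exp_ge_add_one_self[of "2 * (1 + u)"] u \<rho> by (intro mult_left_mono) auto
  finally have 2: "\<bar>(s - p)\<^sup>2 / 2 - s\<^sup>2 / 2\<bar> \<le> \<rho> ^ 3 * E" .
  have "\<bar>exp (s - p) - (1 + s + (s\<^sup>2 / 2 - p))\<bar>
     \<le> \<bar>exp (s - p) - (1 + (s - p) + (s - p)\<^sup>2 / 2)\<bar> + \<bar>(s - p)\<^sup>2 / 2 - s\<^sup>2 / 2\<bar>"
    by linarith
  also have "\<dots> \<le> \<rho> ^ 3 * E + \<rho> ^ 3 * E"
    using 1 2 exp_taylor3[of "s - p"] by linarith
  finally show ?thesis unfolding E_def by simp
qed

section \<open>Second-order expansion of heat averages\<close>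

text \<open>
  The function \<open>g\<close> has a quadratic Taylor polynomial at the origin with a cubic remainder. One constant
  bounds the coefficients and the remainder, so that it can serve for a whole family of functions.
\<close>

definition taylor2 ::
  "nat \<Rightarrow> real \<Rightarrow> ((nat \<Rightarrow> real) \<Rightarrow> real) \<Rightarrow> (nat \<Rightarrow> real) \<Rightarrow> (nat \<Rightarrow> nat \<Rightarrow> real) \<Rightarrow> bool" where
  "taylor2 d C g a q \<longleftrightarrow>
     (\<forall>k<d. \<bar>a k\<bar> \<le> C) \<and> (\<forall>k<d. \<forall>l<d. \<bar>q k l\<bar> \<le> C) \<and>
     (\<forall>h. \<bar>g h - (g (\<lambda>_. 0) + (\<Sum>k<d. a k * h k) + (\<Sum>k<d. \<Sum>l<d. q k l * (h k * h l)) / 2)\<bar>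
        \<le> C * l1 d h ^ 3)"

lemma linear_le_l1: "(\<And>k. k < d \<Longrightarrow> \<bar>a k\<bar> \<le> C) \<Longrightarrow> \<bar>\<Sum>k<d. a k * h k\<bar> \<le> C * l1 d h"
  unfolding l1_def sum_distrib_left
  by (rule sum_abs[THEN order_trans], rule sum_mono) (auto simp: abs_mult intro!: mult_right_mono)

lemma quadratic_le_l1:
  assumes q: "\<And>k l. k < d \<Longrightarrow> l < d \<Longrightarrow> \<bar>q k l\<bar> \<le> C"
  shows "\<bar>\<Sum>k<d. \<Sum>l<d. q k l * (h k * h l)\<bar> \<le> C * (l1 d h)\<^sup>2"
proof -
  have "\<bar>\<Sum>k<d. \<Sum>l<d. q k l * (h k * h l)\<bar> \<le> (\<Sum>k<d. \<Sum>l<d. C * (\<bar>h k\<bar> * \<bar>h l\<bar>))"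
  proof (rule sum_abs[THEN order_trans], rule sum_mono, rule sum_abs[THEN order_trans], rule sum_mono)
    fix k l assume "k \<in> {..<d}" "l \<in> {..<d}"
    then show "\<bar>q k l * (h k * h l)\<bar> \<le> C * (\<bar>h k\<bar> * \<bar>h l\<bar>)"
      unfolding abs_mult by (intro mult_right_mono q) auto
  qed
  also have "\<dots> = C * (l1 d h)\<^sup>2"
    unfolding l1_def power2_eq_square sum_product by (simp add: sum_distrib_left)
  finally show ?thesis .
qed

lemma sum_squares_le_l1: "(\<Sum>k<d. (h k)\<^sup>2) \<le> (l1 d h)\<^sup>2"
proof -
  have "(\<Sum>k<d. (h k)\<^sup>2) \<le> (\<Sum>k<d. \<bar>h k\<bar> * l1 d h)"
  proof (rule sum_mono)
    fix k assume "k \<in> {..<d}"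
    then have "\<bar>h k\<bar> * \<bar>h k\<bar> \<le> \<bar>h k\<bar> * l1 d h" by (intro mult_left_mono abs_le_l1) auto
    then show "(h k)\<^sup>2 \<le> \<bar>h k\<bar> * l1 d h" by (simp add: power2_eq_square)
  qed
  also have "\<dots> = (l1 d h)\<^sup>2"
    unfolding power2_eq_square by (subst (2) l1_def) (simp add: sum_distrib_right)
  finally show ?thesis .
qed

lemma abs_coordinate_le_exp:
  assumes "k < d"
  shows "\<bar>y k\<bar> \<le> exp (2 * (1 + l1 d y))"
proof -
  have "l1 d y \<le> exp (2 * (1 + l1 d y))"
  proof (rule order_trans)
    show "l1 d y \<le> 2 * (1 + l1 d y)" by simp
    show "2 * (1 + l1 d y) \<le> exp (2 * (1 + l1 d y))"
      by (rule order_trans[OF _ exp_ge_add_one_self]) simp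
  qed
  with abs_le_l1[OF assms, of y] show ?thesis by (rule order_trans)
qed

lemma coordinate_product_le_exp:
  assumes "k < d" "l < d"
  shows "\<bar>y k * y l - (if k = l then 1 else 0)\<bar> \<le> exp (2 * (1 + l1 d y))"
proof -
  have "\<bar>y k * y l - (if k = l then 1 else 0)\<bar> \<le> \<bar>y k\<bar> * \<bar>y l\<bar> + 1"
    using abs_triangle_ineq4[of "y k * y l" "if k = l then 1 else 0"]
    by (simp add: abs_mult split: if_splits)
  also have "\<bar>y k\<bar> * \<bar>y l\<bar> \<le> l1 d y * l1 d y"
    by (intro mult_mono abs_le_l1 assms) auto
  also have "l1 d y * l1 d y + 1 \<le> (1 + l1 d y) * (1 + l1 d y)"
    by (simp add: algebra_simps)
  also have "\<dots> \<le> exp (1 + l1 d y) * exp (1 + l1 d y)"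
    using exp_ge_add_one_self[of "1 + l1 d y"] by (intro mult_mono) auto
  also have "\<dots> = exp (2 * (1 + l1 d y))" by (simp add: exp_add[symmetric])
  finally show ?thesis by simp
qed

lemma gauss_exp_ge_1: "0 \<le> p \<Longrightarrow> 1 \<le> gauss_exp d p"
  unfolding gauss_exp_def
  by (intro gauss.integral_ge_const[OF integrable_gauss_exp] AE_I2) simp

text \<open>
  The Cameron-Martin weight is expanded to second order. The coefficients are the means of \<open>\<Psi>\<close>
  against the Hermite polynomials \<open>y k\<close> and \<open>y k * y l - \<delta>\<^sub>k\<^sub>l\<close>.
\<close>

lemma gauss_shift_taylor:
  assumes m [measurable]: "\<Psi> \<in> borel_measurable (euc_borel d)" and b: "\<And>y. y \<in> euc d \<Longrightarrow> \<bar>\<Psi> y\<bar> \<le> M"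
    and M: "0 \<le> M"
  shows "\<exists>a q. taylor2 d (4 * M * gauss_exp d 2) (\<lambda>h. \<integral>y. \<Psi> (\<lambda>k\<in>{..<d}. y k + h k) \<partial>gauss d) a q"
proof -
  let ?Q = "\<lambda>k l y. \<Psi> y * (y k * y l - (if k = l then 1 else 0))"
  define g where "g = gauss_exp d 2"
  have g1: "1 \<le> g" unfolding g_def by (rule gauss_exp_ge_1) simp
  define C where "C = 4 * M * g"
  define a where "a k = (\<integral>y. \<Psi> y * y k \<partial>gauss d)" for k
  define q where "q k l = (\<integral>y. ?Q k l y \<partial>gauss d)" for k l
  define G where "G h = (\<integral>y. \<Psi> (\<lambda>k\<in>{..<d}. y k + h k) \<partial>gauss d)" for h
  let ?err = "\<lambda>h. G h - (G (\<lambda>_. 0) + (\<Sum>k<d. a k * h k) + (\<Sum>k<d. \<Sum>l<d. q k l * (h k * h l)) / 2)"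
  have Mg: "0 \<le> M * g" using M g1 by simp
  have mc: "(\<lambda>y. \<Psi> y * y k) \<in> borel_measurable (gauss d)" if "k < d" for k
    using m that by (intro borel_measurable_times measurable_gauss_coordinate) simp_all
  have mq: "(\<lambda>y. ?Q k l y) \<in> borel_measurable (gauss d)"
    if "k < d" "l < d" for k l
    using m that
    by (intro borel_measurable_times borel_measurable_diff borel_measurable_const measurable_gauss_coordinate) simp_all
  have bc: "\<bar>\<Psi> y * y k\<bar> \<le> M * exp (2 * (1 + l1 d y))" if "k < d" "y \<in> euc d" for k y
    unfolding abs_mult using M that by (intro mult_mono b abs_coordinate_le_exp) auto
  have bq: "\<bar>?Q k l y\<bar> \<le> M * exp (2 * (1 + l1 d y))"
    if "k < d" "l < d" "y \<in> euc d" for k l y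
    unfolding abs_mult using M that by (intro mult_mono b coordinate_product_le_exp) auto
  have a: "\<bar>a k\<bar> \<le> M * g" if "k < d" for k
    unfolding a_def g_def using that by (intro integral_gauss_bound mc bc) auto
  have q: "\<bar>q k l\<bar> \<le> M * g" if "k < d" "l < d" for k l
    unfolding q_def g_def using that by (intro integral_gauss_bound mq bq) auto
  have ic: "integrable (gauss d) (\<lambda>y. \<Psi> y * y k)" if "k < d" for k
    using that by (intro integrable_gauss_bound[OF mc bc]) auto
  have iq: "integrable (gauss d) (\<lambda>y. ?Q k l y)" if "k < d" "l < d" for k l
    using that by (intro integrable_gauss_bound[OF mq bq]) auto
  have i0: "integrable (gauss d) \<Psi>"
    using m b by (intro integrable_gauss_bounded) auto
  have G0: "G (\<lambda>_. 0) = (\<integral>y. \<Psi> y \<partial>gauss d)"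
    unfolding G_def by (intro Bochner_Integration.integral_cong refl arg_cong[of _ _ \<Psi>])
      (auto simp: euc_def PiE_def extensional_restrict)
  have Gb: "\<bar>G h\<bar> \<le> M" for h
  proof -
    have mv: "(\<lambda>y. \<lambda>k\<in>{..<d}. y k + h k) \<in> measurable (gauss d) (euc_borel d)"
      by (intro measurable_euc_intros)
    have i: "integrable (gauss d) (\<lambda>y. \<Psi> (\<lambda>k\<in>{..<d}. y k + h k))"
      using b measurable_compose[OF mv m] by (intro integrable_gauss_bounded[where M=M]) auto
    have "\<bar>G h\<bar> \<le> (\<integral>y. \<bar>\<Psi> (\<lambda>k\<in>{..<d}. y k + h k)\<bar> \<partial>gauss d)"
      unfolding G_def by (rule integral_abs_bound)
    also have "\<dots> \<le> M"
      using b by (intro gauss.integral_le_const integrable_abs[OF i] AE_I2) auto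
    finally show ?thesis .
  qed
  have "\<bar>?err h\<bar>
        \<le> C * l1 d h ^ 3" for h
  proof (cases "l1 d h \<le> 1")
    case True
    define s where "s y = (\<Sum>k<d. h k * y k)" for y
    define p where "p = (\<Sum>k<d. (h k)\<^sup>2) / 2"
    let ?rem = "\<lambda>y. exp (s y - p) - (1 + s y + ((s y)\<^sup>2 / 2 - p))"
    have p: "0 \<le> p" "p \<le> (l1 d h)\<^sup>2 / 2"
      unfolding p_def using sum_squares_le_l1[of h d] by (auto intro!: sum_nonneg)
    have s: "\<bar>s y\<bar> \<le> l1 d h * l1 d y" for y
      unfolding s_def by (rule linear_le_l1) (rule abs_le_l1)
    have ms: "s \<in> borel_measurable (gauss d)"
      unfolding s_def by (intro borel_measurable_sum borel_measurable_times borel_measurable_const measurable_gauss_coordinate) simp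
    have lin: "(\<Sum>k<d. a k * h k) + (\<Sum>k<d. \<Sum>l<d. q k l * (h k * h l)) / 2
      = (\<integral>y. \<Psi> y * (s y + ((s y)\<^sup>2 / 2 - p)) \<partial>gauss d)"
      and lin_i: "integrable (gauss d) (\<lambda>y. \<Psi> y * (s y + ((s y)\<^sup>2 / 2 - p)))"
    proof -
      have e: "\<Psi> y * (s y + ((s y)\<^sup>2 / 2 - p)) = (\<Sum>k<d. \<Psi> y * y k * h k)
        + (\<Sum>k<d. \<Sum>l<d. ?Q k l y * (h k * h l)) / 2" for y
      proof -
        have "(\<Sum>k<d. \<Psi> y * y k * h k) = \<Psi> y * s y"
          unfolding s_def by (simp add: sum_distrib_left ac_simps)
        moreover have "(\<Sum>k<d. \<Sum>l<d. ?Q k l y * (h k * h l))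
           = \<Psi> y * ((s y)\<^sup>2 - 2 * p)"
        proof -
          have "(\<Sum>k<d. \<Sum>l<d. (y k * y l - (if k = l then 1 else 0)) * (h k * h l))
             = (\<Sum>k<d. \<Sum>l<d. (h k * y k) * (h l * y l)) - (\<Sum>k<d. \<Sum>l<d. if k = l then h k * h l else 0)"
            unfolding sum_subtractf[symmetric] by (intro sum.cong refl) (auto simp: algebra_simps)
          also have "(\<Sum>k<d. \<Sum>l<d. (h k * y k) * (h l * y l)) = (s y)\<^sup>2"
            unfolding s_def power2_eq_square sum_product ..
          also have "(\<Sum>k<d. \<Sum>l<d. if k = l then h k * h l else 0) = 2 * p"
            unfolding p_def by (simp add: sum.delta power2_eq_square)
          finally have "(s y)\<^sup>2 - 2 * p
             = (\<Sum>k<d. \<Sum>l<d. (y k * y l - (if k = l then 1 else 0)) * (h k * h l))" ..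
          then show ?thesis by (simp only: sum_distrib_left mult.assoc)
        qed
        ultimately show ?thesis by (simp add: algebra_simps)
      qed
      show "integrable (gauss d) (\<lambda>y. \<Psi> y * (s y + ((s y)\<^sup>2 / 2 - p)))"
        unfolding e
        by (intro Bochner_Integration.integrable_add Bochner_Integration.integrable_sum
            integrable_divide integrable_mult_left ic iq) auto
      show "(\<Sum>k<d. a k * h k) + (\<Sum>k<d. \<Sum>l<d. q k l * (h k * h l)) / 2
      = (\<integral>y. \<Psi> y * (s y + ((s y)\<^sup>2 / 2 - p)) \<partial>gauss d)"
      proof -
        have 1: "(\<integral>y. (\<Sum>k<d. \<Psi> y * y k * h k) \<partial>gauss d) = (\<Sum>k<d. a k * h k)"
          unfolding a_def by (subst Bochner_Integration.integral_sum) (auto intro!: integrable_mult_left ic)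
        have 2: "(\<integral>y. (\<Sum>k<d. \<Sum>l<d. ?Q k l y * (h k * h l)) \<partial>gauss d)
          = (\<Sum>k<d. \<Sum>l<d. q k l * (h k * h l))"
        proof (subst Bochner_Integration.integral_sum)
          show "(\<Sum>k<d. \<integral>y. (\<Sum>l<d. ?Q k l y * (h k * h l)) \<partial>gauss d)
            = (\<Sum>k<d. \<Sum>l<d. q k l * (h k * h l))"
          proof (rule sum.cong[OF refl])
            fix k assume k: "k \<in> {..<d}"
            show "(\<integral>y. (\<Sum>l<d. ?Q k l y * (h k * h l)) \<partial>gauss d)
              = (\<Sum>l<d. q k l * (h k * h l))"
            proof (subst Bochner_Integration.integral_sum)
              show "(\<Sum>l<d. \<integral>y. ?Q k l y * (h k * h l) \<partial>gauss d)
                = (\<Sum>l<d. q k l * (h k * h l))"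
                unfolding q_def by (intro sum.cong refl integral_mult_left_zero)
            qed (use k in \<open>intro integrable_mult_left iq, auto\<close>)
          qed
        qed (intro Bochner_Integration.integrable_sum integrable_mult_left iq, auto)
        show ?thesis
          unfolding e 1[symmetric] 2[symmetric] integral_divide_zero[symmetric]
          by (intro Bochner_Integration.integral_add[symmetric] Bochner_Integration.integrable_sum
              integrable_divide integrable_mult_left ic iq) auto
      qed
    qed
    have cm: "G h = (\<integral>y. exp (s y - p) * \<Psi> y \<partial>gauss d)"
      unfolding G_def s_def p_def by (rule cameron_martin) (rule m)
    have mE: "(\<lambda>y. exp (s y - p)) \<in> borel_measurable (gauss d)"
      using ms by measurable
    have mR: "(\<lambda>y. ?rem y) \<in> borel_measurable (gauss d)"
      using ms by measurable
    have bR: "\<bar>\<Psi> y * ?rem y\<bar>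
        \<le> (M * (2 * l1 d h ^ 3)) * exp (2 * (1 + l1 d y))" if "y \<in> euc d" for y
      unfolding abs_mult mult.assoc
      using M that gaussian_kernel_taylor[OF l1_nonneg True l1_nonneg s p, of y]
      by (intro mult_mono b) (auto simp: mult.assoc)
    have mPR: "(\<lambda>y. \<Psi> y * ?rem y) \<in> borel_measurable (gauss d)"
      using m by (intro borel_measurable_times mR) simp
    have iR: "integrable (gauss d) (\<lambda>y. \<Psi> y * ?rem y)"
      by (rule integrable_gauss_bound[OF mPR bR])
    have "G h = (\<integral>y. \<Psi> y + \<Psi> y * (s y + ((s y)\<^sup>2 / 2 - p))
        + \<Psi> y * ?rem y \<partial>gauss d)"
      unfolding cm by (intro Bochner_Integration.integral_cong refl) (simp add: algebra_simps)
    also have "\<dots> = G (\<lambda>_. 0) + ((\<Sum>k<d. a k * h k) + (\<Sum>k<d. \<Sum>l<d. q k l * (h k * h l)) / 2)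
       + (\<integral>y. \<Psi> y * ?rem y \<partial>gauss d)"
      unfolding lin G0 using i0 lin_i iR by simp
    finally have "\<bar>?err h\<bar>
        = \<bar>\<integral>y. \<Psi> y * ?rem y \<partial>gauss d\<bar>" by simp
    also have "\<dots> \<le> M * (2 * l1 d h ^ 3) * gauss_exp d 2"
      by (rule integral_gauss_bound[OF mPR bR])
    also have "\<dots> = 2 * (M * g) * l1 d h ^ 3" unfolding g_def by simp
    also have "\<dots> \<le> C * l1 d h ^ 3"
      unfolding C_def using Mg by (intro mult_right_mono) auto
    finally show ?thesis .
  next
    case False
    \<comment> \<open>For large \<open>h\<close> boundedness suffices: all terms are dominated by the cube of the norm.\<close>
    define \<rho> where "\<rho> = l1 d h"
    have \<rho>: "1 \<le> \<rho>" using False by (simp add: \<rho>_def)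
    have "\<rho> ^ 1 \<le> \<rho> ^ 3" "\<rho> ^ 2 \<le> \<rho> ^ 3" "\<rho> ^ 0 \<le> \<rho> ^ 3"
      using \<rho> by (intro power_increasing; simp)+
    then have pw: "\<rho> \<le> \<rho> ^ 3" "\<rho> ^ 2 \<le> \<rho> ^ 3" "1 \<le> \<rho> ^ 3" by auto
    have "\<bar>\<Sum>k<d. a k * h k\<bar> \<le> M * g * \<rho>"
      unfolding \<rho>_def by (rule linear_le_l1) (rule a)
    also have "\<dots> \<le> M * g * \<rho> ^ 3" by (intro mult_left_mono pw Mg)
    finally have 1: "\<bar>\<Sum>k<d. a k * h k\<bar> \<le> M * g * \<rho> ^ 3" .
    have "\<bar>\<Sum>k<d. \<Sum>l<d. q k l * (h k * h l)\<bar> \<le> M * g * \<rho>\<^sup>2"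
      unfolding \<rho>_def by (rule quadratic_le_l1) (rule q)
    also have "\<dots> \<le> M * g * \<rho> ^ 3" by (intro mult_left_mono pw Mg)
    finally have 2: "\<bar>\<Sum>k<d. \<Sum>l<d. q k l * (h k * h l)\<bar> \<le> M * g * \<rho> ^ 3" .
    have "M * (1 * 1) \<le> M * (g * \<rho> ^ 3)"
      using M g1 pw(3) by (intro mult_left_mono mult_mono) auto
    then have "\<bar>G h\<bar> \<le> M * g * \<rho> ^ 3" "\<bar>G (\<lambda>_. 0)\<bar> \<le> M * g * \<rho> ^ 3"
      using Gb[of h] Gb[of "\<lambda>_. 0"] by (auto simp: mult.assoc)
    then have "\<bar>?err h\<bar>
      \<le> 4 * (M * g * \<rho> ^ 3)"
      using 1 2 by linarith
    then show ?thesis by (simp add: C_def \<rho>_def mult.assoc)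
  qed
  moreover have "M * g \<le> C" unfolding C_def using Mg by simp
  ultimately have "taylor2 d C G a q"
    unfolding taylor2_def using a q by (meson order_trans)
  then show ?thesis unfolding C_def g_def G_def by blast
qed

text \<open>
  As \<open>P\<^sub>s F = P\<^sub>\<delta> (P\<^sub>s\<^sub>-\<^sub>\<delta> F)\<close> and \<open>P\<^sub>s\<^sub>-\<^sub>\<delta> F\<close> has the same bound as \<open>F\<close>, the expansion at
  time \<open>\<delta>\<close> gives a constant that is uniform over all later times, all points and all functions with
  that bound.
\<close>

lemma heat_taylor:
  assumes \<delta>: "0 < \<delta>" and M: "0 \<le> M"
  shows "\<exists>C\<ge>0. \<forall>F\<in>borel_measurable (euc_borel d). (\<forall>y\<in>euc d. \<bar>F y\<bar> \<le> M) \<longrightarrow>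
    (\<forall>s\<ge>\<delta>. \<forall>x. \<exists>a q. taylor2 d C (\<lambda>h. heat d s F (\<lambda>k. x k + h k)) a q)"
proof -
  \<comment> \<open>A displacement \<open>h\<close> is the Gaussian increment \<open>sqrt \<delta> * (\<sigma> * h)\<close>.\<close>
  define \<sigma> where "\<sigma> = 1 / sqrt \<delta>"
  have \<sigma>: "0 < \<sigma>" using \<delta> by (simp add: \<sigma>_def)
  define C0 where "C0 = 4 * M * gauss_exp d 2"
  have C0: "0 \<le> C0" unfolding C0_def using M gauss_exp_nonneg[of d 2] by simp
  define C where "C = C0 * (1 + \<sigma>) ^ 3"
  have C: "0 \<le> C" using C0 \<sigma> by (simp add: C_def)
  have \<sigma>1: "\<sigma> \<le> (1 + \<sigma>) ^ 3" "\<sigma>\<^sup>2 \<le> (1 + \<sigma>) ^ 3" "\<sigma> ^ 3 \<le> (1 + \<sigma>) ^ 3"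
    using \<sigma> by (auto simp: power2_eq_square power3_eq_cube algebra_simps)
  have "\<exists>a q. taylor2 d C (\<lambda>h. heat d s F (\<lambda>k. x k + h k)) a q"
    if F: "F \<in> borel_measurable (euc_borel d)" and bF: "\<forall>y\<in>euc d. \<bar>F y\<bar> \<le> M" and s: "\<delta> \<le> s" for F s x
  proof -
    define \<psi> where "\<psi> = heat d (s - \<delta>) F"
    have m\<psi> [measurable]: "\<psi> \<in> borel_measurable (euc_borel d)" unfolding \<psi>_def by (intro measurable_heat F)
    have b\<psi>: "\<bar>\<psi> z\<bar> \<le> M" for z
    proof -
      have "-M \<le> F y" "F y \<le> M" if "y \<in> euc d" for y using bF that by (auto simp: abs_le_iff)
      from heat_bounds[OF F this, of "s - \<delta>" z] show ?thesis unfolding \<psi>_def by auto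
    qed
    define \<Psi> where "\<Psi> y = \<psi> (\<lambda>k\<in>{..<d}. x k + sqrt \<delta> * y k)" for y
    have m\<Psi>: "\<Psi> \<in> borel_measurable (euc_borel d)"
      unfolding \<Psi>_def using measurable_compose[OF measurable_move[where d = d and x = x and r = "sqrt \<delta>"] m\<psi>] by simp
    obtain A Q where T: "taylor2 d C0 (\<lambda>h. \<integral>y. \<Psi> (\<lambda>k\<in>{..<d}. y k + h k) \<partial>gauss d) A Q"
      using gauss_shift_taylor[OF m\<Psi> _ M] b\<psi> unfolding \<Psi>_def C0_def by blast
    have eq: "heat d s F (\<lambda>k. x k + h k) = (\<integral>y. \<Psi> (\<lambda>k\<in>{..<d}. y k + \<sigma> * h k) \<partial>gauss d)" for h
    proof -
      have "heat d s F (\<lambda>k. x k + h k) = heat d \<delta> \<psi> (\<lambda>k. x k + h k)"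
        unfolding \<psi>_def using s \<delta> bF by (subst heat_add_time[OF F, where M=M]) auto
      also have "\<dots> = (\<integral>y. \<Psi> (\<lambda>k\<in>{..<d}. y k + \<sigma> * h k) \<partial>gauss d)"
        unfolding heat_def \<Psi>_def using \<delta>
        by (intro Bochner_Integration.integral_cong refl arg_cong[of _ _ \<psi>]) (auto simp: \<sigma>_def field_simps)
      finally show ?thesis .
    qed
    have "taylor2 d C (\<lambda>h. heat d s F (\<lambda>k. x k + h k)) (\<lambda>k. \<sigma> * A k) (\<lambda>k l. \<sigma>\<^sup>2 * Q k l)"
      unfolding taylor2_def
    proof (intro conjI allI impI)
      fix k assume "k < d"
      then have "\<bar>A k\<bar> \<le> C0" using T by (simp add: taylor2_def)
      then have "\<bar>\<sigma> * A k\<bar> \<le> (1 + \<sigma>) ^ 3 * C0"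
        unfolding abs_mult using \<sigma> \<sigma>1 C0 by (intro mult_mono) auto
      then show "\<bar>\<sigma> * A k\<bar> \<le> C" by (simp add: C_def mult.commute)
    next
      fix k l assume "k < d" "l < d"
      then have "\<bar>Q k l\<bar> \<le> C0" using T by (simp add: taylor2_def)
      then have "\<bar>\<sigma>\<^sup>2 * Q k l\<bar> \<le> (1 + \<sigma>) ^ 3 * C0"
        unfolding abs_mult using \<sigma> \<sigma>1 C0 by (intro mult_mono) auto
      then show "\<bar>\<sigma>\<^sup>2 * Q k l\<bar> \<le> C" by (simp add: C_def mult.commute)
    next
      fix h :: "nat \<Rightarrow> real"
      let ?err = "heat d s F (\<lambda>k. x k + h k) - (heat d s F (\<lambda>k. x k + 0) + (\<Sum>k<d. \<sigma> * A k * h k)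
         + (\<Sum>k<d. \<Sum>l<d. \<sigma>\<^sup>2 * Q k l * (h k * h l)) / 2)"
      have l1: "l1 d (\<lambda>k. \<sigma> * h k) = \<sigma> * l1 d h"
        unfolding l1_def using \<sigma> by (simp add: abs_mult sum_distrib_left)
      have "\<bar>?err\<bar> \<le> C0 * (\<sigma> * l1 d h) ^ 3"
      proof -
        have "(\<Sum>k<d. \<sigma> * A k * h k) = (\<Sum>k<d. A k * (\<sigma> * h k))"
          by (simp add: ac_simps)
        moreover have "(\<Sum>k<d. \<Sum>l<d. \<sigma>\<^sup>2 * Q k l * (h k * h l))
          = (\<Sum>k<d. \<Sum>l<d. Q k l * ((\<sigma> * h k) * (\<sigma> * h l)))"
          by (simp add: power2_eq_square ac_simps)
        ultimately show ?thesis
          using T[unfolded taylor2_def, THEN conjunct2, THEN conjunct2, rule_format, of "\<lambda>k. \<sigma> * h k"]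
            eq[of h] eq[of "\<lambda>_. 0"] by (simp only: l1 mult_zero_right)
      qed
      also have "\<dots> = C0 * \<sigma> ^ 3 * l1 d h ^ 3" by (simp add: power_mult_distrib)
      also have "\<dots> \<le> C * l1 d h ^ 3"
        unfolding C_def using \<sigma>1 C0 by (intro mult_right_mono mult_left_mono) auto
      finally show "\<bar>?err\<bar> \<le> C * l1 d h ^ 3" .
    qed
    then show ?thesis by blast
  qed
  then show ?thesis using C by blast
qed

section \<open>Lindeberg comparison and the gradient inequality\<close>

lemma gauss_linear_form:
  "integrable (gauss d) (\<lambda>y. \<Sum>j<d. u j * y j)" "(\<integral>y. (\<Sum>j<d. u j * y j) \<partial>gauss d) = 0"
proof -
  have i: "integrable (gauss d) (\<lambda>y. u j * y j)" if "j \<in> {..<d}" for j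
    using that by (intro integrable_mult_right gauss_first_moment) simp
  show "integrable (gauss d) (\<lambda>y. \<Sum>j<d. u j * y j)"
    using i by (rule Bochner_Integration.integrable_sum)
  show "(\<integral>y. (\<Sum>j<d. u j * y j) \<partial>gauss d) = 0"
    using i by (subst Bochner_Integration.integral_sum) (auto simp: gauss_first_moment)
qed

lemma gauss_linear_product:
  "integrable (gauss d) (\<lambda>y. (\<Sum>j<d. u j * y j) * (\<Sum>j<d. v j * y j))"
  "(\<integral>y. (\<Sum>j<d. u j * y j) * (\<Sum>j<d. v j * y j) \<partial>gauss d) = (\<Sum>j<d. u j * v j)"
proof -
  let ?m = "\<lambda>j l y. (u j * v l) * (y j * y l)"
  have e: "(\<Sum>j<d. u j * y j) * (\<Sum>j<d. v j * y j) = (\<Sum>j<d. \<Sum>l<d. ?m j l y)" for y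
    unfolding sum_product by (simp add: ac_simps)
  have i: "integrable (gauss d) (\<lambda>y. ?m j l y)" if "j < d" "l < d" for j l
    using that by (intro integrable_mult_right gauss_second_moment)
  have i': "integrable (gauss d) (\<lambda>y. \<Sum>l<d. ?m j l y)" if "j < d" for j
    using that by (intro Bochner_Integration.integrable_sum i) auto
  show "integrable (gauss d) (\<lambda>y. (\<Sum>j<d. u j * y j) * (\<Sum>j<d. v j * y j))"
    unfolding e by (intro Bochner_Integration.integrable_sum i') simp
  have "(\<integral>y. (\<Sum>j<d. u j * y j) * (\<Sum>j<d. v j * y j) \<partial>gauss d)
    = (\<Sum>j<d. \<integral>y. (\<Sum>l<d. ?m j l y) \<partial>gauss d)"
    unfolding e by (rule Bochner_Integration.integral_sum) (simp add: i')
  also have "\<dots> = (\<Sum>j<d. \<Sum>l<d. if j = l then u j * v j else 0)"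
  proof (rule sum.cong[OF refl])
    fix j assume j: "j \<in> {..<d}"
    have "(\<integral>y. (\<Sum>l<d. ?m j l y) \<partial>gauss d)
      = (\<Sum>l<d. \<integral>y. ?m j l y \<partial>gauss d)"
      using j by (intro Bochner_Integration.integral_sum i) auto
    also have "\<dots> = (\<Sum>l<d. if j = l then u j * v j else 0)"
      using j by (intro sum.cong refl) (auto simp: gauss_second_moment)
    finally show "(\<integral>y. (\<Sum>l<d. ?m j l y) \<partial>gauss d)
      = (\<Sum>l<d. if j = l then u j * v j else 0)" .
  qed
  also have "\<dots> = (\<Sum>j<d. u j * v j)" by (simp add: sum.delta)
  finally show "(\<integral>y. (\<Sum>j<d. u j * y j) * (\<Sum>j<d. v j * y j) \<partial>gauss d) = (\<Sum>j<d. u j * v j)" .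
qed

lemma l1_scale: "l1 d (\<lambda>k. r * h k) = \<bar>r\<bar> * l1 d h"
  unfolding l1_def by (simp add: abs_mult sum_distrib_left)

lemma l1_cube_le_exp: "(1 + l1 d y) ^ 3 \<le> 6 * exp (1 * (1 + l1 d y))"
  using cube_le_exp[of "1 + l1 d y"] by simp

text \<open>
  Lindeberg's observation: up to the cubic remainder, the mean of \<open>g\<close> at a random point depends only
  on the mean and the covariance of that point. It is applied to \<open>B\<^sub>i y\<close> and to a standard Gaussian
  vector of the target dimension, so that the two means agree up to order \<open>r\<^sup>3\<close>.
\<close>

lemma mean_taylor:
  assumes T: "taylor2 e C g a q" and C: "0 \<le> C" and r: "0 \<le> r" and \<Lambda>: "0 \<le> \<Lambda>"
    and h1: "\<And>k. k < e \<Longrightarrow> integrable (gauss d) (\<lambda>y. h y k)" "\<And>k. k < e \<Longrightarrow> (\<integral>y. h y k \<partial>gauss d) = 0"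
    and h2: "\<And>k l. k < e \<Longrightarrow> l < e \<Longrightarrow> integrable (gauss d) (\<lambda>y. h y k * h y l)"
      "\<And>k l. k < e \<Longrightarrow> l < e \<Longrightarrow> (\<integral>y. h y k * h y l \<partial>gauss d) = (if k = l then 1 else 0)"
    and hl: "\<And>y. l1 e (h y) \<le> \<Lambda> * l1 d y"
    and m: "(\<lambda>y. g (\<lambda>k. r * h y k)) \<in> borel_measurable (gauss d)"
  shows "\<bar>(\<integral>y. g (\<lambda>k. r * h y k) \<partial>gauss d) - (g (\<lambda>_. 0) + r\<^sup>2 / 2 * (\<Sum>k<e. q k k))\<bar>
     \<le> 6 * C * \<Lambda> ^ 3 * gauss_exp d 1 * r ^ 3"
proof -
  let ?q = "\<lambda>y. \<Sum>k<e. \<Sum>l<e. q k l * (h y k * h y l)"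
  let ?a = "\<lambda>y. \<Sum>k<e. a k * h y k"
  let ?g = "\<lambda>y. g (\<lambda>k. r * h y k)"
  define P where "P y = g (\<lambda>_. 0) + r * ?a y + r\<^sup>2 / 2 * ?q y" for y
  have iL: "integrable (gauss d) ?a"
    by (intro Bochner_Integration.integrable_sum integrable_mult_right h1) simp
  have L0: "(\<integral>y. ?a y \<partial>gauss d) = 0"
    using h1 by (subst Bochner_Integration.integral_sum) auto
  have iQ1: "integrable (gauss d) (\<lambda>y. \<Sum>l<e. q k l * (h y k * h y l))" if "k < e" for k
    using that by (intro Bochner_Integration.integrable_sum integrable_mult_right h2) auto
  have iQ: "integrable (gauss d) ?q"
    by (intro Bochner_Integration.integrable_sum iQ1) simp
  have Q0: "(\<integral>y. ?q y \<partial>gauss d) = (\<Sum>k<e. q k k)"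
  proof -
    have "(\<integral>y. ?q y \<partial>gauss d)
       = (\<Sum>k<e. \<integral>y. (\<Sum>l<e. q k l * (h y k * h y l)) \<partial>gauss d)"
      using iQ1 by (intro Bochner_Integration.integral_sum) simp
    also have "\<dots> = (\<Sum>k<e. \<Sum>l<e. if k = l then q k k else 0)"
    proof (rule sum.cong[OF refl])
      fix k assume k: "k \<in> {..<e}"
      have "(\<integral>y. (\<Sum>l<e. q k l * (h y k * h y l)) \<partial>gauss d) = (\<Sum>l<e. \<integral>y. q k l * (h y k * h y l) \<partial>gauss d)"
        using k by (intro Bochner_Integration.integral_sum integrable_mult_right h2) auto
      also have "\<dots> = (\<Sum>l<e. if k = l then q k k else 0)"
        using k by (intro sum.cong refl) (auto simp: h2)
      finally show "(\<integral>y. (\<Sum>l<e. q k l * (h y k * h y l)) \<partial>gauss d) = (\<Sum>l<e. if k = l then q k k else 0)" .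
    qed
    also have "\<dots> = (\<Sum>k<e. q k k)" by (simp add: sum.delta)
    finally show ?thesis .
  qed
  have iP: "integrable (gauss d) P"
    unfolding P_def by (intro Bochner_Integration.integrable_add integrable_mult_right iL iQ) simp
  have P0: "(\<integral>y. P y \<partial>gauss d) = g (\<lambda>_. 0) + r\<^sup>2 / 2 * (\<Sum>k<e. q k k)"
    unfolding P_def using iL iQ by (simp add: L0 Q0 gauss.prob_space[simplified])
  have R: "\<bar>?g y - P y\<bar> \<le> (6 * C * \<Lambda> ^ 3 * r ^ 3) * exp (1 * (1 + l1 d y))" for y
  proof -
    have "(\<Sum>k<e. a k * (r * h y k)) = r * ?a y"
      by (simp add: sum_distrib_left ac_simps)
    moreover have "(\<Sum>k<e. \<Sum>l<e. q k l * (r * h y k * (r * h y l)))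
        = r\<^sup>2 * ?q y"
      by (simp add: sum_distrib_left power2_eq_square ac_simps)
    ultimately have "\<bar>?g y - P y\<bar> \<le> C * (r * l1 e (h y)) ^ 3"
      using T[unfolded taylor2_def, THEN conjunct2, THEN conjunct2, rule_format, of "\<lambda>k. r * h y k"] r
      unfolding P_def l1_scale by simp
    also have "\<dots> \<le> C * (r * (\<Lambda> * (1 + l1 d y))) ^ 3"
    proof -
      have "l1 e (h y) \<le> \<Lambda> * (1 + l1 d y)" using hl[of y] \<Lambda> by (simp add: algebra_simps)
      then show ?thesis using C r by (intro mult_left_mono power_mono) auto
    qed
    also have "\<dots> = (C * \<Lambda> ^ 3 * r ^ 3) * (1 + l1 d y) ^ 3" by (simp add: power_mult_distrib)
    also have "\<dots> \<le> (C * \<Lambda> ^ 3 * r ^ 3) * (6 * exp (1 * (1 + l1 d y)))"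
      using C \<Lambda> r by (intro mult_left_mono l1_cube_le_exp) auto
    finally show ?thesis by simp
  qed
  have mR: "(\<lambda>y. ?g y - P y) \<in> borel_measurable (gauss d)"
    by (intro borel_measurable_diff m borel_measurable_integrable[OF iP])
  have iR: "integrable (gauss d) (\<lambda>y. ?g y - P y)"
    using R by (intro integrable_gauss_bound[OF mR]) blast
  have "(\<integral>y. ?g y \<partial>gauss d) = (\<integral>y. P y + (?g y - P y) \<partial>gauss d)" by simp
  also have "\<dots> = (\<integral>y. P y \<partial>gauss d) + (\<integral>y. ?g y - P y \<partial>gauss d)"
    by (rule Bochner_Integration.integral_add[OF iP iR])
  finally have "\<bar>(\<integral>y. ?g y \<partial>gauss d) - (g (\<lambda>_. 0) + r\<^sup>2 / 2 * (\<Sum>k<e. q k k))\<bar>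
     = \<bar>\<integral>y. ?g y - P y \<partial>gauss d\<bar>" by (simp add: P0)
  also have "\<dots> \<le> (6 * C * \<Lambda> ^ 3 * r ^ 3) * gauss_exp d 1"
    using R by (intro integral_gauss_bound[OF mR]) blast
  finally show ?thesis by (simp add: ac_simps)
qed

lemma pointwise_taylor1:
  assumes T: "taylor2 e C g a q" and C: "0 \<le> C" and r: "0 \<le> r" "r \<le> 1" and \<Lambda>: "1 \<le> \<Lambda>"
    and h: "l1 e h \<le> \<Lambda> * L" and L: "0 \<le> L"
  shows "\<bar>g (\<lambda>k. r * h k) - (g (\<lambda>_. 0) + r * (\<Sum>k<e. a k * h k))\<bar> \<le> C * \<Lambda> ^ 3 * (1 + L) ^ 3 * r\<^sup>2"
proof -
  let ?q = "\<Sum>k<e. \<Sum>l<e. q k l * (h k * h l)"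
  let ?a = "\<Sum>k<e. a k * h k"
  let ?g = "g (\<lambda>k. r * h k)"
  define x where "x = l1 e h"
  have x: "0 \<le> x" unfolding x_def by simp
  have q: "\<bar>?q\<bar> \<le> C * x\<^sup>2"
    unfolding x_def using T by (intro quadratic_le_l1) (auto simp: taylor2_def)
  have "(\<Sum>k<e. a k * (r * h k)) = r * ?a"
    by (simp add: sum_distrib_left ac_simps)
  moreover have "(\<Sum>k<e. \<Sum>l<e. q k l * (r * h k * (r * h l))) = r\<^sup>2 * ?q"
    by (simp add: sum_distrib_left power2_eq_square ac_simps)
  ultimately have "\<bar>?g - (g (\<lambda>_. 0) + r * ?a
     + r\<^sup>2 * ?q / 2)\<bar> \<le> C * (r * x) ^ 3"
    using T[unfolded taylor2_def, THEN conjunct2, THEN conjunct2, rule_format, of "\<lambda>k. r * h k"] r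
    unfolding l1_scale x_def by simp
  moreover have "\<bar>r\<^sup>2 * ?q / 2\<bar> \<le> r\<^sup>2 * (C * x\<^sup>2) / 2"
    using mult_left_mono[OF q, of "r\<^sup>2"] by (simp add: abs_mult)
  ultimately have "\<bar>?g - (g (\<lambda>_. 0) + r * ?a)\<bar>
     \<le> C * (r * x) ^ 3 + r\<^sup>2 * (C * x\<^sup>2) / 2" by linarith
  also have "\<dots> \<le> C * r\<^sup>2 * x ^ 3 + C * r\<^sup>2 * x\<^sup>2"
  proof (rule add_mono)
    have "r ^ 3 \<le> r\<^sup>2" using r by (intro power_decreasing) auto
    then have "C * (r ^ 3 * x ^ 3) \<le> C * (r\<^sup>2 * x ^ 3)" using x C by (intro mult_left_mono mult_right_mono) auto
    then show "C * (r * x) ^ 3 \<le> C * r\<^sup>2 * x ^ 3" by (simp add: power_mult_distrib)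
    have "0 \<le> r\<^sup>2 * (C * x\<^sup>2)" using C by simp
    then show "r\<^sup>2 * (C * x\<^sup>2) / 2 \<le> C * r\<^sup>2 * x\<^sup>2" by (simp add: ac_simps)
  qed
  also have "\<dots> = (C * r\<^sup>2) * (x ^ 3 + x\<^sup>2)" by (simp add: algebra_simps)
  also have "\<dots> \<le> (C * r\<^sup>2) * (\<Lambda> ^ 3 * (1 + L) ^ 3)"
  proof (rule mult_left_mono)
    have "x ^ 3 + x\<^sup>2 \<le> (1 + x) ^ 3" using x by (simp add: power2_eq_square power3_eq_cube algebra_simps)
    also have "1 + x \<le> \<Lambda> * (1 + L)" using h \<Lambda> by (simp add: x_def algebra_simps)
    then have "(1 + x) ^ 3 \<le> (\<Lambda> * (1 + L)) ^ 3" using x by (intro power_mono) auto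
    finally show "x ^ 3 + x\<^sup>2 \<le> \<Lambda> ^ 3 * (1 + L) ^ 3" by (simp add: power_mult_distrib)
  qed (use C in simp)
  finally show ?thesis by (simp add: ac_simps)
qed

definition mv :: "nat \<Rightarrow> (nat \<Rightarrow> nat \<Rightarrow> real) \<Rightarrow> (nat \<Rightarrow> real) \<Rightarrow> nat \<Rightarrow> real" where
  "mv N \<beta> x k = (\<Sum>j<N. \<beta> k j * x j)"

lemma mv_add: "mv N \<beta> (\<lambda>j. x j + r * y j) k = mv N \<beta> x k + r * mv N \<beta> y k"
  by (simp add: mv_def distrib_left sum.distrib sum_distrib_left ac_simps)

lemma l1_mv: "l1 e (mv N \<beta> y) \<le> (\<Sum>k<e. \<Sum>j<N. \<bar>\<beta> k j\<bar>) * l1 N y"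
  unfolding l1_def[of e] mv_def sum_distrib_right
  by (intro sum_mono sum_abs[THEN order_trans]) (auto simp: abs_mult intro!: mult_left_mono abs_le_l1)

text \<open>
  The hypotheses \<open>B\<^sub>i B\<^sub>i\<^sup>* = I\<close> and \<open>\<Sum> c\<^sub>i B\<^sub>i\<^sup>* B\<^sub>i = I\<close> in terms of the matrices \<open>b i\<close> of the
  maps \<open>B\<^sub>i\<close>.
\<close>

locale geometric_datum =
  fixes I :: "'i set" and N :: nat and n :: "'i \<Rightarrow> nat" and c :: "'i \<Rightarrow> real"
    and b :: "'i \<Rightarrow> nat \<Rightarrow> nat \<Rightarrow> real"
  assumes fin: "finite I" and c_pos: "\<And>i. i \<in> I \<Longrightarrow> 0 < c i"
    and orthonormal_rows: "\<And>i k l. i \<in> I \<Longrightarrow> k < n i \<Longrightarrow> l < n i \<Longrightarrow>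
        (\<Sum>j<N. b i k j * b i l j) = (if k = l then 1 else 0)"
    and resolution: "\<And>j l. j < N \<Longrightarrow> l < N \<Longrightarrow>
        (\<Sum>i\<in>I. c i * (\<Sum>k<n i. b i k j * b i k l)) = (if j = l then 1 else 0)"
begin

lemma resolution_norm: "(\<Sum>i\<in>I. c i * (\<Sum>k<n i. (mv N (b i) v k)\<^sup>2)) = (\<Sum>j<N. (v j)\<^sup>2)"
proof -
  define G where "G i j l = (\<Sum>k<n i. b i k j * b i k l)" for i j l
  have 1: "(\<Sum>k<n i. (mv N (b i) v k)\<^sup>2) = (\<Sum>j<N. \<Sum>l<N. G i j l * (v j * v l))" for i
  proof -
    have "(\<Sum>k<n i. (mv N (b i) v k)\<^sup>2) = (\<Sum>k<n i. \<Sum>j<N. \<Sum>l<N. b i k j * b i k l * (v j * v l))"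
      unfolding mv_def power2_eq_square sum_product by (simp add: ac_simps)
    also have "\<dots> = (\<Sum>j<N. \<Sum>k<n i. \<Sum>l<N. b i k j * b i k l * (v j * v l))"
      by (rule sum.swap)
    also have "\<dots> = (\<Sum>j<N. \<Sum>l<N. \<Sum>k<n i. b i k j * b i k l * (v j * v l))"
      by (intro sum.cong refl sum.swap)
    finally show ?thesis unfolding G_def by (simp only: sum_distrib_right)
  qed
  have "(\<Sum>i\<in>I. c i * (\<Sum>k<n i. (mv N (b i) v k)\<^sup>2))
     = (\<Sum>i\<in>I. \<Sum>j<N. \<Sum>l<N. c i * G i j l * (v j * v l))"
    unfolding 1 by (simp only: sum_distrib_left mult.assoc)
  also have "\<dots> = (\<Sum>j<N. \<Sum>i\<in>I. \<Sum>l<N. c i * G i j l * (v j * v l))"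
    by (rule sum.swap)
  also have "\<dots> = (\<Sum>j<N. \<Sum>l<N. \<Sum>i\<in>I. c i * G i j l * (v j * v l))"
    by (intro sum.cong refl sum.swap)
  also have "\<dots> = (\<Sum>j<N. \<Sum>l<N. (\<Sum>i\<in>I. c i * G i j l) * (v j * v l))"
    by (simp only: sum_distrib_right)
  also have "\<dots> = (\<Sum>j<N. \<Sum>l<N. (if j = l then 1 else 0) * (v j * v l))"
    by (intro sum.cong refl) (simp add: resolution G_def)
  also have "\<dots> = (\<Sum>j<N. (v j)\<^sup>2)"
    by (simp add: if_distrib[of "\<lambda>x. x * _"] power2_eq_square cong: if_cong)
  finally show ?thesis .
qed

text \<open>
  For \<open>v = \<Sum> c\<^sub>i B\<^sub>i\<^sup>* \<alpha>\<^sub>i\<close> one has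
  \<open>|v|\<^sup>2 = \<Sum> c\<^sub>i \<langle>\<alpha>\<^sub>i, B\<^sub>i v\<rangle> \<le> \<Sum> c\<^sub>i |\<alpha>\<^sub>i|\<^sup>2 / 2 + \<Sum> c\<^sub>i |B\<^sub>i v|\<^sup>2 / 2\<close>, and the last sum equals
  \<open>|v|\<^sup>2 / 2\<close>. In the application \<open>\<alpha>\<^sub>i\<close> is the logarithmic gradient of the \<open>i\<close>-th factor.
\<close>

lemma gradient_inequality:
  fixes \<alpha> :: "'i \<Rightarrow> nat \<Rightarrow> real"
  defines "u \<equiv> \<lambda>i j. \<Sum>k<n i. \<alpha> i k * b i k j"
  shows "(\<Sum>j<N. (\<Sum>i\<in>I. c i * u i j)\<^sup>2) \<le> (\<Sum>i\<in>I. c i * (\<Sum>j<N. (u i j)\<^sup>2))"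
proof -
  define v where "v j = (\<Sum>i\<in>I. c i * u i j)" for j
  have u2: "(\<Sum>j<N. (u i j)\<^sup>2) = (\<Sum>k<n i. (\<alpha> i k)\<^sup>2)" if i: "i \<in> I" for i
  proof -
    have "(\<Sum>j<N. (u i j)\<^sup>2) = (\<Sum>j<N. \<Sum>k<n i. \<Sum>l<n i. (\<alpha> i k * \<alpha> i l) * (b i k j * b i l j))"
      unfolding u_def power2_eq_square sum_product by (simp add: ac_simps)
    also have "\<dots> = (\<Sum>k<n i. \<Sum>j<N. \<Sum>l<n i. (\<alpha> i k * \<alpha> i l) * (b i k j * b i l j))"
      by (rule sum.swap)
    also have "\<dots> = (\<Sum>k<n i. \<Sum>l<n i. \<Sum>j<N. (\<alpha> i k * \<alpha> i l) * (b i k j * b i l j))"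
      by (intro sum.cong refl sum.swap)
    also have "\<dots> = (\<Sum>k<n i. \<Sum>l<n i. (\<alpha> i k * \<alpha> i l) * (if k = l then 1 else 0))"
      by (intro sum.cong refl) (simp add: sum_distrib_left[symmetric] orthonormal_rows[OF i])
    also have "\<dots> = (\<Sum>k<n i. (\<alpha> i k)\<^sup>2)"
      by (simp add: if_distrib[of "\<lambda>x. _ * x"] power2_eq_square cong: if_cong)
    finally show ?thesis .
  qed
  have uv: "(\<Sum>j<N. u i j * v j) = (\<Sum>k<n i. \<alpha> i k * mv N (b i) v k)" for i
    unfolding u_def mv_def sum_distrib_right sum_distrib_left
    by (subst sum.swap) (simp add: ac_simps)
  have "(\<Sum>j<N. (v j)\<^sup>2) = (\<Sum>i\<in>I. c i * (\<Sum>j<N. u i j * v j))"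
  proof -
    have "(\<Sum>j<N. (v j)\<^sup>2) = (\<Sum>j<N. \<Sum>i\<in>I. c i * (u i j * v j))"
      unfolding power2_eq_square by (subst (1) v_def) (simp add: sum_distrib_right mult.assoc)
    also have "\<dots> = (\<Sum>i\<in>I. \<Sum>j<N. c i * (u i j * v j))" by (rule sum.swap)
    finally show ?thesis by (simp add: sum_distrib_left)
  qed
  also have "\<dots> \<le> (\<Sum>i\<in>I. c i * (((\<Sum>j<N. (u i j)\<^sup>2) + (\<Sum>k<n i. (mv N (b i) v k)\<^sup>2)) / 2))"
  proof (intro sum_mono mult_left_mono)
    fix i assume i: "i \<in> I"
    have "\<alpha> i k * mv N (b i) v k \<le> ((\<alpha> i k)\<^sup>2 + (mv N (b i) v k)\<^sup>2) / 2" for k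
      using sum_squares_bound[of "\<alpha> i k" "mv N (b i) v k"] by (simp add: field_simps)
    then have "(\<Sum>k<n i. \<alpha> i k * mv N (b i) v k) \<le> (\<Sum>k<n i. ((\<alpha> i k)\<^sup>2 + (mv N (b i) v k)\<^sup>2) / 2)"
      by (intro sum_mono)
    then show "(\<Sum>j<N. u i j * v j) \<le> ((\<Sum>j<N. (u i j)\<^sup>2) + (\<Sum>k<n i. (mv N (b i) v k)\<^sup>2)) / 2"
      unfolding uv u2[OF i] sum_divide_distrib[symmetric] sum.distrib .
    show "0 \<le> c i" using c_pos[OF i] by simp
  qed
  also have "\<dots> = ((\<Sum>i\<in>I. c i * (\<Sum>j<N. (u i j)\<^sup>2)) + (\<Sum>j<N. (v j)\<^sup>2)) / 2"
    unfolding resolution_norm[of v, symmetric]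
    by (simp only: sum.distrib[symmetric] sum_divide_distrib distrib_left[symmetric] times_divide_eq_right)
  finally show ?thesis unfolding v_def by simp
qed

end

section \<open>One short step of the flow\<close>

context geometric_datum
begin

text \<open>
  What a short step requires of the factors \<open>g i\<close>, seen as functions of the displacement from the
  base point: uniform expansions, uniform bounds, and measurability along the two Gaussian vectors that
  are compared.
\<close>

definition expandable ::
  "real \<Rightarrow> real \<Rightarrow> real \<Rightarrow> real \<Rightarrow> ('i \<Rightarrow> (nat \<Rightarrow> real) \<Rightarrow> real) \<Rightarrow> ('i \<Rightarrow> nat \<Rightarrow> real) \<Rightarrow>
    ('i \<Rightarrow> nat \<Rightarrow> nat \<Rightarrow> real) \<Rightarrow> bool" where
  "expandable C lo hi r g a q \<longleftrightarrow>
    (\<forall>i\<in>I. taylor2 (n i) C (g i) (a i) (q i) \<and> (\<forall>h. lo \<le> g i h \<and> g i h \<le> hi) \<and>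
       (\<lambda>y. g i (\<lambda>k. r * mv N (b i) y k)) \<in> borel_measurable (gauss N) \<and>
       (\<lambda>z. g i (\<lambda>k. r * z k)) \<in> borel_measurable (gauss (n i)))"

text \<open>
  The heart of the proof: the inequality over a time step \<open>r\<^sup>2\<close> with a relative loss of order \<open>r\<^sup>3\<close>.
  Each factor is divided by its heat average \<open>p i\<close> in the target space and written as \<open>1 + w i\<close>, and
  \<open>prod_powr_second_order\<close> is integrated: the linear term is negligible by \<open>mean_taylor\<close>, and the
  quadratic term has nonpositive mean to leading order by \<open>gradient_inequality\<close>.
\<close>

lemma local_step:
  assumes C: "0 \<le> C" and lo: "0 < lo" and lohi: "lo \<le> hi"
  shows "\<exists>K\<ge>0. \<forall>r g a q. 0 \<le> r \<longrightarrow> r \<le> 1 \<longrightarrow>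
    expandable C lo hi r g a q \<longrightarrow>
    (\<integral>y. (\<Prod>i\<in>I. g i (\<lambda>k. r * mv N (b i) y k) powr c i) \<partial>gauss N)
      \<le> (1 + K * r ^ 3) * (\<Prod>i\<in>I. (\<integral>z. g i (\<lambda>k. r * z k) \<partial>gauss (n i)) powr c i)"
proof -
  define S where "S = (\<Sum>i\<in>I. c i)"
  have S: "0 \<le> S" unfolding S_def by (intro sum_nonneg) (simp add: c_pos less_imp_le)
  define \<Lambda> where "\<Lambda> = 1 + (\<Sum>i\<in>I. \<Sum>k<n i. \<Sum>j<N. \<bar>b i k j\<bar>)"
  have \<Lambda>: "1 \<le> \<Lambda>" unfolding \<Lambda>_def by (simp add: sum_nonneg)
  have l1_b: "l1 (n i) (mv N (b i) y) \<le> \<Lambda> * l1 N y" if "i \<in> I" for i y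
  proof -
    have "(\<Sum>k<n i. \<Sum>j<N. \<bar>b i k j\<bar>) \<le> (\<Sum>i\<in>I. \<Sum>k<n i. \<Sum>j<N. \<bar>b i k j\<bar>)"
      using that fin by (intro member_le_sum[of i I "\<lambda>i. \<Sum>k<n i. \<Sum>j<N. \<bar>b i k j\<bar>"]) (auto intro!: sum_nonneg)
    then have "(\<Sum>k<n i. \<Sum>j<N. \<bar>b i k j\<bar>) * l1 N y \<le> \<Lambda> * l1 N y"
      unfolding \<Lambda>_def by (intro mult_right_mono) auto
    then show ?thesis using l1_mv[of "n i" N "b i" y] by (rule order_trans[rotated])
  qed
  define D where "D = (\<Sum>i\<in>I. gauss_exp (n i) 1)"
  have D: "gauss_exp (n i) 1 \<le> D" if "i \<in> I" for i
    unfolding D_def using that fin by (intro member_le_sum[of i I "\<lambda>i. gauss_exp (n i) 1"]) (auto intro: gauss_exp_nonneg)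
  have D0: "0 \<le> D" unfolding D_def by (intro sum_nonneg gauss_exp_nonneg)
  define nn where "nn = (\<Sum>i\<in>I. real (n i))"
  have nn: "real (n i) \<le> nn" if "i \<in> I" for i
    unfolding nn_def using that fin by (intro member_le_sum[of i I "\<lambda>i. real (n i)"]) auto
  have nn0: "0 \<le> nn" unfolding nn_def by (simp add: sum_nonneg)
  define E where "E y = exp (1 + l1 N y)" for y
  have E1: "1 \<le> E y" for y unfolding E_def using l1_nonneg[of N y] by simp
  have E2: "(E y)\<^sup>2 = exp (2 * (1 + l1 N y))" and E3: "E y ^ 3 = exp (3 * (1 + l1 N y))" for y
    unfolding E_def by (simp_all add: exp_of_nat_mult[symmetric])
  \<comment> \<open>Up to powers of \<open>r\<close> and \<open>E\<close>, \<open>K1\<close> bounds the mean of \<open>w i\<close>, \<open>K2\<close> the distance from \<open>w i\<close> to its linear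
    part \<open>r * lin i\<close>, \<open>K3\<close> the form \<open>lin i\<close>, \<open>K4\<close> the function \<open>w i\<close>, and \<open>K5\<close> the change of the
    quadratic term when \<open>w i\<close> is replaced by its linear part.\<close>
  define K1 where "K1 = 6 * C * (\<Lambda> ^ 3 * gauss_exp N 1 + D) / lo"
  define K2 where "K2 = (6 * C * \<Lambda> ^ 3 + (C * nn + 6 * C * D)) / lo"
  define K3 where "K3 = C * \<Lambda> / lo"
  define K4 where "K4 = K2 + K3"
  define K5 where "K5 = 2 * (S\<^sup>2 + S) * (K2 * K4)"
  have K1: "0 \<le> K1" unfolding K1_def using C \<Lambda> D0 lo gauss_exp_nonneg[of N 1] by simp
  have K2: "0 \<le> K2" unfolding K2_def using C \<Lambda> D0 lo nn0 by simp
  have K3: "0 \<le> K3" unfolding K3_def using C \<Lambda> lo by simp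
  have K4: "0 \<le> K4" unfolding K4_def using K2 K3 by simp
  have K5: "0 \<le> K5" unfolding K5_def using K2 K4 S by simp
  define \<kappa> where "\<kappa> = lo / hi"
  have hi: "0 < hi" using lo lohi by simp
  have \<kappa>: "0 < \<kappa>" "\<kappa> \<le> 1" unfolding \<kappa>_def using lo lohi hi by simp_all
  define M where "M = hi / lo"
  have M: "1 \<le> M" unfolding M_def using lo lohi by simp
  obtain CR where CR: "0 \<le> CR" "\<And>w \<tau>. 0 \<le> \<tau> \<Longrightarrow> (\<And>i. i \<in> I \<Longrightarrow> \<kappa> \<le> 1 + w i \<and> \<bar>w i\<bar> \<le> M \<and> \<bar>w i\<bar> \<le> \<tau>) \<Longrightarrow>
    (\<Prod>i\<in>I. (1 + w i) powr c i) \<le>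
      1 + (\<Sum>i\<in>I. c i * w i) + ((\<Sum>i\<in>I. c i * w i)\<^sup>2 - (\<Sum>i\<in>I. c i * (w i)\<^sup>2)) / 2 + CR * \<tau> ^ 3"
  proof -
    have M0: "0 \<le> M" using M by simp
    have c0: "0 \<le> c i" if "i \<in> I" for i using c_pos[OF that] by simp
    obtain C' where "0 \<le> C'" and C': "\<forall>w \<tau>. 0 \<le> \<tau> \<longrightarrow> (\<forall>i\<in>I. \<kappa> \<le> 1 + w i \<and> \<bar>w i\<bar> \<le> M \<and> \<bar>w i\<bar> \<le> \<tau>) \<longrightarrow>
      (\<Prod>i\<in>I. (1 + w i) powr c i) \<le>
      1 + (\<Sum>i\<in>I. c i * w i) + ((\<Sum>i\<in>I. c i * w i)\<^sup>2 - (\<Sum>i\<in>I. c i * (w i)\<^sup>2)) / 2 + C' * \<tau> ^ 3"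
      using prod_powr_second_order[of I c \<kappa> M, OF fin c0 \<kappa> M0] by blast
    show ?thesis
      by (rule that[OF \<open>0 \<le> C'\<close>]) (use C' in simp)
  qed
  define K where "K = S * K1 + K5 / 2 * gauss_exp N 2 + CR * K4 ^ 3 * gauss_exp N 3"
  have K: "0 \<le> K"
    unfolding K_def using S K1 K5 CR(1) K4 gauss_exp_nonneg by simp
  have "(\<integral>y. (\<Prod>i\<in>I. g i (\<lambda>k. r * mv N (b i) y k) powr c i) \<partial>gauss N)
      \<le> (1 + K * r ^ 3) * (\<Prod>i\<in>I. (\<integral>z. g i (\<lambda>k. r * z k) \<partial>gauss (n i)) powr c i)"
    if r: "0 \<le> r" "r \<le> 1" and H: "expandable C lo hi r g a q" for r g a q
  proof -
    have T: "taylor2 (n i) C (g i) (a i) (q i)" and g_lo: "lo \<le> g i h" and g_hi: "g i h \<le> hi"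
      and mN: "(\<lambda>y. g i (\<lambda>k. r * mv N (b i) y k)) \<in> borel_measurable (gauss N)"
      and mn: "(\<lambda>z. g i (\<lambda>k. r * z k)) \<in> borel_measurable (gauss (n i))" if "i \<in> I" for i h
      using H that by (auto simp: expandable_def)
    have r32: "r ^ 3 \<le> r\<^sup>2" "r\<^sup>2 \<le> r"
      using r power_decreasing[of 2 3 r] power_decreasing[of 1 2 r] by auto
    have rp: "0 \<le> r ^ 3" using r by simp
    let ?d = "\<lambda>i y k. r * mv N (b i) y k"
    define t where "t i = (\<Sum>k<n i. q i k k)" for i
    define A where "A i = (\<integral>y. g i (?d i y) \<partial>gauss N)" for i
    define p where "p i = (\<integral>z. g i (\<lambda>k. r * z k) \<partial>gauss (n i))" for i
    define w where "w i y = g i (?d i y) / p i - 1" for i y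
    define \<alpha> where "\<alpha> i k = a i k / p i" for i k
    define u where "u i j = (\<Sum>k<n i. \<alpha> i k * b i k j)" for i j
    define lin where "lin i y = (\<Sum>j<N. u i j * y j)" for i y
    let ?W = "\<lambda>y. \<Sum>i\<in>I. c i * w i y"
    let ?W2 = "\<lambda>y. \<Sum>i\<in>I. c i * (w i y)\<^sup>2"
    let ?P = "\<lambda>y. \<Prod>i\<in>I. (1 + w i y) powr c i"
    let ?a = "\<lambda>i y. \<Sum>k<n i. a i k * mv N (b i) y k"
    have abs_hi: "\<bar>g i h\<bar> \<le> hi" if "i \<in> I" for i h using g_lo[OF that, of h] g_hi[OF that, of h] lo by simp
    have p: "lo \<le> p i" "p i \<le> hi" if i: "i \<in> I" for i
    proof -
      have "integrable (gauss (n i)) (\<lambda>z. g i (\<lambda>k. r * z k))"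
        using abs_hi[OF i] by (intro integrable_gauss_bounded[OF mn[OF i]]) auto
      then show "lo \<le> p i" "p i \<le> hi"
        unfolding p_def using g_lo[OF i] g_hi[OF i]
        by (auto intro!: gauss.integral_ge_const gauss.integral_le_const AE_I2)
    qed
    have p0: "0 < p i" if "i \<in> I" for i using p[OF that] lo by simp
    have t_le: "\<bar>t i\<bar> \<le> C * nn" if i: "i \<in> I" for i
    proof -
      have "\<bar>t i\<bar> \<le> (\<Sum>k<n i. C)"
        unfolding t_def using T[OF i] by (intro sum_abs[THEN order_trans] sum_mono) (auto simp: taylor2_def)
      also have "\<dots> \<le> C * nn" using C nn[OF i] by (simp add: mult.commute mult_left_mono)
      finally show ?thesis .
    qed
    have A_exp: "\<bar>A i - (g i (\<lambda>_. 0) + r\<^sup>2 / 2 * t i)\<bar> \<le> 6 * C * (\<Lambda> ^ 3 * gauss_exp N 1) * r ^ 3" if i: "i \<in> I" for i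
    proof -
      have "\<bar>A i - (g i (\<lambda>_. 0) + r\<^sup>2 / 2 * t i)\<bar> \<le> 6 * C * \<Lambda> ^ 3 * gauss_exp N 1 * r ^ 3"
        unfolding A_def t_def
      proof (rule mean_taylor[OF T[OF i] C r(1)])
        show "0 \<le> \<Lambda>" using \<Lambda> by simp
        show "integrable (gauss N) (\<lambda>y. mv N (b i) y k)" "(\<integral>y. mv N (b i) y k \<partial>gauss N) = 0" for k
          unfolding mv_def by (rule gauss_linear_form)+
        show "integrable (gauss N) (\<lambda>y. mv N (b i) y k * mv N (b i) y l)" for k l
          unfolding mv_def by (rule gauss_linear_product)
        show "(\<integral>y. mv N (b i) y k * mv N (b i) y l \<partial>gauss N) = (if k = l then 1 else 0)"
          if "k < n i" "l < n i" for k l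
          unfolding mv_def gauss_linear_product orthonormal_rows[OF i that] ..
      qed (use l1_b[OF i] mN[OF i] in auto)
      then show ?thesis by (simp add: mult.assoc)
    qed
    have p_exp: "\<bar>p i - (g i (\<lambda>_. 0) + r\<^sup>2 / 2 * t i)\<bar> \<le> 6 * C * D * r ^ 3" if i: "i \<in> I" for i
    proof -
      have "\<bar>p i - (g i (\<lambda>_. 0) + r\<^sup>2 / 2 * t i)\<bar> \<le> 6 * C * 1 ^ 3 * gauss_exp (n i) 1 * r ^ 3"
        unfolding p_def t_def
      proof (rule mean_taylor[OF T[OF i] C r(1)])
        show "integrable (gauss (n i)) (\<lambda>y. y k)" "(\<integral>y. y k \<partial>gauss (n i)) = 0" if "k < n i" for k
          using gauss_first_moment[OF that] by auto
        show "integrable (gauss (n i)) (\<lambda>y. y k * y l)" "(\<integral>y. y k * y l \<partial>gauss (n i)) = (if k = l then 1 else 0)"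
          if "k < n i" "l < n i" for k l
          using gauss_second_moment[OF that] by auto
      qed (use mn[OF i] in auto)
      also have "\<dots> \<le> 6 * C * D * r ^ 3" using C D[OF i] rp by (simp add: mult_left_mono mult_right_mono)
      finally show ?thesis .
    qed
    have iN: "integrable (gauss N) (\<lambda>y. g i (?d i y))" if i: "i \<in> I" for i
      using abs_hi[OF i] by (intro integrable_gauss_bounded[OF mN[OF i]]) auto
    have iw: "integrable (gauss N) (w i)" if i: "i \<in> I" for i
      unfolding w_def by (intro Bochner_Integration.integrable_diff integrable_divide iN[OF i]) simp
    have mean_w: "(\<integral>y. w i y \<partial>gauss N) \<le> K1 * r ^ 3" if i: "i \<in> I" for i
    proof -
      have "(\<integral>y. w i y \<partial>gauss N) = (A i - p i) / p i"
        unfolding w_def A_def using iN[OF i] p0[OF i]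
        by (simp add: gauss.prob_space[simplified] diff_divide_distrib)
      also have "\<dots> \<le> \<bar>A i - p i\<bar> / p i" using p0[OF i] by (intro divide_right_mono) auto
      also have "\<dots> \<le> \<bar>A i - p i\<bar> / lo" using p[OF i] lo p0[OF i] by (intro divide_left_mono) auto
      also have "\<bar>A i - p i\<bar> \<le> 6 * C * (\<Lambda> ^ 3 * gauss_exp N 1) * r ^ 3 + 6 * C * D * r ^ 3"
        using A_exp[OF i] p_exp[OF i] by linarith
      also have "(6 * C * (\<Lambda> ^ 3 * gauss_exp N 1) * r ^ 3 + 6 * C * D * r ^ 3) / lo = K1 * r ^ 3"
        unfolding K1_def by (simp add: algebra_simps add_divide_distrib)
      finally show ?thesis using lo by (simp add: divide_right_mono)
    qed
    have lin_eq: "lin i y = ?a i y / p i" for i y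
    proof -
      have "lin i y = (\<Sum>j<N. \<Sum>k<n i. \<alpha> i k * b i k j * y j)"
        unfolding lin_def u_def by (simp add: sum_distrib_right)
      also have "\<dots> = (\<Sum>k<n i. \<Sum>j<N. \<alpha> i k * b i k j * y j)" by (rule sum.swap)
      also have "\<dots> = (?a i y / p i)"
        unfolding mv_def \<alpha>_def by (simp add: sum_distrib_left sum_divide_distrib mult.assoc)
      finally show ?thesis by (simp add: sum_divide_distrib)
    qed
    have w_lin: "\<bar>w i y - r * lin i y\<bar> \<le> K2 * r\<^sup>2 * E y" if i: "i \<in> I" for i y
    proof -
      define X where "X = g i (?d i y) - (g i (\<lambda>_. 0) + r * ?a i y)"
      have "\<bar>X\<bar> \<le> C * \<Lambda> ^ 3 * (1 + l1 N y) ^ 3 * r\<^sup>2"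
        unfolding X_def by (rule pointwise_taylor1[OF T[OF i] C r \<Lambda> l1_b[OF i]]) simp
      also have "\<dots> \<le> C * \<Lambda> ^ 3 * (6 * E y) * r\<^sup>2"
        using l1_cube_le_exp[of N y] C \<Lambda> unfolding E_def
        by (intro mult_right_mono mult_left_mono) auto
      finally have X: "\<bar>X\<bar> \<le> 6 * C * \<Lambda> ^ 3 * r\<^sup>2 * E y" by (simp add: ac_simps)
      have "\<bar>p i - g i (\<lambda>_. 0)\<bar> \<le> r\<^sup>2 * (C * nn) + 6 * C * D * r\<^sup>2"
      proof -
        have "\<bar>r\<^sup>2 / 2 * t i\<bar> \<le> r\<^sup>2 * (C * nn)"
        proof -
          have "\<bar>r\<^sup>2 / 2 * t i\<bar> = r\<^sup>2 / 2 * \<bar>t i\<bar>" by (simp add: abs_mult)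
          also have "\<dots> \<le> r\<^sup>2 * (C * nn)"
            by (intro mult_mono t_le[OF i]) auto
          finally show ?thesis .
        qed
        moreover have "6 * C * D * r ^ 3 \<le> 6 * C * D * r\<^sup>2"
          using C D0 r32 by (intro mult_left_mono) auto
        ultimately show ?thesis using p_exp[OF i] by linarith
      qed
      also have "\<dots> = (C * nn + 6 * C * D) * r\<^sup>2" by (simp add: algebra_simps)
      also have "\<dots> \<le> (C * nn + 6 * C * D) * r\<^sup>2 * E y"
        using E1[of y] C D0 nn0 mult_left_mono[of 1 "E y" "(C * nn + 6 * C * D) * r\<^sup>2"] by simp
      finally have Y: "\<bar>p i - g i (\<lambda>_. 0)\<bar> \<le> (C * nn + 6 * C * D) * r\<^sup>2 * E y" .
      have "w i y - r * lin i y = (X - (p i - g i (\<lambda>_. 0))) / p i"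
        unfolding w_def lin_eq X_def using p0[OF i] by (simp add: field_simps)
      then have "\<bar>w i y - r * lin i y\<bar> = \<bar>X - (p i - g i (\<lambda>_. 0))\<bar> / p i"
        using p0[OF i] by simp
      also have "\<dots> \<le> \<bar>X - (p i - g i (\<lambda>_. 0))\<bar> / lo"
        using p[OF i] lo p0[OF i] by (intro divide_left_mono) auto
      also have "\<dots> \<le> (6 * C * \<Lambda> ^ 3 * r\<^sup>2 * E y + (C * nn + 6 * C * D) * r\<^sup>2 * E y) / lo"
        using X Y lo by (intro divide_right_mono) linarith+
      also have "\<dots> = K2 * r\<^sup>2 * E y" unfolding K2_def by (simp add: algebra_simps add_divide_distrib)
      finally show ?thesis .
    qed
    have lin_le: "\<bar>lin i y\<bar> \<le> K3 * E y" if i: "i \<in> I" for i y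
    proof -
      have "\<bar>lin i y\<bar> = \<bar>?a i y\<bar> / p i"
        unfolding lin_eq using p0[OF i] by simp
      also have "\<dots> \<le> \<bar>?a i y\<bar> / lo"
        using p[OF i] lo p0[OF i] by (intro divide_left_mono) auto
      also have "\<bar>?a i y\<bar> \<le> C * l1 (n i) (mv N (b i) y)"
        using T[OF i] by (intro linear_le_l1) (auto simp: taylor2_def)
      also have "\<dots> \<le> C * (\<Lambda> * E y)"
      proof (intro mult_left_mono C)
        have "l1 N y \<le> E y" unfolding E_def by (rule order_trans[OF _ exp_ge_add_one_self]) simp
        then have "\<Lambda> * l1 N y \<le> \<Lambda> * E y" using \<Lambda> by (intro mult_left_mono) auto
        then show "l1 (n i) (mv N (b i) y) \<le> \<Lambda> * E y" using l1_b[OF i, of y] by linarith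
      qed
      also have "C * (\<Lambda> * E y) / lo = K3 * E y" by (simp add: K3_def)
      finally show ?thesis using lo by (simp add: divide_right_mono)
    qed
    have w_le: "\<bar>w i y\<bar> \<le> K4 * r * E y" if i: "i \<in> I" for i y
    proof -
      have "K2 * r\<^sup>2 * E y \<le> K2 * r * E y"
        using K2 r32 E1[of y] by (intro mult_right_mono mult_left_mono) auto
      moreover have "\<bar>r * lin i y\<bar> \<le> K3 * r * E y"
        using mult_left_mono[OF lin_le[OF i, of y] r(1)] r by (simp add: abs_mult ac_simps)
      ultimately have "\<bar>w i y\<bar> \<le> K2 * r * E y + K3 * r * E y"
        using w_lin[OF i, of y] by linarith
      then show ?thesis by (simp add: K4_def algebra_simps)
    qed
    define Ql where "Ql y = (\<Sum>i\<in>I. c i * lin i y)\<^sup>2 - (\<Sum>i\<in>I. c i * (lin i y)\<^sup>2)" for y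
    have quad: "(?W y)\<^sup>2 - ?W2 y \<le> r\<^sup>2 * Ql y + K5 * r ^ 3 * (E y)\<^sup>2" for y
    proof -
      define W where "W = ?W y"
      define L where "L = (\<Sum>i\<in>I. c i * (r * lin i y))"
      have rlin_le: "\<bar>r * lin i y\<bar> \<le> K4 * r * E y" if i: "i \<in> I" for i
      proof -
        have "\<bar>r * lin i y\<bar> \<le> K3 * r * E y"
          using mult_left_mono[OF lin_le[OF i, of y] r(1)] r by (simp add: abs_mult ac_simps)
        also have "\<dots> \<le> K4 * r * E y"
          unfolding K4_def using K2 r E1[of y] by (intro mult_right_mono) auto
        finally show ?thesis .
      qed
      have sum_le: "\<bar>\<Sum>i\<in>I. c i * x i\<bar> \<le> S * B" if "\<And>i. i \<in> I \<Longrightarrow> \<bar>x i\<bar> \<le> B" for x B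
      proof -
        have "\<bar>\<Sum>i\<in>I. c i * x i\<bar> \<le> (\<Sum>i\<in>I. c i * B)"
        proof (rule sum_abs[THEN order_trans], rule sum_mono)
          fix i assume i: "i \<in> I"
          show "\<bar>c i * x i\<bar> \<le> c i * B"
            using c_pos[OF i] that[OF i] by (simp add: abs_mult)
        qed
        then show ?thesis by (simp add: S_def sum_distrib_right)
      qed
      have W: "\<bar>W\<bar> \<le> S * (K4 * r * E y)" unfolding W_def by (rule sum_le) (rule w_le)
      have L: "\<bar>L\<bar> \<le> S * (K4 * r * E y)" unfolding L_def by (rule sum_le) (rule rlin_le)
      have WL: "\<bar>W - L\<bar> \<le> S * (K2 * r\<^sup>2 * E y)"
      proof -
        have "W - L = (\<Sum>i\<in>I. c i * (w i y - r * lin i y))"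
          unfolding W_def L_def by (simp add: right_diff_distrib sum_subtractf)
        then show ?thesis using sum_le[OF w_lin] by simp
      qed
      have EE: "0 \<le> E y" using E1[of y] by simp
      have "W\<^sup>2 - L\<^sup>2 = (W - L) * (W + L)" by (simp add: power2_eq_square algebra_simps)
      also have "\<dots> \<le> \<bar>W - L\<bar> * \<bar>W + L\<bar>" by (metis abs_ge_self abs_mult)
      also have "\<dots> \<le> (S * (K2 * r\<^sup>2 * E y)) * (2 * (S * (K4 * r * E y)))"
        using W L S K2 r EE by (intro mult_mono WL) auto
      also have "\<dots> = 2 * S\<^sup>2 * (K2 * K4) * r ^ 3 * (E y)\<^sup>2"
        by (simp add: power2_eq_square power3_eq_cube ac_simps)
      finally have 1: "W\<^sup>2 - L\<^sup>2 \<le> 2 * S\<^sup>2 * (K2 * K4) * r ^ 3 * (E y)\<^sup>2" .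
      have "\<bar>\<Sum>i\<in>I. c i * ((r * lin i y)\<^sup>2 - (w i y)\<^sup>2)\<bar> \<le> S * (2 * (K2 * K4) * r ^ 3 * (E y)\<^sup>2)"
      proof (rule sum_le)
        fix i assume i: "i \<in> I"
        have "\<bar>(r * lin i y)\<^sup>2 - (w i y)\<^sup>2\<bar> = \<bar>w i y - r * lin i y\<bar> * \<bar>w i y + r * lin i y\<bar>"
          by (subst abs_mult[symmetric], subst abs_minus_commute) (simp add: power2_eq_square algebra_simps)
        also have "\<dots> \<le> (K2 * r\<^sup>2 * E y) * (2 * (K4 * r * E y))"
          using w_le[OF i, of y] rlin_le[OF i] K2 EE by (intro mult_mono w_lin[OF i]) auto
        also have "\<dots> = 2 * (K2 * K4) * r ^ 3 * (E y)\<^sup>2"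
          by (simp add: power2_eq_square power3_eq_cube ac_simps)
        finally show "\<bar>(r * lin i y)\<^sup>2 - (w i y)\<^sup>2\<bar> \<le> 2 * (K2 * K4) * r ^ 3 * (E y)\<^sup>2" .
      qed
      then have "(\<Sum>i\<in>I. c i * (r * lin i y)\<^sup>2) - ?W2 y \<le> S * (2 * (K2 * K4) * r ^ 3 * (E y)\<^sup>2)"
        by (simp add: right_diff_distrib sum_subtractf)
      moreover have "r\<^sup>2 * Ql y = L\<^sup>2 - (\<Sum>i\<in>I. c i * (r * lin i y)\<^sup>2)"
        unfolding Ql_def L_def
        by (simp add: right_diff_distrib power_mult_distrib sum_distrib_left[symmetric] mult.left_commute[of _ r]
            mult.left_commute[of _ "r\<^sup>2"])
      moreover have "K5 * r ^ 3 * (E y)\<^sup>2 = 2 * S\<^sup>2 * (K2 * K4) * r ^ 3 * (E y)\<^sup>2 + S * (2 * (K2 * K4) * r ^ 3 * (E y)\<^sup>2)"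
        unfolding K5_def by (simp add: algebra_simps)
      ultimately show ?thesis using 1 unfolding W_def by linarith
    qed
    have iQl: "integrable (gauss N) Ql" and Ql_mean: "(\<integral>y. Ql y \<partial>gauss N) \<le> 0"
    proof -
      have e: "(\<Sum>i\<in>I. c i * lin i y) = (\<Sum>j<N. (\<Sum>i\<in>I. c i * u i j) * y j)" for y
        unfolding lin_def sum_distrib_left sum_distrib_right mult.assoc by (rule sum.swap)
      have i1: "integrable (gauss N) (\<lambda>y. (\<Sum>i\<in>I. c i * lin i y)\<^sup>2)"
        unfolding e power2_eq_square by (rule gauss_linear_product)
      have i2: "integrable (gauss N) (\<lambda>y. (lin i y)\<^sup>2)" for i
        unfolding lin_def power2_eq_square by (rule gauss_linear_product)
      have i3: "integrable (gauss N) (\<lambda>y. \<Sum>i\<in>I. c i * (lin i y)\<^sup>2)"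
        by (intro Bochner_Integration.integrable_sum integrable_mult_right i2)
      show "integrable (gauss N) Ql"
        unfolding Ql_def by (intro Bochner_Integration.integrable_diff i1 i3)
      have "(\<integral>y. Ql y \<partial>gauss N) = (\<integral>y. (\<Sum>i\<in>I. c i * lin i y)\<^sup>2 \<partial>gauss N) - (\<integral>y. (\<Sum>i\<in>I. c i * (lin i y)\<^sup>2) \<partial>gauss N)"
        unfolding Ql_def by (intro Bochner_Integration.integral_diff i1 i3)
      also have "(\<integral>y. (\<Sum>i\<in>I. c i * lin i y)\<^sup>2 \<partial>gauss N) = (\<Sum>j<N. (\<Sum>i\<in>I. c i * u i j)\<^sup>2)"
        unfolding e power2_eq_square by (rule gauss_linear_product)
      also have "(\<integral>y. (\<Sum>i\<in>I. c i * (lin i y)\<^sup>2) \<partial>gauss N) = (\<Sum>i\<in>I. c i * (\<integral>y. (lin i y)\<^sup>2 \<partial>gauss N))"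
        using i2 by (subst Bochner_Integration.integral_sum) (auto intro!: integrable_mult_right)
      also have "\<dots> = (\<Sum>i\<in>I. c i * (\<Sum>j<N. (u i j)\<^sup>2))"
        unfolding lin_def power2_eq_square gauss_linear_product ..
      finally show "(\<integral>y. Ql y \<partial>gauss N) \<le> 0"
        using gradient_inequality[of \<alpha>] unfolding u_def by linarith
    qed
    define R where "R y = 1 + ?W y + (r\<^sup>2 / 2 * Ql y + K5 / 2 * r ^ 3 * exp (2 * (1 + l1 N y)))
        + CR * K4 ^ 3 * r ^ 3 * exp (3 * (1 + l1 N y))" for y
    have prod_le: "?P y \<le> R y" for y
    proof -
      have "?P y \<le> 1 + ?W y
        + ((?W y)\<^sup>2 - ?W2 y) / 2 + CR * (K4 * r * E y) ^ 3"
      proof (rule CR(2))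
        show "0 \<le> K4 * r * E y" using K4 r E1[of y] by simp
        fix i assume i: "i \<in> I"
        have e: "1 + w i y = g i (?d i y) / p i" unfolding w_def by simp
        have "lo / hi \<le> g i (?d i y) / p i"
          using p[OF i] p0[OF i] lo by (intro frac_le g_lo[OF i] order_trans[OF less_imp_le[OF lo] g_lo[OF i]]) auto
        moreover have "g i (?d i y) / p i \<le> hi / lo"
          using p[OF i] lo hi by (intro frac_le g_hi[OF i]) auto
        ultimately show "\<kappa> \<le> 1 + w i y \<and> \<bar>w i y\<bar> \<le> M \<and> \<bar>w i y\<bar> \<le> K4 * r * E y"
          using w_le[OF i, of y] \<kappa> M unfolding e[symmetric] \<kappa>_def[symmetric] M_def[symmetric]
          by (auto simp: abs_le_iff)
      qed
      also have "\<dots> \<le> R y"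
        using quad[of y] unfolding R_def E2[symmetric] E3[symmetric] power_mult_distrib by (simp add: ac_simps)
      finally show ?thesis .
    qed
    have iR: "integrable (gauss N) R"
      unfolding R_def
      by (intro Bochner_Integration.integrable_add Bochner_Integration.integrable_sum integrable_mult_right
          iw iQl integrable_gauss_exp) simp_all
    have R_mean: "(\<integral>y. R y \<partial>gauss N) \<le> 1 + K * r ^ 3"
    proof -
      have isum: "integrable (gauss N) ?W"
        by (intro Bochner_Integration.integrable_sum integrable_mult_right iw)
      have "(\<integral>y. R y \<partial>gauss N) = 1 + (\<integral>y. ?W y \<partial>gauss N)
        + (r\<^sup>2 / 2 * (\<integral>y. Ql y \<partial>gauss N) + K5 / 2 * r ^ 3 * gauss_exp N 2) + CR * K4 ^ 3 * r ^ 3 * gauss_exp N 3"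
      proof -
        have linear: "(\<integral>y. 1 + X y + (\<beta>1 * X1 y + \<beta>2 * X2 y) + \<beta>3 * X3 y \<partial>gauss N)
            = 1 + (\<integral>y. X y \<partial>gauss N) + (\<beta>1 * (\<integral>y. X1 y \<partial>gauss N) + \<beta>2 * (\<integral>y. X2 y \<partial>gauss N))
              + \<beta>3 * (\<integral>y. X3 y \<partial>gauss N)"
          if "integrable (gauss N) X" "integrable (gauss N) X1" "integrable (gauss N) X2" "integrable (gauss N) X3"
          for X X1 X2 X3 :: "(nat \<Rightarrow> real) \<Rightarrow> real" and \<beta>1 \<beta>2 \<beta>3
          using that by (simp add: gauss.prob_space[simplified])
        show ?thesis
          unfolding R_def gauss_exp_def by (rule linear[OF isum iQl integrable_gauss_exp integrable_gauss_exp])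
      qed
      also have "(\<integral>y. ?W y \<partial>gauss N) = (\<Sum>i\<in>I. c i * (\<integral>y. w i y \<partial>gauss N))"
        using iw by (subst Bochner_Integration.integral_sum) auto
      also have "\<dots> \<le> (\<Sum>i\<in>I. c i * (K1 * r ^ 3))"
        using c_pos by (intro sum_mono mult_left_mono mean_w) (auto intro: less_imp_le)
      also have "\<dots> = S * K1 * r ^ 3" unfolding S_def by (simp add: sum_distrib_right mult.assoc)
      also have "r\<^sup>2 / 2 * (\<integral>y. Ql y \<partial>gauss N) \<le> 0"
        using Ql_mean by (simp add: mult_nonneg_nonpos)
      finally show ?thesis unfolding K_def by (simp add: algebra_simps)
    qed
    define Pp where "Pp = (\<Prod>i\<in>I. p i powr c i)"
    have "(\<Prod>i\<in>I. g i (?d i y) powr c i) = Pp * ?P y" for y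
    proof -
      have "g i (?d i y) powr c i = p i powr c i * (1 + w i y) powr c i" if i: "i \<in> I" for i
      proof -
        have "g i (?d i y) = p i * (1 + w i y)"
          unfolding w_def using p0[OF i] by simp
        moreover have "0 \<le> 1 + w i y"
          unfolding w_def using p0[OF i] order_trans[OF less_imp_le[OF lo] g_lo[OF i]] by simp
        ultimately show ?thesis using p0[OF i] by (simp add: powr_mult)
      qed
      then show ?thesis unfolding Pp_def prod.distrib[symmetric] by (intro prod.cong refl)
    qed
    then have "(\<integral>y. (\<Prod>i\<in>I. g i (?d i y) powr c i) \<partial>gauss N)
       = Pp * (\<integral>y. ?P y \<partial>gauss N)" by simp
    also have "\<dots> \<le> Pp * (1 + K * r ^ 3)"
    proof (intro mult_left_mono)
      show "0 \<le> Pp" unfolding Pp_def by (intro prod_nonneg) simp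
      have "(\<integral>y. ?P y \<partial>gauss N) \<le> (\<integral>y. R y \<partial>gauss N)"
      proof (intro integral_mono' iR prod_le)
        show "0 \<le> R y" for y
          using prod_le[of y] prod_nonneg[of I "\<lambda>i. (1 + w i y) powr c i"] by simp
      qed
      then show "(\<integral>y. ?P y \<partial>gauss N) \<le> 1 + K * r ^ 3"
        using R_mean by linarith
    qed
    finally show ?thesis unfolding Pp_def p_def by (simp add: mult.commute)
  qed
  then show ?thesis using K by blast
qed

end

section \<open>Iterating short steps\<close>

lemma taylor2_mono: "taylor2 d C g a q \<Longrightarrow> C \<le> C' \<Longrightarrow> taylor2 d C' g a q"
  unfolding taylor2_def
  by (blast intro: order_trans mult_right_mono[OF _ zero_le_power[OF l1_nonneg]])

lemma measurable_mv:
  "(\<lambda>x. \<lambda>k\<in>{..<e}. mv N \<beta> x k) \<in> measurable (euc_borel N) (euc_borel e)"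
  unfolding mv_def
  by (intro measurable_euc_restrict borel_measurable_sum borel_measurable_times borel_measurable_const
      measurable_euc_coordinate) simp

lemma measurable_heat_mv:
  assumes "F \<in> borel_measurable (euc_borel e)"
  shows "(\<lambda>x. heat e s F (mv N \<beta> x)) \<in> borel_measurable (euc_borel N)"
proof -
  have "(\<lambda>x. heat e s F (\<lambda>k\<in>{..<e}. mv N \<beta> x k)) \<in> borel_measurable (euc_borel N)"
    by (rule measurable_compose[OF measurable_mv measurable_heat[OF assms]])
  moreover have "heat e s F (mv N \<beta> x) = heat e s F (\<lambda>k\<in>{..<e}. mv N \<beta> x k)" for x
    by (rule heat_cong) simp
  ultimately show ?thesis by simp
qed

lemma heat_0: "heat d 0 F x = F (restrict x {..<d})"
  unfolding heat_def by (simp add: gauss.prob_space[simplified] restrict_def)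

lemma measurable_euc_to_borel: "(\<lambda>z. z) \<in> measurable (euc_borel d) (borel :: (nat \<Rightarrow> real) measure)"
proof (rule measurable_coordinatewise_then_product)
  fix k :: nat
  show "(\<lambda>x. x k) \<in> borel_measurable (euc_borel d)"
  proof (cases "k < d")
    case True then show ?thesis by (rule measurable_euc_coordinate)
  next
    case False
    then have "(\<lambda>x. x k) \<in> borel_measurable (euc_borel d) \<longleftrightarrow> (\<lambda>x. undefined :: real) \<in> borel_measurable (euc_borel d)"
      by (intro measurable_cong) (auto simp: euc_def PiE_def extensional_def)
    then show ?thesis by simp
  qed
qed

lemma continuous_imp_measurable_euc:
  fixes f :: "(nat \<Rightarrow> real) \<Rightarrow> real"
  assumes "continuous_on UNIV f"
  shows "f \<in> borel_measurable (euc_borel d)"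
  using measurable_compose[OF measurable_euc_to_borel borel_measurable_continuous_onI[OF assms]] .

text \<open>
  Dominated convergence, using that \<open>\<phi>\<close> is continuous for the product topology and that the shifted
  point depends continuously on the square root of the time.
\<close>

lemma heat_right_continuous:
  fixes \<phi> :: "(nat \<Rightarrow> real) \<Rightarrow> real"
  assumes c: "continuous_on UNIV \<phi>" and b: "\<And>x. \<bar>\<phi> x\<bar> \<le> M" and \<delta>: "\<delta> \<longlonglongrightarrow> 0"
  shows "(\<lambda>m. heat d (t + \<delta> m) \<phi> x) \<longlonglongrightarrow> heat d t \<phi> x"
  unfolding heat_def
proof (rule integral_dominated_convergence)
  have m: "\<phi> \<in> borel_measurable (euc_borel d)" by (rule continuous_imp_measurable_euc[OF c])
  show "(\<lambda>y. \<phi> (\<lambda>k\<in>{..<d}. x k + sqrt t * y k)) \<in> borel_measurable (gauss d)"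
    "(\<lambda>y. \<phi> (\<lambda>k\<in>{..<d}. x k + sqrt (t + \<delta> j) * y k)) \<in> borel_measurable (gauss d)" for j
    by (rule measurable_compose[OF measurable_move m])+
  show "integrable (gauss d) (\<lambda>_. M)" by simp
  show "AE y in gauss d. norm (\<phi> (\<lambda>k\<in>{..<d}. x k + sqrt (t + \<delta> j) * y k)) \<le> M" for j
    using b by simp
  show "AE y in gauss d. (\<lambda>j. \<phi> (\<lambda>k\<in>{..<d}. x k + sqrt (t + \<delta> j) * y k))
      \<longlonglongrightarrow> \<phi> (\<lambda>k\<in>{..<d}. x k + sqrt t * y k)"
  proof (rule AE_I2)
    fix y
    have "continuous_on UNIV (\<lambda>s. \<lambda>k\<in>{..<d}. x k + s * y k)"
    proof (rule continuous_on_coordinatewise_then_product)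
      fix k show "continuous_on UNIV (\<lambda>s. (\<lambda>k\<in>{..<d}. x k + s * y k) k)"
        by (cases "k < d") (auto intro!: continuous_intros)
    qed
    then have "continuous_on UNIV (\<lambda>s. \<phi> (\<lambda>k\<in>{..<d}. x k + s * y k))"
      by (rule continuous_on_compose2[OF c]) simp
    then have i: "isCont (\<lambda>s. \<phi> (\<lambda>k\<in>{..<d}. x k + s * y k)) (sqrt t)"
      by (simp add: continuous_on_eq_continuous_at)
    have "(\<lambda>j. sqrt (t + \<delta> j)) \<longlonglongrightarrow> sqrt (t + 0)"
      by (intro tendsto_intros \<delta>)
    then have "(\<lambda>j. sqrt (t + \<delta> j)) \<longlonglongrightarrow> sqrt t" by simp
    from isCont_tendsto_compose[OF i this]
    show "(\<lambda>j. \<phi> (\<lambda>k\<in>{..<d}. x k + sqrt (t + \<delta> j) * y k)) \<longlonglongrightarrow> \<phi> (\<lambda>k\<in>{..<d}. x k + sqrt t * y k)" .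
  qed
qed

context geometric_datum
begin

definition admissible :: "real \<Rightarrow> real \<Rightarrow> ('i \<Rightarrow> (nat \<Rightarrow> real) \<Rightarrow> real) \<Rightarrow> bool" where
  "admissible lo hi \<phi> \<longleftrightarrow> (\<forall>i\<in>I. \<phi> i \<in> borel_measurable (euc_borel (n i)) \<and>
     (\<forall>y\<in>euc (n i). lo \<le> \<phi> i y \<and> \<phi> i y \<le> hi))"

text \<open>
  The right-hand side of the inequality as a function of time and of the base point. At time \<open>0\<close> it
  is the product of the given functions themselves.
\<close>

definition flow :: "('i \<Rightarrow> (nat \<Rightarrow> real) \<Rightarrow> real) \<Rightarrow> real \<Rightarrow> (nat \<Rightarrow> real) \<Rightarrow> real" where
  "flow \<phi> s x = (\<Prod>i\<in>I. heat (n i) s (\<phi> i) (mv N (b i) x) powr c i)"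

lemma admissible_heat:
  assumes "admissible lo hi \<phi>" "i \<in> I"
  shows "lo \<le> heat (n i) s (\<phi> i) x" "heat (n i) s (\<phi> i) x \<le> hi"
  using assms by (auto simp: admissible_def intro: heat_bounds)

lemma measurable_flow:
  assumes "admissible lo hi \<phi>"
  shows "flow \<phi> s \<in> borel_measurable (euc_borel N)"
  unfolding flow_def using assms
  by (intro borel_measurable_prod powr_real_measurable borel_measurable_const measurable_heat_mv) (auto simp: admissible_def)

lemma flow_bounds:
  assumes "admissible lo hi \<phi>" "0 < lo"
  shows "0 \<le> flow \<phi> s x" "flow \<phi> s x \<le> (\<Prod>i\<in>I. hi powr c i)"
proof -
  show "0 \<le> flow \<phi> s x" unfolding flow_def by (intro prod_nonneg) simp
  show "flow \<phi> s x \<le> (\<Prod>i\<in>I. hi powr c i)"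
    unfolding flow_def
  proof (rule prod_mono)
    fix i assume i: "i \<in> I"
    show "0 \<le> heat (n i) s (\<phi> i) (mv N (b i) x) powr c i \<and>
        heat (n i) s (\<phi> i) (mv N (b i) x) powr c i \<le> hi powr c i"
      using admissible_heat[OF assms(1) i, of s "mv N (b i) x"] assms(2) c_pos[OF i]
      by (auto intro!: powr_mono2)
  qed
qed

lemma abs_flow_le: "admissible lo hi \<phi> \<Longrightarrow> 0 < lo \<Longrightarrow> \<bar>flow \<phi> s x\<bar> \<le> (\<Prod>i\<in>I. hi powr c i)"
  using flow_bounds[of lo hi \<phi> s x] by simp

text \<open>
  The constant depends on the functions only through their bounds and on the time only through the
  lower bound \<open>\<delta>\<close>. This uniformity makes the iteration possible.
\<close>

lemma heat_step:
  assumes \<delta>: "0 < \<delta>" and lo: "0 < lo" "lo \<le> hi"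
  shows "\<exists>K\<ge>0. \<forall>\<phi>. admissible lo hi \<phi> \<longrightarrow> (\<forall>s\<ge>\<delta>. \<forall>r. 0 \<le> r \<longrightarrow> r \<le> 1 \<longrightarrow>
     (\<forall>x. heat N (r\<^sup>2) (flow \<phi> s) x \<le> (1 + K * r ^ 3) * flow \<phi> (s + r\<^sup>2) x))"
proof -
  have hi: "0 \<le> hi" using lo by simp
  define smooth where "smooth i C \<longleftrightarrow> (\<forall>F\<in>borel_measurable (euc_borel (n i)). (\<forall>y\<in>euc (n i). \<bar>F y\<bar> \<le> hi) \<longrightarrow>
    (\<forall>s\<ge>\<delta>. \<forall>x. \<exists>a q. taylor2 (n i) C (\<lambda>h. heat (n i) s F (\<lambda>k. x k + h k)) a q))" for i C
  have "\<forall>i. \<exists>C. 0 \<le> C \<and> smooth i C"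
    using heat_taylor[OF \<delta> hi] unfolding smooth_def by blast
  from choice[OF this] obtain Ci where Ci: "\<And>i. 0 \<le> Ci i" "\<And>i. smooth i (Ci i)" by blast
  define C where "C = (\<Sum>i\<in>I. Ci i)"
  have C: "0 \<le> C" unfolding C_def using Ci by (intro sum_nonneg)
  have CiC: "Ci i \<le> C" if "i \<in> I" for i
    unfolding C_def using that fin Ci by (intro member_le_sum) auto
  obtain K where K: "0 \<le> K" "\<forall>r g a q. 0 \<le> r \<longrightarrow> r \<le> 1 \<longrightarrow>
    expandable C lo hi r g a q \<longrightarrow>
    (\<integral>y. (\<Prod>i\<in>I. g i (\<lambda>k. r * mv N (b i) y k) powr c i) \<partial>gauss N)
      \<le> (1 + K * r ^ 3) * (\<Prod>i\<in>I. (\<integral>z. g i (\<lambda>k. r * z k) \<partial>gauss (n i)) powr c i)"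
    using local_step[OF C lo] by blast
  have "heat N (r\<^sup>2) (flow \<phi> s) x \<le> (1 + K * r ^ 3) * flow \<phi> (s + r\<^sup>2) x"
    if ad: "admissible lo hi \<phi>" and s: "\<delta> \<le> s" and r: "0 \<le> r" "r \<le> 1" for \<phi> s r x
  proof -
    define g where "g i h = heat (n i) s (\<phi> i) (\<lambda>k. mv N (b i) x k + h k)" for i h
    have m\<phi>: "\<phi> i \<in> borel_measurable (euc_borel (n i))" and b\<phi>: "\<And>y. y \<in> euc (n i) \<Longrightarrow> \<bar>\<phi> i y\<bar> \<le> hi"
      if "i \<in> I" for i
      using ad that lo by (force simp: admissible_def)+
    have "\<exists>aq. taylor2 (n i) C (g i) (fst aq) (snd aq)" if i: "i \<in> I" for i
    proof -
      obtain a q where "taylor2 (n i) (Ci i) (g i) a q"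
        using Ci(2)[of i, unfolded smooth_def, rule_format, OF m\<phi>[OF i] b\<phi>[OF i] s, of "mv N (b i) x"]
        unfolding g_def by blast
      from taylor2_mono[OF this CiC[OF i]] show ?thesis by (intro exI[of _ "(a, q)"]) simp
    qed
    then have "\<forall>i\<in>I. \<exists>aq. taylor2 (n i) C (g i) (fst aq) (snd aq)" by blast
    from bchoice[OF this] obtain aq where
      aq: "\<And>i. i \<in> I \<Longrightarrow> taylor2 (n i) C (g i) (fst (aq i)) (snd (aq i))" by blast
    define a where "a i = fst (aq i)" for i
    define q where "q i = snd (aq i)" for i
    have T: "taylor2 (n i) C (g i) (a i) (q i)" if "i \<in> I" for i
      unfolding a_def q_def by (rule aq[OF that])
    have m1: "(\<lambda>y. g i (\<lambda>k. r * mv N (b i) y k)) \<in> borel_measurable (gauss N)" if i: "i \<in> I" for i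
    proof -
      have "(\<lambda>y. \<lambda>k\<in>{..<n i}. mv N (b i) x k + r * mv N (b i) y k) \<in> measurable (euc_borel N) (euc_borel (n i))"
        unfolding mv_def
        by (intro measurable_euc_restrict borel_measurable_add borel_measurable_sum borel_measurable_times
            borel_measurable_const measurable_euc_coordinate) simp
      from measurable_compose[OF this measurable_heat[OF m\<phi>[OF i], of s]]
      have "(\<lambda>y. heat (n i) s (\<phi> i) (\<lambda>k\<in>{..<n i}. mv N (b i) x k + r * mv N (b i) y k)) \<in> borel_measurable (gauss N)"
        by simp
      moreover have "g i (\<lambda>k. r * mv N (b i) y k)
        = heat (n i) s (\<phi> i) (\<lambda>k\<in>{..<n i}. mv N (b i) x k + r * mv N (b i) y k)" for y
        unfolding g_def by (rule heat_cong) simp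
      ultimately show ?thesis by simp
    qed
    have gz: "g i (\<lambda>k. r * z k) = heat (n i) s (\<phi> i) (\<lambda>k\<in>{..<n i}. mv N (b i) x k + r * z k)" for i z
      unfolding g_def by (rule heat_cong) simp
    have m2: "(\<lambda>z. g i (\<lambda>k. r * z k)) \<in> borel_measurable (gauss (n i))" if i: "i \<in> I" for i
      unfolding gz by (rule measurable_compose[OF measurable_move measurable_heat[OF m\<phi>[OF i]]])
    have gl: "lo \<le> g i h" "g i h \<le> hi" if "i \<in> I" for i h
      unfolding g_def using admissible_heat[OF ad that] by auto
    have "heat N (r\<^sup>2) (flow \<phi> s) x = (\<integral>y. (\<Prod>i\<in>I. g i (\<lambda>k. r * mv N (b i) y k) powr c i) \<partial>gauss N)"
    proof -
      have "mv N (b i) (\<lambda>k\<in>{..<N}. x k + r * y k) = (\<lambda>k. mv N (b i) x k + r * mv N (b i) y k)" for i y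
        unfolding mv_add[symmetric] by (rule ext) (simp add: mv_def)
      then show ?thesis unfolding heat_def[of N] flow_def g_def using r by simp
    qed
    also have "\<dots> \<le> (1 + K * r ^ 3) * (\<Prod>i\<in>I. (\<integral>z. g i (\<lambda>k. r * z k) \<partial>gauss (n i)) powr c i)"
      using K(2)[rule_format, OF r, of g a q] T m1 m2 gl unfolding expandable_def by blast
    also have "(\<Prod>i\<in>I. (\<integral>z. g i (\<lambda>k. r * z k) \<partial>gauss (n i)) powr c i) = flow \<phi> (s + r\<^sup>2) x"
      unfolding flow_def
    proof (rule prod.cong[OF refl])
      fix i assume i: "i \<in> I"
      have "(\<integral>z. g i (\<lambda>k. r * z k) \<partial>gauss (n i)) = heat (n i) (r\<^sup>2) (heat (n i) s (\<phi> i)) (mv N (b i) x)"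
        unfolding gz heat_def[of "n i" "r\<^sup>2"] using r by simp
      also have "\<dots> = heat (n i) (s + r\<^sup>2) (\<phi> i) (mv N (b i) x)"
        using heat_add_time[OF m\<phi>[OF i] b\<phi>[OF i], of "r\<^sup>2" s "mv N (b i) x"] s \<delta> by (simp add: add.commute)
      finally show "(\<integral>z. g i (\<lambda>k. r * z k) \<partial>gauss (n i)) powr c i
          = heat (n i) (s + r\<^sup>2) (\<phi> i) (mv N (b i) x) powr c i" by simp
    qed
    finally show ?thesis .
  qed
  then show ?thesis using K(1) by blast
qed

text \<open>
  With \<open>m\<close> steps of length \<open>t / m\<close> the total loss is
  \<open>(1 + K (t / m) powr (3/2)) ^ m \<le> exp (K t sqrt (t / m))\<close>, which tends to \<open>1\<close>.
\<close>

lemma heat_flow: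
  assumes ad: "admissible lo hi \<phi>" and lo: "0 < lo" "lo \<le> hi" and \<delta>: "0 < \<delta>" and t: "0 \<le> t"
  shows "heat N t (flow \<phi> \<delta>) x \<le> flow \<phi> (\<delta> + t) x"
proof -
  obtain K where K: "0 \<le> K" "\<And>\<phi> s r x. admissible lo hi \<phi> \<Longrightarrow> \<delta> \<le> s \<Longrightarrow> 0 \<le> r \<Longrightarrow> r \<le> 1 \<Longrightarrow>
     heat N (r\<^sup>2) (flow \<phi> s) x \<le> (1 + K * r ^ 3) * flow \<phi> (s + r\<^sup>2) x"
    using heat_step[OF \<delta> lo] by blast
  have iter: "heat N (real j * r\<^sup>2) (flow \<phi> s) x \<le> (1 + K * r ^ 3) ^ j * flow \<phi> (s + real j * r\<^sup>2) x"
    if r: "0 \<le> r" "r \<le> 1" and s: "\<delta> \<le> s" for r s x j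
    using s
  proof (induction j arbitrary: s x)
    case 0
    have "mv N (b i) (restrict x {..<N}) = mv N (b i) x" for i by (rule ext) (simp add: mv_def)
    then show ?case by (simp add: heat_0 flow_def)
  next
    case (Suc j)
    have K1: "0 \<le> 1 + K * r ^ 3" using K(1) r by simp
    have s': "\<delta> \<le> s + r\<^sup>2" using Suc.prems by (simp add: add_increasing2)
    have e: "real (Suc j) * r\<^sup>2 = real j * r\<^sup>2 + r\<^sup>2" by (simp add: algebra_simps)
    have "heat N (real (Suc j) * r\<^sup>2) (flow \<phi> s) x = heat N (real j * r\<^sup>2) (heat N (r\<^sup>2) (flow \<phi> s)) x"
      unfolding e by (rule heat_add_time[OF measurable_flow[OF ad] abs_flow_le[OF ad lo(1)], symmetric]) simp_all
    also have "\<dots> \<le> heat N (real j * r\<^sup>2) (\<lambda>y. (1 + K * r ^ 3) * flow \<phi> (s + r\<^sup>2) y) x"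
    proof (rule heat_mono)
      show "heat N (r\<^sup>2) (flow \<phi> s) \<in> borel_measurable (euc_borel N)"
        by (intro measurable_heat measurable_flow[OF ad])
      show "(\<lambda>y. (1 + K * r ^ 3) * flow \<phi> (s + r\<^sup>2) y) \<in> borel_measurable (euc_borel N)"
        by (intro borel_measurable_times borel_measurable_const measurable_flow[OF ad])
      show "\<bar>heat N (r\<^sup>2) (flow \<phi> s) y\<bar> \<le> (\<Prod>i\<in>I. hi powr c i)" for y
        using heat_bounds[OF measurable_flow[OF ad] flow_bounds(1)[OF ad lo(1)] flow_bounds(2)[OF ad lo(1)], of "r\<^sup>2" s y]
        by simp
      show "\<bar>(1 + K * r ^ 3) * flow \<phi> (s + r\<^sup>2) y\<bar> \<le> (1 + K * r ^ 3) * (\<Prod>i\<in>I. hi powr c i)" for y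
        using K1 abs_flow_le[OF ad lo(1)] by (simp add: abs_mult mult_left_mono)
      show "heat N (r\<^sup>2) (flow \<phi> s) y \<le> (1 + K * r ^ 3) * flow \<phi> (s + r\<^sup>2) y" for y
        using K(2)[OF ad Suc.prems r] .
    qed
    also have "\<dots> = (1 + K * r ^ 3) * heat N (real j * r\<^sup>2) (flow \<phi> (s + r\<^sup>2)) x"
      by (rule heat_mult)
    also have "\<dots> \<le> (1 + K * r ^ 3) * ((1 + K * r ^ 3) ^ j * flow \<phi> (s + r\<^sup>2 + real j * r\<^sup>2) x)"
      by (intro mult_left_mono Suc.IH s' K1)
    finally show ?case unfolding e by (simp add: ac_simps)
  qed
  define G where "G = flow \<phi> (\<delta> + t) x"
  have G: "0 \<le> G" unfolding G_def by (rule flow_bounds[OF ad lo(1)])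
  have "heat N t (flow \<phi> \<delta>) x \<le> exp (K * t * sqrt (t / real m)) * G" if m: "0 < m" "t \<le> real m" for m
  proof -
    define r where "r = sqrt (t / real m)"
    have r: "0 \<le> r" "r \<le> 1" unfolding r_def using t m by auto
    have mr: "real m * r\<^sup>2 = t" unfolding r_def using t m by simp
    have "heat N t (flow \<phi> \<delta>) x \<le> (1 + K * r ^ 3) ^ m * G"
      using iter[OF r order_refl, of m x] unfolding mr G_def .
    also have "(1 + K * r ^ 3) ^ m \<le> exp (K * r ^ 3) ^ m"
      using K(1) r by (intro power_mono) auto
    also have "exp (K * r ^ 3) ^ m = exp (K * (real m * r\<^sup>2) * r)"
      unfolding exp_of_nat_mult[symmetric] by (simp add: power2_eq_square power3_eq_cube ac_simps)
    finally show ?thesis using G unfolding mr by (simp add: mult_right_mono r_def)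
  qed
  note bound = this
  have ev: "\<forall>\<^sub>F m in sequentially. heat N t (flow \<phi> \<delta>) x \<le> exp (K * t * sqrt (t / real m)) * G"
    using eventually_ge_at_top[of "Suc (nat \<lceil>t\<rceil>)"]
  proof eventually_elim
    case (elim m)
    have "t \<le> real (nat \<lceil>t\<rceil>)" by (rule real_nat_ceiling_ge)
    also have "\<dots> \<le> real m" by (rule of_nat_mono[OF Suc_leD[OF elim]])
    finally have tm: "t \<le> real m" .
    have "0 < m" using elim by simp
    from bound[OF this tm] show ?case .
  qed
  have "(\<lambda>m. t / real m) \<longlonglongrightarrow> 0"
    by (rule lim_const_over_n)
  then have "(\<lambda>m. exp (K * t * sqrt (t / real m)) * G) \<longlonglongrightarrow> exp (K * t * sqrt 0) * G"
    by (intro tendsto_intros)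
  then have "(\<lambda>m. exp (K * t * sqrt (t / real m)) * G) \<longlonglongrightarrow> G" by simp
  from tendsto_lowerbound[OF this ev] show ?thesis unfolding G_def by simp
qed

text \<open>
  For continuous functions the smoothing time \<open>\<delta>\<close> tends to \<open>0\<close> on both sides.
\<close>

lemma heat_inequality_continuous:
  assumes c\<phi>: "\<And>i. i \<in> I \<Longrightarrow> continuous_on UNIV (\<phi> i)"
    and b\<phi>: "\<And>i y. i \<in> I \<Longrightarrow> lo \<le> \<phi> i y" "\<And>i y. i \<in> I \<Longrightarrow> \<phi> i y \<le> hi" and lo: "0 < lo" "lo \<le> hi"
    and t: "0 \<le> t"
  shows "heat N t (flow \<phi> 0) x \<le> flow \<phi> t x"
proof -
  let ?X = "\<lambda>y. \<lambda>k\<in>{..<N}. x k + sqrt t * y k"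
  have ad: "admissible lo hi \<phi>"
    unfolding admissible_def using c\<phi> b\<phi> by (auto intro: continuous_imp_measurable_euc)
  have ab: "\<bar>\<phi> i y\<bar> \<le> hi" if "i \<in> I" for i y using b\<phi>[OF that, of y] lo by simp
  define \<delta> where "\<delta> m = 1 / real (Suc m)" for m
  have \<delta>0: "\<delta> \<longlonglongrightarrow> 0" unfolding \<delta>_def using LIMSEQ_inverse_real_of_nat by (simp add: inverse_eq_divide)
  have lim: "(\<lambda>m. flow \<phi> (s + \<delta> m) z) \<longlonglongrightarrow> flow \<phi> s z" for s z
    unfolding flow_def
  proof (rule tendsto_prod)
    fix i assume i: "i \<in> I"
    have "heat (n i) s (\<phi> i) (mv N (b i) z) \<noteq> 0"
      using admissible_heat(1)[OF ad i, of s "mv N (b i) z"] lo by auto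
    then show "(\<lambda>m. heat (n i) (s + \<delta> m) (\<phi> i) (mv N (b i) z) powr c i)
        \<longlonglongrightarrow> heat (n i) s (\<phi> i) (mv N (b i) z) powr c i"
      by (intro tendsto_powr heat_right_continuous[OF c\<phi>[OF i] ab[OF i] \<delta>0] tendsto_const)
  qed
  have "(\<lambda>m. heat N t (flow \<phi> (\<delta> m)) x) \<longlonglongrightarrow> heat N t (flow \<phi> 0) x"
    unfolding heat_def[of N]
  proof (rule integral_dominated_convergence)
    show "(\<lambda>y. flow \<phi> 0 (?X y)) \<in> borel_measurable (gauss N)"
      "(\<lambda>y. flow \<phi> (\<delta> m) (?X y)) \<in> borel_measurable (gauss N)" for m
      by (rule measurable_compose[OF measurable_move measurable_flow[OF ad]])+
    show "integrable (gauss N) (\<lambda>_. \<Prod>i\<in>I. hi powr c i)" by simp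
    show "AE y in gauss N. norm (flow \<phi> (\<delta> m) (?X y)) \<le> (\<Prod>i\<in>I. hi powr c i)" for m
      using abs_flow_le[OF ad lo(1)] by simp
    show "AE y in gauss N. (\<lambda>m. flow \<phi> (\<delta> m) (?X y))
      \<longlonglongrightarrow> flow \<phi> 0 (?X y)"
      using lim[of 0] by simp
  qed
  moreover have "(\<lambda>m. flow \<phi> (\<delta> m + t) x) \<longlonglongrightarrow> flow \<phi> t x"
    using lim[of t x] by (simp add: add.commute)
  moreover have "heat N t (flow \<phi> (\<delta> m)) x \<le> flow \<phi> (\<delta> m + t) x" for m
    by (rule heat_flow[OF ad lo _ t]) (simp add: \<delta>_def)
  ultimately show ?thesis by (intro LIMSEQ_le) auto
qed

end

section \<open>From continuous to bounded measurable functions\<close>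

lemma open_indicator_limit:
  fixes U :: "'a::metric_space set"
  assumes "open U"
  shows "\<exists>u. (\<forall>k. continuous_on UNIV (u k)) \<and> (\<forall>k x. 0 \<le> u k x \<and> u k x \<le> (indicator U x :: real)) \<and>
    (\<forall>x. (\<lambda>k::nat. u k x) \<longlonglongrightarrow> indicator U x)"
proof (cases "U = UNIV")
  case True
  then show ?thesis by (intro exI[of _ "\<lambda>_ _. 1"]) auto
next
  case False
  then have ne: "- U \<noteq> {}" by auto
  have cl: "closed (- U)" using assms by (simp add: closed_def)
  define u where "u k x = min 1 (real k * infdist x (- U))" for k x
  have "continuous_on UNIV (u k)" for k
    unfolding u_def by (intro continuous_intros)
  moreover have "0 \<le> u k x \<and> u k x \<le> indicator U x" for k x
    unfolding u_def by (cases "x \<in> U") (auto simp: infdist_nonneg)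
  moreover have "(\<lambda>k. u k x) \<longlonglongrightarrow> indicator U x" for x
  proof (cases "x \<in> U")
    case True
    then have pos: "0 < infdist x (- U)"
      using in_closed_iff_infdist_zero[OF cl ne, of x] infdist_nonneg[of x "- U"] by auto
    obtain m :: nat where m: "1 / infdist x (- U) < real m" using reals_Archimedean2 by blast
    have "u k x = 1" if "m \<le> k" for k
    proof -
      have "1 / infdist x (- U) \<le> real k" using m that by (meson less_imp_le of_nat_mono order_trans)
      then have "1 \<le> real k * infdist x (- U)" using pos by (simp add: divide_le_eq)
      then show ?thesis by (simp add: u_def)
    qed
    then have "\<forall>\<^sub>F k in sequentially. u k x = 1" by (auto simp: eventually_sequentially)
    then show ?thesis using True by (simp add: tendsto_eventually)
  next
    case False
    then show ?thesis by (simp add: u_def)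
  qed
  ultimately show ?thesis by blast
qed

text \<open>
  The sum equals \<open>\<eta> \<lceil>v / \<eta>\<rceil>\<close>: it is a Riemann sum for the layer-cake representation of \<open>v\<close>.
\<close>

lemma layer_sum_bounds:
  fixes v \<eta> :: real
  assumes \<eta>: "0 < \<eta>" and v: "0 \<le> v" "v \<le> real J * \<eta>"
  shows "v \<le> (\<Sum>j<J. \<eta> * of_bool (real j * \<eta> < v))" "(\<Sum>j<J. \<eta> * of_bool (real j * \<eta> < v)) \<le> v + \<eta>"
proof -
  let ?S = "\<Sum>j<J. \<eta> * of_bool (real j * \<eta> < v)"
  define s where "s = nat \<lceil>v / \<eta>\<rceil>"
  have "v / \<eta> \<le> real J" using v \<eta> by (simp add: divide_le_eq)
  then have sJ: "s \<le> J" unfolding s_def by (simp add: nat_le_iff ceiling_le_iff)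
  have iff: "real j * \<eta> < v \<longleftrightarrow> j < s" for j
  proof -
    have "real j * \<eta> < v \<longleftrightarrow> real j < v / \<eta>" using \<eta> by (simp add: less_divide_eq)
    also have "\<dots> \<longleftrightarrow> int j < \<lceil>v / \<eta>\<rceil>" by (simp add: less_ceiling_iff)
    also have "\<dots> \<longleftrightarrow> j < s" unfolding s_def by linarith
    finally show ?thesis .
  qed
  have "?S = (\<Sum>j\<in>{..<J} \<inter> {j. j < s}. \<eta>)"
    unfolding iff by (simp add: of_bool_def if_distrib[of "\<lambda>x. \<eta> * x"] sum.If_cases cong: if_cong)
  also have "{..<J} \<inter> {j. j < s} = {..<s}" using sJ by auto
  also have "(\<Sum>j\<in>{..<s}. \<eta>) = real s * \<eta>" by simp
  finally have e: "?S = real s * \<eta>" .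
  have s: "real s = of_int \<lceil>v / \<eta>\<rceil>"
    unfolding s_def using v \<eta> by simp
  have "v / \<eta> \<le> real s" "real s \<le> v / \<eta> + 1"
    unfolding s by (simp_all add: of_int_ceiling_le_add_one)
  then show "v \<le> ?S" "?S \<le> v + \<eta>"
    unfolding e using \<eta> by (simp_all add: field_simps)
qed

text \<open>
  A bounded form of the Vitali-Caratheodory theorem. The level sets of \<open>f\<close> are enlarged to open sets by
  outer regularity, and indicators of open sets are limits of smaller continuous functions. The limit
  \<open>L\<close> dominates \<open>f\<close> at every point, not merely almost everywhere. This matters because \<open>L\<close> is built
  from the law of one Gaussian vector and is later evaluated along another, \<open>B\<^sub>i y\<close>.
\<close>

lemma continuous_majorant:
  fixes M :: "'a::polish_space measure" and f :: "'a \<Rightarrow> real"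
  assumes M: "prob_space M" and sM: "sets M = sets borel" and f [measurable]: "f \<in> borel_measurable borel"
    and fb: "\<And>x. 0 \<le> f x" "\<And>x. f x \<le> R" and \<epsilon>: "0 < \<epsilon>"
  shows "\<exists>g L B. (\<forall>k. continuous_on UNIV (g k)) \<and> (\<forall>k x. 0 \<le> g k x \<and> g k x \<le> B) \<and>
    (\<forall>x. (\<lambda>k::nat. g k x) \<longlonglongrightarrow> L x) \<and> (\<forall>x. f x \<le> L x) \<and> (\<forall>k. (\<integral>x. g k x \<partial>M) \<le> (\<integral>x. f x \<partial>M) + \<epsilon>)"
proof -
  let ?S = "\<lambda>\<eta> J x. \<Sum>j<(J::nat). \<eta> * of_bool (real j * \<eta> < f x)"
  interpret prob_space M by fact
  note [measurable_cong] = sM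
  have spM: "space M = UNIV" using sets_eq_imp_space_eq[OF sM] by simp
  define \<eta> where "\<eta> = \<epsilon> / 2"
  have \<eta>: "0 < \<eta>" using \<epsilon> by (simp add: \<eta>_def)
  obtain J :: nat where J0: "R / \<eta> < real J" using reals_Archimedean2 by blast
  have J: "R \<le> real J * \<eta>" using J0 \<eta> by (simp add: divide_less_eq)
  define \<epsilon>' where "\<epsilon>' = 1 / (real J + 1)"
  have \<epsilon>': "0 < \<epsilon>'" "real J * \<epsilon>' \<le> 1" by (auto simp: \<epsilon>'_def divide_le_eq)
  define A where "A j = {x. real j * \<eta> < f x}" for j
  have A [measurable]: "A j \<in> sets borel" for j unfolding A_def by measurable
  have "\<exists>U. open U \<and> A j \<subseteq> U \<and> measure M U \<le> measure M (A j) + \<epsilon>'" for j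
  proof -
    have "emeasure M (A j) = (INF U \<in> {U. A j \<subseteq> U \<and> open U}. emeasure M U)"
      by (rule outer_regular[OF sM _ A]) simp
    moreover have "emeasure M (A j) < emeasure M (A j) + ennreal \<epsilon>'"
      using \<epsilon>' by (simp add: emeasure_eq_measure ennreal_plus[symmetric] ennreal_less_iff del: ennreal_plus)
    ultimately obtain U where U: "A j \<subseteq> U" "open U" "emeasure M U < emeasure M (A j) + ennreal \<epsilon>'"
      unfolding INF_less_iff by (metis (mono_tags, lifting) INF_less_iff mem_Collect_eq)
    then have "measure M U \<le> measure M (A j) + \<epsilon>'"
      using \<epsilon>' by (simp add: emeasure_eq_measure ennreal_plus[symmetric] ennreal_less_iff del: ennreal_plus)
    then show ?thesis using U by blast
  qed
  then have "\<forall>j. \<exists>U. open U \<and> A j \<subseteq> U \<and> measure M U \<le> measure M (A j) + \<epsilon>'" by blast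
  from choice[OF this] obtain U where U: "\<And>j. open (U j)" "\<And>j. A j \<subseteq> U j"
    "\<And>j. measure M (U j) \<le> measure M (A j) + \<epsilon>'" by blast
  have "\<forall>j. \<exists>u. (\<forall>k. continuous_on UNIV (u k)) \<and> (\<forall>k x. 0 \<le> u k x \<and> u k x \<le> (indicator (U j) x :: real)) \<and>
    (\<forall>x. (\<lambda>k::nat. u k x) \<longlonglongrightarrow> indicator (U j) x)"
    using open_indicator_limit[OF U(1)] by blast
  from choice[OF this] obtain u where u: "\<And>j k. continuous_on UNIV (u j k)"
    "\<And>j k x. 0 \<le> u j k x" "\<And>j k x. u j k x \<le> (indicator (U j) x :: real)"
    "\<And>j x. (\<lambda>k::nat. u j k x) \<longlonglongrightarrow> indicator (U j) x" by blast
  define g where "g k x = (\<Sum>j<J. \<eta> * u j k x)" for k x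
  define L where "L x = (\<Sum>j<J. \<eta> * indicator (U j) x)" for x
  have gL: "g k x \<le> L x" for k x
    unfolding g_def L_def using \<eta> u(3) by (intro sum_mono mult_left_mono) auto
  have "continuous_on UNIV (g k)" for k
    unfolding g_def using u(1) by (intro continuous_intros) auto
  moreover have "0 \<le> g k x" for k x
    unfolding g_def using \<eta> u(2) by (intro sum_nonneg mult_nonneg_nonneg) auto
  moreover have "g k x \<le> real J * \<eta>" for k x
  proof -
    have "L x \<le> (\<Sum>j<J. \<eta> * 1)"
      unfolding L_def using \<eta> by (intro sum_mono mult_left_mono) (auto simp: indicator_def)
    then show ?thesis using gL[of k x] by simp
  qed
  moreover have "(\<lambda>k. g k x) \<longlonglongrightarrow> L x" for x
    unfolding g_def L_def by (intro tendsto_intros u(4))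
  moreover have "f x \<le> L x" for x
  proof -
    have "f x \<le> ?S \<eta> J x"
      using layer_sum_bounds(1)[OF \<eta> fb(1)[of x], of J] J fb(2)[of x] by linarith
    also have "\<dots> \<le> L x"
      unfolding L_def using U(2) \<eta> by (intro sum_mono mult_left_mono) (auto simp: A_def indicator_def subset_eq)
    finally show ?thesis .
  qed
  moreover have "(\<integral>x. g k x \<partial>M) \<le> (\<integral>x. f x \<partial>M) + \<epsilon>" for k
  proof -
    have Um [measurable]: "U j \<in> sets M" for j using U(1) sM by simp
    have Am: "A j \<in> sets M" for j using A sM by simp
    have iU: "integrable M (\<lambda>x. indicator (U j) x :: real)" for j
      by (intro integrable_const_bound[where B=1] AE_I2) (auto simp: indicator_def)
    have iA: "integrable M (\<lambda>x. of_bool (real j * \<eta> < f x) :: real)" for j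
      by (intro integrable_const_bound[where B=1] AE_I2) (auto simp: of_bool_def)
    have if': "integrable M f"
      using fb by (intro integrable_const_bound[where B=R] AE_I2) auto
    have iL: "integrable M L" unfolding L_def
      by (intro Bochner_Integration.integrable_sum integrable_mult_right iU)
    have "(\<integral>x. g k x \<partial>M) \<le> (\<integral>x. L x \<partial>M)"
    proof (rule integral_mono'[OF iL gL])
      show "0 \<le> L x" for x unfolding L_def using \<eta> by (intro sum_nonneg) auto
    qed
    also have "\<dots> = (\<Sum>j<J. \<eta> * measure M (U j))"
      unfolding L_def using iU by (subst Bochner_Integration.integral_sum) (auto simp: spM)
    also have "\<dots> \<le> (\<Sum>j<J. \<eta> * measure M (A j) + \<eta> * \<epsilon>')"
      unfolding distrib_left[symmetric] using \<eta> U(3) by (intro sum_mono mult_left_mono) auto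
    also have "\<dots> = (\<Sum>j<J. \<eta> * measure M (A j)) + \<eta> * (real J * \<epsilon>')"
      by (simp add: sum.distrib)
    also have "(\<Sum>j<J. \<eta> * measure M (A j)) = (\<integral>x. ?S \<eta> J x \<partial>M)"
    proof -
      have "(\<integral>x. of_bool (real j * \<eta> < f x) \<partial>M) = measure M (A j)" for j
      proof -
        have "(\<lambda>x. of_bool (real j * \<eta> < f x) :: real) = indicator (A j)"
          by (auto simp: A_def indicator_def)
        then show ?thesis using Am[of j] by (simp add: spM)
      qed
      then show ?thesis using iA by (subst Bochner_Integration.integral_sum) auto
    qed
    also have "\<dots> \<le> (\<integral>x. f x + \<eta> \<partial>M)"
    proof (intro integral_mono)
      show "integrable M (\<lambda>x. \<Sum>j<J. \<eta> * of_bool (real j * \<eta> < f x))"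
        by (intro Bochner_Integration.integrable_sum integrable_mult_right iA)
      show "integrable M (\<lambda>x. f x + \<eta>)" using if' by simp
      show "?S \<eta> J x \<le> f x + \<eta>" for x
        using layer_sum_bounds(2)[OF \<eta> fb(1)[of x], of J] J fb(2)[of x] by linarith
    qed
    also have "\<dots> = (\<integral>x. f x \<partial>M) + \<eta>" using if' by (simp add: prob_space)
    also have "\<eta> * (real J * \<epsilon>') \<le> \<eta>" using \<eta> \<epsilon>' by (simp add: mult_left_le)
    finally show ?thesis by (simp add: \<eta>_def)
  qed
  ultimately show ?thesis by blast
qed

lemma measurable_borel_to_euc: "(\<lambda>z. restrict z {..<d}) \<in> measurable (borel :: (nat \<Rightarrow> real) measure) (euc_borel d)"
proof -
  have "(\<lambda>z. \<lambda>k\<in>{..<d}. z k) \<in> measurable (borel :: (nat \<Rightarrow> real) measure) (euc_borel d)"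
    by (intro measurable_euc_restrict measurable_product_coordinates)
  then show ?thesis by (simp add: restrict_def)
qed

context geometric_datum
begin

lemma flow_0: "flow \<phi> 0 x = (\<Prod>i\<in>I. \<phi> i (restrict (mv N (b i) x) {..<n i}) powr c i)"
  unfolding flow_def heat_0 ..

text \<open>
  The continuous majorants, raised by \<open>\<epsilon>\<close> to be bounded below, satisfy the inequality. Their limits
  dominate the left-hand side, and their integrals exceed those of \<open>f\<close> by at most \<open>2 \<epsilon>\<close>.
\<close>

lemma heat_inequality_bounded:
  assumes ad: "admissible 0 R f" and t: "0 \<le> t"
  shows "heat N t (flow f 0) x \<le> flow f t x"
proof -
  let ?b = "\<lambda>i z. restrict (mv N (b i) z) {..<n i}"
  let ?H = "\<lambda>i. heat (n i) t (f i) (mv N (b i) x)"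
  let ?X = "\<lambda>y. \<lambda>k\<in>{..<N}. x k + sqrt t * y k"
  let ?rhs = "\<lambda>\<epsilon>. \<Prod>i\<in>I. (?H i + 2 * \<epsilon>) powr c i"
  \<comment> \<open>The law of the argument of \<open>f i\<close> on the right-hand side, as a Borel measure on the Polish space of all
    sequences, where outer regularity is available.\<close>
  define \<mu> where "\<mu> i = distr (gauss (n i)) (borel :: (nat \<Rightarrow> real) measure)
      (\<lambda>z. \<lambda>k\<in>{..<n i}. mv N (b i) x k + sqrt t * z k)" for i
  have mm: "(\<lambda>z. \<lambda>k\<in>{..<n i}. mv N (b i) x k + sqrt t * z k) \<in> measurable (gauss (n i)) (borel :: (nat \<Rightarrow> real) measure)" for i
    by (rule measurable_compose[OF measurable_move measurable_euc_to_borel])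
  have \<mu>: "prob_space (\<mu> i)" for i unfolding \<mu>_def by (rule gauss.prob_space_distr[OF mm])
  have s\<mu>: "sets (\<mu> i) = sets borel" for i by (simp add: \<mu>_def)
  define f' where "f' i z = f i (restrict z {..<n i})" for i z
  have fm: "f i \<in> borel_measurable (euc_borel (n i))" and fb: "\<And>y. y \<in> euc (n i) \<Longrightarrow> 0 \<le> f i y"
    "\<And>y. y \<in> euc (n i) \<Longrightarrow> f i y \<le> R" if "i \<in> I" for i
    using ad that by (auto simp: admissible_def)
  have f'm: "f' i \<in> borel_measurable borel" if "i \<in> I" for i
    unfolding f'_def by (rule measurable_compose[OF measurable_borel_to_euc fm[OF that]])
  have f'b: "0 \<le> f' i z" "f' i z \<le> R" if "i \<in> I" for i z
    unfolding f'_def using fb[OF that] by auto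
  have \<mu>_heat: "(\<integral>z. F z \<partial>\<mu> i) = heat (n i) t F (mv N (b i) x)" if "F \<in> borel_measurable borel" for F i
    unfolding \<mu>_def heat_def by (rule integral_distr[OF mm that])
  have f'_heat: "(\<integral>z. f' i z \<partial>\<mu> i) = ?H i" if "i \<in> I" for i
    unfolding \<mu>_heat[OF f'm[OF that]] unfolding heat_def f'_def by simp
  have F0: "0 \<le> ?H i" if "i \<in> I" for i
    using admissible_heat(1)[OF ad that] .
  have main: "heat N t (flow f 0) x \<le> ?rhs \<epsilon>"
    if \<epsilon>: "0 < \<epsilon>" for \<epsilon>
  proof -
    define maj where "maj i g L B \<longleftrightarrow> (\<forall>k. continuous_on UNIV (g k)) \<and> (\<forall>k x. 0 \<le> g k x \<and> g k x \<le> B) \<and>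
      (\<forall>x. (\<lambda>k::nat. g k x) \<longlonglongrightarrow> L x) \<and> (\<forall>x. f' i x \<le> L x) \<and>
      (\<forall>k. (\<integral>x. g k x \<partial>\<mu> i) \<le> (\<integral>x. f' i x \<partial>\<mu> i) + \<epsilon>)" for i g L and B :: real
    have "\<forall>i\<in>I. \<exists>G. maj i (fst G) (fst (snd G)) (snd (snd G))"
    proof
      fix i assume i: "i \<in> I"
      obtain g L B where "maj i g L B"
        using continuous_majorant[OF \<mu> s\<mu> f'm[OF i] f'b[OF i] \<epsilon>] unfolding maj_def by blast
      then show "\<exists>G. maj i (fst G) (fst (snd G)) (snd (snd G))" by (intro exI[of _ "(g, L, B)"]) simp
    qed
    from bchoice[OF this] obtain G where G: "\<And>i. i \<in> I \<Longrightarrow> maj i (fst (G i)) (fst (snd (G i))) (snd (snd (G i)))"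
      by blast
    define g where "g i = fst (G i)" for i
    define L where "L i = fst (snd (G i))" for i
    define B where "B i = snd (snd (G i))" for i
    have gc: "continuous_on UNIV (g i k)" and g0: "0 \<le> g i k z" and gB: "g i k z \<le> B i"
      and gl: "(\<lambda>k. g i k z) \<longlonglongrightarrow> L i z" and fL: "f' i z \<le> L i z"
      and gi: "(\<integral>z. g i k z \<partial>\<mu> i) \<le> (\<integral>z. f' i z \<partial>\<mu> i) + \<epsilon>" if "i \<in> I" for i k z
      using G[OF that] unfolding maj_def g_def L_def B_def by auto
    have B0: "0 \<le> B i" if "i \<in> I" for i using g0[OF that] gB[OF that] by (meson order_trans)
    define hi where "hi = (\<Sum>i\<in>I. B i) + \<epsilon>"
    let ?U = "\<Prod>i\<in>I. hi powr c i"
    have Bhi: "B i + \<epsilon> \<le> hi" if "i \<in> I" for i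
      unfolding hi_def using that fin B0 by (auto intro: member_le_sum)
    have hi: "\<epsilon> \<le> hi" unfolding hi_def using B0 by (simp add: sum_nonneg)
    define \<phi> where "\<phi> k i z = g i k z + \<epsilon>" for k i z
    have \<phi>c: "continuous_on UNIV (\<phi> k i)" if "i \<in> I" for k i
      unfolding \<phi>_def by (intro continuous_intros gc[OF that])
    have \<phi>b: "\<epsilon> \<le> \<phi> k i z" "\<phi> k i z \<le> hi" if "i \<in> I" for k i z
      unfolding \<phi>_def using g0[OF that, of k z] gB[OF that, of k z] Bhi[OF that] by auto
    have ad\<phi>: "admissible \<epsilon> hi (\<phi> k)" for k
      unfolding admissible_def using \<phi>c \<phi>b by (auto intro: continuous_imp_measurable_euc)
    have step: "heat N t (flow (\<phi> k) 0) x \<le> ?rhs \<epsilon>" for k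
    proof -
      have "heat N t (flow (\<phi> k) 0) x \<le> flow (\<phi> k) t x"
        by (rule heat_inequality_continuous[OF \<phi>c \<phi>b \<epsilon> hi t])
      also have "\<dots> \<le> ?rhs \<epsilon>"
        unfolding flow_def
      proof (rule prod_mono, rule conjI)
        fix i assume i: "i \<in> I"
        have gm: "g i k \<in> borel_measurable borel" by (rule borel_measurable_continuous_onI[OF gc[OF i]])
        interpret \<mu>: prob_space "\<mu> i" by (rule \<mu>)
        have gint: "integrable (\<mu> i) (g i k)"
        proof (rule \<mu>.integrable_const_bound)
          show "AE z in \<mu> i. norm (g i k z) \<le> B i" using g0[OF i] gB[OF i] by simp
          show "g i k \<in> borel_measurable (\<mu> i)"
            unfolding measurable_cong_sets[OF s\<mu> refl] by (rule gm)
        qed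
        have "heat (n i) t (\<phi> k i) (mv N (b i) x) = (\<integral>z. \<phi> k i z \<partial>\<mu> i)"
          by (rule \<mu>_heat[symmetric], rule borel_measurable_continuous_onI[OF \<phi>c[OF i]])
        also have "\<dots> = (\<integral>z. g i k z \<partial>\<mu> i) + \<epsilon>"
          unfolding \<phi>_def using gint by (simp add: \<mu>.prob_space)
        also have "\<dots> \<le> ?H i + 2 * \<epsilon>"
          using gi[OF i, of k] unfolding f'_heat[OF i] by simp
        finally have le: "heat (n i) t (\<phi> k i) (mv N (b i) x) \<le> ?H i + 2 * \<epsilon>" .
        show "0 \<le> heat (n i) t (\<phi> k i) (mv N (b i) x) powr c i" by simp
        show "heat (n i) t (\<phi> k i) (mv N (b i) x) powr c i
            \<le> (?H i + 2 * \<epsilon>) powr c i"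
          using le admissible_heat(1)[OF ad\<phi> i, of t k "mv N (b i) x"] \<epsilon> c_pos[OF i]
          by (intro powr_mono2) auto
      qed
      finally show ?thesis .
    qed
    define \<Phi> where "\<Phi> z = (\<Prod>i\<in>I. (L i (?b i z) + \<epsilon>) powr c i)" for z
    have lim: "(\<lambda>k. flow (\<phi> k) 0 z) \<longlonglongrightarrow> \<Phi> z" for z
      unfolding flow_0 \<Phi>_def \<phi>_def
    proof (rule tendsto_prod)
      fix i assume i: "i \<in> I"
      have "0 \<le> L i y" for y using f'b(1)[OF i, of y] fL[OF i, of y] by linarith
      then have "L i (?b i z) + \<epsilon> \<noteq> 0" using \<epsilon> by (simp add: add_nonneg_pos less_imp_neq[symmetric])
      then show "(\<lambda>k. (g i k (?b i z) + \<epsilon>) powr c i)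
          \<longlonglongrightarrow> (L i (?b i z) + \<epsilon>) powr c i"
        by (intro tendsto_powr tendsto_add tendsto_const gl[OF i])
    qed
    have \<Phi>m: "\<Phi> \<in> borel_measurable (euc_borel N)"
      by (rule borel_measurable_LIMSEQ_real[OF lim measurable_flow[OF ad\<phi>]])
    have \<Phi>b: "\<bar>\<Phi> z\<bar> \<le> ?U" for z
    proof -
      have "(\<lambda>k. \<bar>flow (\<phi> k) 0 z\<bar>) \<longlonglongrightarrow> \<bar>\<Phi> z\<bar>" by (intro tendsto_intros lim)
      then show ?thesis
        by (rule tendsto_upperbound) (auto intro!: abs_flow_le[OF ad\<phi> \<epsilon>] always_eventually)
    qed
    have fm0: "flow f 0 \<in> borel_measurable (euc_borel N)" by (rule measurable_flow[OF ad])
    have f\<Phi>: "0 \<le> flow f 0 z \<and> flow f 0 z \<le> \<Phi> z" for z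
      unfolding flow_0 \<Phi>_def
    proof (intro conjI prod_nonneg prod_mono ballI)
      fix i assume i: "i \<in> I"
      have "f i (?b i z) \<le> L i (?b i z)"
        using fL[OF i, of "?b i z"] by (simp add: f'_def)
      then show "f i (?b i z) powr c i
          \<le> (L i (?b i z) + \<epsilon>) powr c i"
        using \<epsilon> c_pos[OF i] fb[OF i] by (intro powr_mono2) auto
    qed simp_all
    have "heat N t (flow f 0) x \<le> heat N t \<Phi> x"
    proof (rule heat_mono[OF fm0 _ \<Phi>m \<Phi>b])
      show "\<bar>flow f 0 y\<bar> \<le> ?U" for y
        using f\<Phi>[of y] \<Phi>b[of y] by simp
      show "flow f 0 y \<le> \<Phi> y" for y using f\<Phi> by blast
    qed
    also have "heat N t \<Phi> x \<le> ?rhs \<epsilon>"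
    proof (rule tendsto_upperbound)
      show "(\<lambda>k. heat N t (flow (\<phi> k) 0) x) \<longlonglongrightarrow> heat N t \<Phi> x"
        unfolding heat_def[of N]
      proof (rule integral_dominated_convergence)
        show "(\<lambda>y. \<Phi> (?X y)) \<in> borel_measurable (gauss N)"
          by (rule measurable_compose[OF measurable_move \<Phi>m])
        show "(\<lambda>y. flow (\<phi> m) 0 (?X y)) \<in> borel_measurable (gauss N)" for m
          by (rule measurable_compose[OF measurable_move measurable_flow[OF ad\<phi>]])
        show "integrable (gauss N) (\<lambda>_. ?U)" by simp
        show "AE y in gauss N. norm (flow (\<phi> m) 0 (?X y)) \<le> ?U" for m
          using abs_flow_le[OF ad\<phi> \<epsilon>] by simp
        show "AE y in gauss N. (\<lambda>m. flow (\<phi> m) 0 (?X y))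
          \<longlonglongrightarrow> \<Phi> (?X y)"
          using lim by simp
      qed
    qed (use step in simp_all)
    finally show ?thesis .
  qed
  define \<epsilon> where "\<epsilon> m = 1 / real (Suc m)" for m
  have \<epsilon>0: "\<epsilon> \<longlonglongrightarrow> 0" unfolding \<epsilon>_def using LIMSEQ_inverse_real_of_nat by (simp add: inverse_eq_divide)
  have "(\<lambda>m. ?rhs (\<epsilon> m))
      \<longlonglongrightarrow> (\<Prod>i\<in>I. (?H i + 2 * 0) powr c i)"
  proof (rule tendsto_prod)
    fix i assume i: "i \<in> I"
    have "0 \<le> \<epsilon> m" for m by (simp add: \<epsilon>_def)
    then show "(\<lambda>m. (?H i + 2 * \<epsilon> m) powr c i)
      \<longlonglongrightarrow> (?H i + 2 * 0) powr c i"
      using c_pos[OF i] F0[OF i]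
      by (intro tendsto_powr' tendsto_add tendsto_mult tendsto_const \<epsilon>0)
         (auto intro!: always_eventually add_nonneg_nonneg)
  qed
  then have "(\<lambda>m. ?rhs (\<epsilon> m)) \<longlonglongrightarrow> flow f t x"
    by (simp add: flow_def)
  then show ?thesis
  proof (rule tendsto_lowerbound)
    have "0 < \<epsilon> m" for m by (simp add: \<epsilon>_def)
    then show "\<forall>\<^sub>F m in sequentially. heat N t (flow f 0) x
        \<le> ?rhs (\<epsilon> m)"
      by (intro always_eventually allI main)
  qed simp
qed

end

section \<open>Unbounded functions and the Brascamp-Lieb inequality\<close>

lemma euc_linear_matrix:
  assumes T: "euc_linear d e T" and x: "x \<in> euc d" and k: "k < e"
  shows "T x k = (\<Sum>j<d. T (euc_unit d j) k * x j)"
proof -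
  have "T x k = euc_inner e (euc_unit e k) (T x)" by (rule euc_inner_unit[OF k, symmetric])
  also have "\<dots> = euc_inner e (T x) (euc_unit e k)" by (simp add: euc_inner_def mult.commute)
  also have "\<dots> = euc_inner d x (euc_adjoint d e T (euc_unit e k))"
    by (rule euc_adjoint_inner[OF T x])
  also have "\<dots> = (\<Sum>j<d. x j * euc_inner e (T (euc_unit d j)) (euc_unit e k))"
    by (simp add: euc_inner_def[of d] euc_adjoint_def)
  also have "\<dots> = (\<Sum>j<d. T (euc_unit d j) k * x j)"
  proof (rule sum.cong[OF refl])
    fix j
    have "euc_inner e (T (euc_unit d j)) (euc_unit e k) = euc_inner e (euc_unit e k) (T (euc_unit d j))"
      by (simp add: euc_inner_def mult.commute)
    also have "\<dots> = T (euc_unit d j) k" by (rule euc_inner_unit[OF k])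
    finally show "x j * euc_inner e (T (euc_unit d j)) (euc_unit e k) = T (euc_unit d j) k * x j" by simp
  qed
  finally show ?thesis .
qed

lemma heat_semigroup_eq:
  "heat_semigroup d t f x = (\<integral>\<^sup>+ y. ennreal (f (\<lambda>k\<in>{..<d}. x k + sqrt t * y k)) \<partial>gauss d)"
proof -
  have "euc_add d x (euc_scale d (sqrt t) y) = (\<lambda>k\<in>{..<d}. x k + sqrt t * y k)" for y
    by (auto simp: euc_add_def euc_scale_def)
  then show ?thesis by (simp add: heat_semigroup_def std_gaussian_eq)
qed

lemma heat_semigroup_bounded:
  assumes F: "F \<in> borel_measurable (euc_borel d)" and b: "\<And>y. y \<in> euc d \<Longrightarrow> 0 \<le> F y" "\<And>y. y \<in> euc d \<Longrightarrow> F y \<le> M"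
  shows "(\<integral>\<^sup>+ y. ennreal (F (\<lambda>k\<in>{..<d}. x k + sqrt t * y k)) \<partial>gauss d) = ennreal (heat d t F x)"
  unfolding heat_def
proof (rule nn_integral_eq_integral)
  show "integrable (gauss d) (\<lambda>y. F (\<lambda>k\<in>{..<d}. x k + sqrt t * y k))"
    using b by (intro integrable_heat[OF F, where M=M]) (simp add: abs_le_iff order_trans[of _ 0])
  show "AE y in gauss d. 0 \<le> F (\<lambda>k\<in>{..<d}. x k + sqrt t * y k)"
    using b by simp
qed

lemma ennreal_powr_mono:
  assumes "0 \<le> a" "ennreal a \<le> X" "0 < c"
  shows "ennreal (a powr c) \<le> ennreal_powr X c"
proof (cases "X = \<infinity>")
  case False
  then have "X = ennreal (enn2real X)" by (simp add: less_top)
  then have "a \<le> enn2real X" using assms by (metis enn2real_nonneg ennreal_le_iff)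
  then show ?thesis unfolding ennreal_powr_def using assms False by (simp add: ennreal_leI powr_mono2)
qed (simp add: ennreal_powr_def)

context geometric_datum
begin

text \<open>
  Truncation at height \<open>m\<close> and monotone convergence on the left. Since each truncated inequality
  involves only finite factors, an infinite factor beside a vanishing one causes no ambiguity: if some
  factor is \<open>0\<close>, every truncated left-hand side is \<open>0\<close>.
\<close>

lemma heat_semigroup_inequality:
  assumes f: "\<And>i. i \<in> I \<Longrightarrow> f i \<in> borel_measurable (euc_borel (n i))"
    and f0: "\<And>i y. i \<in> I \<Longrightarrow> y \<in> euc (n i) \<Longrightarrow> 0 \<le> f i y" and t: "0 \<le> t"
    and h: "\<And>y. y \<in> euc N \<Longrightarrow> h y \<le> (\<Prod>i\<in>I. f i (restrict (mv N (b i) y) {..<n i}) powr c i)"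
  shows "heat_semigroup N t h x
    \<le> (\<Prod>i\<in>I. ennreal_powr (heat_semigroup (n i) t (f i) (mv N (b i) x)) (c i))"
proof -
  let ?b = "\<lambda>i z. restrict (mv N (b i) z) {..<n i}"
  let ?X = "\<lambda>y. \<lambda>k\<in>{..<N}. x k + sqrt t * y k"
  let ?rhs = "\<Prod>i\<in>I. ennreal_powr (heat_semigroup (n i) t (f i) (mv N (b i) x)) (c i)"
  define f' where "f' m i y = min (f i y) (real m)" for m :: nat and i y
  have f'm: "f' m i \<in> borel_measurable (euc_borel (n i))" if "i \<in> I" for m i
    unfolding f'_def using f[OF that] by (intro borel_measurable_min) simp_all
  have f'b: "0 \<le> f' m i y" "f' m i y \<le> real m" if "i \<in> I" "y \<in> euc (n i)" for m i y
    unfolding f'_def using f0[OF that] by simp_all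
  have ad: "admissible 0 (real m) (f' m)" for m
    unfolding admissible_def using f'm f'b by auto
  define G where "G m z = flow (f' m) 0 z" for m z
  have Gm: "G m \<in> borel_measurable (euc_borel N)" for m
    unfolding G_def by (rule measurable_flow[OF ad])
  have Gb: "0 \<le> G m z" "G m z \<le> (\<Prod>i\<in>I. real m powr c i)" for m z
  proof -
    show "0 \<le> G m z" unfolding G_def flow_def by (intro prod_nonneg) simp
    show "G m z \<le> (\<Prod>i\<in>I. real m powr c i)"
      unfolding G_def flow_0 using f'b by (intro prod_mono conjI powr_mono2 less_imp_le[OF c_pos]) auto
  qed
  have bound: "(\<integral>\<^sup>+ y. ennreal (G m (?X y)) \<partial>gauss N)
    \<le> ?rhs" for m
  proof -
    have "(\<integral>\<^sup>+ y. ennreal (G m (?X y)) \<partial>gauss N) = ennreal (heat N t (G m) x)"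
      by (rule heat_semigroup_bounded[OF Gm Gb])
    also have "\<dots> \<le> ennreal (flow (f' m) t x)"
      unfolding G_def using heat_inequality_bounded[OF ad t] by (intro ennreal_leI)
    also have "\<dots> = (\<Prod>i\<in>I. ennreal (heat (n i) t (f' m i) (mv N (b i) x) powr c i))"
      unfolding flow_def by (simp add: prod_ennreal)
    also have "\<dots> \<le> ?rhs"
    proof (rule prod_mono_ennreal)
      fix i assume i: "i \<in> I"
      show "ennreal (heat (n i) t (f' m i) (mv N (b i) x) powr c i)
        \<le> ennreal_powr (heat_semigroup (n i) t (f i) (mv N (b i) x)) (c i)"
      proof (rule ennreal_powr_mono[OF _ _ c_pos[OF i]])
        show "0 \<le> heat (n i) t (f' m i) (mv N (b i) x)" by (rule admissible_heat(1)[OF ad i])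
        have "ennreal (heat (n i) t (f' m i) (mv N (b i) x))
          = (\<integral>\<^sup>+ y. ennreal (f' m i (\<lambda>k\<in>{..<n i}. mv N (b i) x k + sqrt t * y k)) \<partial>gauss (n i))"
          by (rule heat_semigroup_bounded[OF f'm[OF i] f'b[OF i], symmetric])
        also have "\<dots> \<le> heat_semigroup (n i) t (f i) (mv N (b i) x)"
          unfolding heat_semigroup_eq f'_def by (intro nn_integral_mono ennreal_leI) simp
        finally show "ennreal (heat (n i) t (f' m i) (mv N (b i) x))
          \<le> heat_semigroup (n i) t (f i) (mv N (b i) x)" .
      qed
    qed
    finally show ?thesis .
  qed
  have mono: "incseq (\<lambda>m y. ennreal (G m (?X y)))"
  proof (intro incseq_SucI le_funI ennreal_leI)
    fix m y
    show "G m (?X y) \<le> G (Suc m) (?X y)"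
      unfolding G_def flow_0
    proof (rule prod_mono, rule conjI)
      fix i assume i: "i \<in> I"
      let ?y = "?b i (?X y)"
      have "f' m i ?y \<le> f' (Suc m) i ?y" unfolding f'_def by auto
      then show "f' m i ?y powr c i \<le> f' (Suc m) i ?y powr c i"
        using f'b(1)[OF i] c_pos[OF i] by (intro powr_mono2) auto
    qed simp
  qed
  have "heat_semigroup N t h x \<le> (\<integral>\<^sup>+ y. (SUP m. ennreal (G m (?X y))) \<partial>gauss N)"
    unfolding heat_semigroup_eq
  proof (rule nn_integral_mono)
    fix y
    define z where "z = ?X y"
    obtain m :: nat where m: "(\<Sum>i\<in>I. \<bar>f i (?b i z)\<bar>) \<le> real m"
      using real_arch_simple by blast
    have "f' m i (?b i z) = f i (?b i z)" if i: "i \<in> I" for i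
    proof -
      have "\<bar>f i (?b i z)\<bar> \<le> (\<Sum>i\<in>I. \<bar>f i (?b i z)\<bar>)"
        using i fin by (intro member_le_sum[of i I "\<lambda>i. \<bar>f i (?b i z)\<bar>"]) auto
      then show ?thesis using m unfolding f'_def by simp
    qed
    then have "G m z = (\<Prod>i\<in>I. f i (?b i z) powr c i)"
      unfolding G_def flow_0 by (intro prod.cong) auto
    moreover have "z \<in> euc N" by (simp add: z_def)
    ultimately have "h z \<le> G m z" using h by simp
    then have "ennreal (h z) \<le> ennreal (G m z)" by (rule ennreal_leI)
    also have "\<dots> \<le> (SUP m. ennreal (G m z))" by (rule SUP_upper) simp
    finally show "ennreal (h (?X y))
      \<le> (SUP m. ennreal (G m (?X y)))" unfolding z_def .
  qed
  also have "\<dots> = (SUP m. \<integral>\<^sup>+ y. ennreal (G m (?X y)) \<partial>gauss N)"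
  proof (rule nn_integral_monotone_convergence_SUP[OF mono])
    show "(\<lambda>y. ennreal (G m (?X y))) \<in> borel_measurable (gauss N)" for m
      by (intro measurable_compose[OF _ measurable_ennreal] measurable_compose[OF measurable_move Gm])
  qed
  also have "\<dots> \<le> ?rhs"
    by (intro SUP_least bound)
  finally show ?thesis .
qed

end

theorem theorem5:
  fixes m N :: nat and n :: "nat \<Rightarrow> nat" and c :: "nat \<Rightarrow> real"
    and B :: "nat \<Rightarrow> (nat \<Rightarrow> real) \<Rightarrow> (nat \<Rightarrow> real)"
    and h :: "(nat \<Rightarrow> real) \<Rightarrow> real"
    and f :: "nat \<Rightarrow> (nat \<Rightarrow> real) \<Rightarrow> real"
  assumes "m \<ge> 1" and "N \<ge> 1" and "\<And>i. i \<in> {1..m} \<Longrightarrow> n i \<ge> 1"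
    and "\<And>i. i \<in> {1..m} \<Longrightarrow> c i > 0"
    and "\<And>i. i \<in> {1..m} \<Longrightarrow> euc_linear N (n i) (B i)"
    and "\<And>i y. i \<in> {1..m} \<Longrightarrow> y \<in> euc (n i) \<Longrightarrow> B i (euc_adjoint N (n i) (B i) y) = y"
    and "\<And>x k. x \<in> euc N \<Longrightarrow> k < N \<Longrightarrow>
           (\<Sum>i=1..m. c i * euc_adjoint N (n i) (B i) (B i x) k) = x k"
    and "h \<in> borel_measurable (euc_borel N)"
    and "\<And>x. x \<in> euc N \<Longrightarrow> h x \<ge> 0"
    and "\<And>i. i \<in> {1..m} \<Longrightarrow> f i \<in> borel_measurable (euc_borel (n i))"
    and "\<And>i y. i \<in> {1..m} \<Longrightarrow> y \<in> euc (n i) \<Longrightarrow> f i y \<ge> 0"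
    and "\<And>x. x \<in> euc N \<Longrightarrow> h x \<le> (\<Prod>i=1..m. f i (B i x) powr c i)"
  shows "\<forall>t\<ge>0. \<forall>x\<in>euc N.
           heat_semigroup N t h x
             \<le> (\<Prod>i=1..m. ennreal_powr (heat_semigroup (n i) t (f i) (B i x)) (c i))"
proof (intro allI impI ballI)
  fix t :: real and x assume t: "0 \<le> t" and x: "x \<in> euc N"
  define b where "b i k j = B i (euc_unit N j) k" for i k j
  have B_mv: "B i z = restrict (mv N (b i) z) {..<n i}" if i: "i \<in> {1..m}" and z: "z \<in> euc N" for i z
  proof -
    have "B i z \<in> euc (n i)" using assms(5)[OF i] z by (simp add: euc_linear_def)
    then show ?thesis
      using euc_linear_matrix[OF assms(5)[OF i] z]
      by (intro PiE_ext[of _ "{..<n i}" "\<lambda>_. UNIV"]) (auto simp: euc_def mv_def b_def)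
  qed
  have adj: "euc_adjoint N (n i) (B i) y j = (\<Sum>k<n i. b i k j * y k)" if "j < N" for i y j
    using that by (simp add: euc_adjoint_def euc_inner_def b_def)
  interpret geometric_datum "{1..m}" N n c b
  proof
    fix i k l assume i: "i \<in> {1..m}" and kl: "k < n i" "l < n i"
    have "B i (euc_adjoint N (n i) (B i) (euc_unit (n i) l)) k = (if k = l then 1 else 0)"
      using assms(6)[OF i euc_unit_mem] kl by (simp add: euc_unit_def)
    moreover have "B i (euc_adjoint N (n i) (B i) (euc_unit (n i) l)) k
      = (\<Sum>j<N. b i k j * euc_adjoint N (n i) (B i) (euc_unit (n i) l) j)"
      unfolding B_mv[OF i euc_adjoint_mem] using kl by (simp add: mv_def)
    moreover have "euc_adjoint N (n i) (B i) (euc_unit (n i) l) j = b i l j" if "j < N" for j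
      unfolding adj[OF that] using kl
      by (simp add: euc_unit_def if_distrib[of "\<lambda>x. _ * x"] cong: if_cong)
    ultimately show "(\<Sum>j<N. b i k j * b i l j) = (if k = l then 1 else 0)" by simp
  next
    fix j l assume jl: "j < N" "l < N"
    have "(\<Sum>i=1..m. c i * euc_adjoint N (n i) (B i) (B i (euc_unit N l)) j) = (if j = l then 1 else 0)"
      using assms(7)[OF euc_unit_mem jl(1), of l] jl by (simp add: euc_unit_def)
    then show "(\<Sum>i\<in>{1..m}. c i * (\<Sum>k<n i. b i k j * b i k l)) = (if j = l then 1 else 0)"
      unfolding adj[OF jl(1)] by (simp add: b_def)
  qed (use assms(4) in simp_all)
  have "heat_semigroup N t h x
    \<le> (\<Prod>i=1..m. ennreal_powr (heat_semigroup (n i) t (f i) (mv N (b i) x)) (c i))"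
  proof (rule heat_semigroup_inequality[OF assms(10) assms(11) t])
    fix y assume y: "y \<in> euc N"
    have "(\<Prod>i=1..m. f i (B i y) powr c i) = (\<Prod>i=1..m. f i (restrict (mv N (b i) y) {..<n i}) powr c i)"
      by (intro prod.cong refl) (simp only: B_mv[OF _ y])
    then show "h y \<le> (\<Prod>i=1..m. f i (restrict (mv N (b i) y) {..<n i}) powr c i)"
      using assms(12)[OF y] by simp
  qed simp_all
  also have "\<dots> = (\<Prod>i=1..m. ennreal_powr (heat_semigroup (n i) t (f i) (B i x)) (c i))"
  proof (rule prod.cong[OF refl])
    fix i assume i: "i \<in> {1..m}"
    have "heat_semigroup (n i) t (f i) (mv N (b i) x) = heat_semigroup (n i) t (f i) (B i x)"
      unfolding heat_semigroup_eq B_mv[OF i x]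
      by (intro nn_integral_cong arg_cong[of _ _ "\<lambda>z. ennreal (f i z)"]) auto
    then show "ennreal_powr (heat_semigroup (n i) t (f i) (mv N (b i) x)) (c i)
      = ennreal_powr (heat_semigroup (n i) t (f i) (B i x)) (c i)" by simp
  qed
  finally show "heat_semigroup N t h x
    \<le> (\<Prod>i=1..m. ennreal_powr (heat_semigroup (n i) t (f i) (B i x)) (c i))" .
qed

end
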